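(* Let a wildfire spread in a smooth manifold $M$ under a wind $W$ which is a Killing vector field of the Riemannian manifold $(M,h)$, the propagation being governed by the Randers metric $F$ with Zermelo data $(h;W)$. Let $A$ be the wavefront at time $0$ and let $\varphi$ be the flow of $W$. Then: (i) For every $p\in A$, the wave rays emanating from $p$ are the curves $\gamma_F(t)=\varphi(t,\gamma_h(t))$, where $\gamma_h$ is an $h$-geodesic such that $\gamma_h(0)=p$, $|\gamma_h'(t)|_h=1$, and $d\varphi_p\gamma_h'(0)$ is $h$-orthogonal to $A$. (ii) For every $p\in M$, the spherical wavefront at time $\tau$ with center $p$ is the set $$\{\varphi(\tau,\gamma_h(\tau)) : \gamma_h \text{ is a unit speed } h\text{-geodesic with } \gamma_h(0)=p\}.$$ (iii) The wavefront at time $\tau$ is the set $$\{\varphi(\tau,\gamma_h(\tau)) : \gamma_h \text{ is an } h\text{-geodesic with } p=\gamma_h(0)\in A,\ d\varphi_p\gamma_h'(0)\ h\text{-orthogonal to } A,\ |\gamma_h'|_h=1\}.$$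
   Context: Zermelo data: for a Riemannian metric $h$ and a vector field $W$ on $M$ with $h(W,W)<1$, the Randers metric with Zermelo data $(h;W)$ is $F(V)=\frac{\sqrt{h(W,V)^2+\lambda h(V,V)}-h(W,V)}{\lambda}$, $\lambda=1-h(W,W)$; equivalently $F$ is positively homogeneous and $F(V)=1$ iff $h(V-W,V-W)=1$. Write $|V|_h=\sqrt{h(V,V)}$. $W$ is Killing if $\mathcal{L}_Wh=0$, equivalently its flow consists of isometries of $(M,h)$. The flow satisfies $\varphi(0,p)=p$ and $t\mapsto\varphi(t,p)$ is an integral curve of $W$. The symbol $d\varphi_p$ denotes the differential at $p$ of the time-$0$ map $x\mapsto\varphi(0,x)$ (so that $\gamma_F'(0)=W(p)+d\varphi_p\gamma_h'(0)$). Distance: the length of a piecewise smooth curve $\gamma:[0,1]\to M$ is $\int_0^1F(\gamma'(t))\,dt$; $d(p,q)$ is the infimum of lengths of such curves from $p$ to $q$; $d(A,q)=\inf_{p\in A}d(p,q)$ and $\rho(q)=d(A,q)$. An $F$-geodesic is a smooth curve that is locally the shortest-time path between nearby points on it; unit speed means $F(\gamma')=1$. Fire model: the fire starts at time $0$ from $A$, a compact smooth submanifold of $M$ (possibly a point). The wavefront at time $\tau$ is $\rho^{-1}(\tau)$, the set of points first reached at time $\tau$. The spherical wavefront at time $\tau$ with center $p$ is the wavefront at time $\tau$ when $A$ is replaced by $\{p\}$. A wave ray from $A$ is a unit-speed shortest-time path from $A$, i.e. $\gamma(0)\in A$ and $d(A,\gamma(t))=t$ for the times considered. Standing assumption (the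 fire is stopped before cut loci or singularities appear): all times $t,\tau$ lie in $(0,r]$, where $r$ is such that every unit-speed $F$-geodesic leaving $A$ $F$-orthogonally is defined on $[0,r]$ and satisfies $d(A,\gamma(t))=t$ there, every $q$ with $0<\rho(q)\le r$ is reached by such a geodesic at time $\rho(q)$, and the $h$-geodesics and flow lines of $W$ involved are defined for these times. For spherical wavefronts the same is assumed with $A$ replaced by $\{p\}$ (all directions being allowed). A nonzero vector $V$ is $F$-orthogonal to $A$ if $g_V(V,U)=0$ for all $U$ tangent to $A$, where $g_V(V,U)=\frac12\frac{\partial^2}{\partial t\partial s}F^2(V+tV+sU)|_{s=t=0}$; $X$ is $h$-orthogonal to $A$ at $p\in A$ if $h(X,U)=0$ for all $U\in T_pA$. *)

theory Defs
  imports "HOL-Analysis.Analysis"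
begin

section \<open>Smooth maps between Euclidean spaces\<close>

text \<open>\<open>Ck_on k f S\<close> is meant for open \<open>S\<close>. In finite dimension it suffices that all iterated
  directional derivatives exist and are continuous.\<close>

primrec Ck_on ::
  "nat \<Rightarrow> ('a::euclidean_space \<Rightarrow> 'b::euclidean_space) \<Rightarrow> 'a set \<Rightarrow> bool" where
  "Ck_on 0 f S \<longleftrightarrow> continuous_on S f"
| "Ck_on (Suc k) f S \<longleftrightarrow>
     (\<forall>x\<in>S. f differentiable (at x)) \<and>
     (\<forall>v. Ck_on k (\<lambda>x. frechet_derivative f (at x) v) S)"

text \<open>Smoothness on an arbitrary set means that there are local extensions which are smooth on an
  open set. This is what smoothness on a compact interval refers to below.\<close>

definition smooth_on ::
  "'a::euclidean_space set \<Rightarrow> ('a \<Rightarrow> 'b::euclidean_space) \<Rightarrow> bool" where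
  "smooth_on S f \<longleftrightarrow>
     (\<forall>x\<in>S. \<exists>N g. open N \<and> x \<in> N \<and> (\<forall>k. Ck_on k g N) \<and> (\<forall>y\<in>S \<inter> N. g y = f y))"


section \<open>Smooth manifolds\<close>

text \<open>The underlying set of the manifold is the whole type \<open>'m\<close>; the smooth structure is given by an
  atlas. A chart is a pair of its domain and its coordinate map; the values of the coordinate map
  outside of the domain are irrelevant.\<close>

type_synonym ('m, 'e) chart = "'m set \<times> ('m \<Rightarrow> 'e)"

definition chart_inv :: "('m, 'e) chart \<Rightarrow> 'e \<Rightarrow> 'm" where
  "chart_inv c = inv_into (fst c) (snd c)"

definition is_chart :: "('m::topological_space, 'e::euclidean_space) chart \<Rightarrow> bool" where
  "is_chart c \<longleftrightarrow> open (fst c) \<and> open (snd c ` fst c) \<and>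
     homeomorphism (fst c) (snd c ` fst c) (snd c) (chart_inv c)"

definition compatible ::
  "('m, 'e::euclidean_space) chart \<Rightarrow> ('m, 'e) chart \<Rightarrow> bool" where
  "compatible c d \<longleftrightarrow>
     smooth_on (snd c ` (fst c \<inter> fst d)) (snd d \<circ> chart_inv c) \<and>
     smooth_on (snd d ` (fst c \<inter> fst d)) (snd c \<circ> chart_inv d)"

definition smooth_atlas ::
  "('m::{t2_space, second_countable_topology}, 'e::euclidean_space) chart set \<Rightarrow> bool" where
  "smooth_atlas M \<longleftrightarrow>
     (\<forall>c\<in>M. is_chart c) \<and> (\<Union>c\<in>M. fst c) = UNIV \<and> (\<forall>c\<in>M. \<forall>d\<in>M. compatible c d)"

text \<open>The tangent space at \<open>p\<close> is the model space \<open>'e\<close>, a tangent vector being represented by its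
  components in one fixed chart of the atlas around \<open>p\<close>, namely \<open>chart_at M p\<close>. As this chart depends
  on \<open>p\<close> in no particular way, smoothness of tensor fields has to be expressed by passing to the
  components in a chart that does not depend on the point; \<open>to_chart\<close> and \<open>from_chart\<close>
  are these changes of components.\<close>

definition chart_at :: "('m, 'e) chart set \<Rightarrow> 'm \<Rightarrow> ('m, 'e) chart" where
  "chart_at M p = (SOME c. c \<in> M \<and> p \<in> fst c)"

definition to_chart ::
  "('m, 'e::euclidean_space) chart set \<Rightarrow> ('m, 'e) chart \<Rightarrow> 'm \<Rightarrow> 'e \<Rightarrow> 'e" where
  "to_chart M c p V =
     frechet_derivative (snd c \<circ> chart_inv (chart_at M p)) (at (snd (chart_at M p) p)) V"

definition from_chart ::
  "('m, 'e::euclidean_space) chart set \<Rightarrow> ('m, 'e) chart \<Rightarrow> 'm \<Rightarrow> 'e \<Rightarrow> 'e" where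
  "from_chart M c p v =
     frechet_derivative (snd (chart_at M p) \<circ> chart_inv c) (at (snd c p)) v"

text \<open>The differential \<open>T\<^sub>pM \<rightarrow> T\<^sub>f\<^sub>(\<^sub>p\<^sub>)M\<close> of a map that is defined and differentiable near \<open>p\<close>.\<close>

definition differential_at ::
  "('m, 'e::euclidean_space) chart set \<Rightarrow> ('m \<Rightarrow> 'm) \<Rightarrow> 'm \<Rightarrow> 'e \<Rightarrow> 'e" where
  "differential_at M f p V =
     frechet_derivative (snd (chart_at M (f p)) \<circ> f \<circ> chart_inv (chart_at M p))
       (at (snd (chart_at M p) p)) V"


section \<open>Curves and submanifolds\<close>

definition smooth_curve ::
  "('m::topological_space, 'e::euclidean_space) chart set \<Rightarrow> real set \<Rightarrow> (real \<Rightarrow> 'm) \<Rightarrow> bool" where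
  "smooth_curve M I \<gamma> \<longleftrightarrow>
     continuous_on I \<gamma> \<and> (\<forall>c\<in>M. smooth_on (I \<inter> \<gamma> -` fst c) (snd c \<circ> \<gamma>))"

text \<open>At the boundary points of an interval \<open>I\<close> this is the one-sided velocity.\<close>

definition velocity ::
  "('m, 'e::euclidean_space) chart set \<Rightarrow> real set \<Rightarrow> (real \<Rightarrow> 'm) \<Rightarrow> real \<Rightarrow> 'e" where
  "velocity M I \<gamma> t = vector_derivative (snd (chart_at M (\<gamma> t)) \<circ> \<gamma>) (at t within I)"

definition piecewise_smooth_curve ::
  "('m::topological_space, 'e::euclidean_space) chart set \<Rightarrow> real \<Rightarrow> real \<Rightarrow> (real \<Rightarrow> 'm) \<Rightarrow> bool"
  where
  "piecewise_smooth_curve M a b \<gamma> \<longleftrightarrow>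
     continuous_on {a..b} \<gamma> \<and>
     (\<exists>P. finite P \<and>
        (\<forall>s t. a \<le> s \<and> s < t \<and> t \<le> b \<and> {s<..<t} \<inter> P = {} \<longrightarrow> smooth_curve M {s..t} \<gamma>))"

text \<open>Embedded submanifolds, by slice charts from the maximal atlas determined by \<open>M\<close>.\<close>

definition smooth_submanifold ::
  "('m::topological_space, 'e::euclidean_space) chart set \<Rightarrow> 'm set \<Rightarrow> bool" where
  "smooth_submanifold M A \<longleftrightarrow>
     (\<exists>k. \<forall>p\<in>A. \<exists>c S. is_chart c \<and> (\<forall>d\<in>M. compatible c d) \<and> p \<in> fst c \<and>
        subspace S \<and> dim S = k \<and> snd c ` (fst c \<inter> A) = snd c ` fst c \<inter> S)"

definition tangent_to ::
  "('m::topological_space, 'e::euclidean_space) chart set \<Rightarrow> 'm set \<Rightarrow> 'm \<Rightarrow> 'e set" where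
  "tangent_to M A p =
     {velocity M {-e<..<e} c 0 | c e. 0 < e \<and> smooth_curve M {-e<..<e} c \<and>
        c ` {-e<..<e} \<subseteq> A \<and> c 0 = p}"


section \<open>Vector fields, flows and Riemannian metrics\<close>

definition smooth_vector_field ::
  "('m, 'e::euclidean_space) chart set \<Rightarrow> ('m \<Rightarrow> 'e) \<Rightarrow> bool" where
  "smooth_vector_field M W \<longleftrightarrow>
     (\<forall>c\<in>M. smooth_on (snd c ` fst c)
        (\<lambda>x. to_chart M c (chart_inv c x) (W (chart_inv c x))))"

definition integral_curve ::
  "('m::topological_space, 'e::euclidean_space) chart set \<Rightarrow> ('m \<Rightarrow> 'e) \<Rightarrow> real set \<Rightarrow>
     (real \<Rightarrow> 'm) \<Rightarrow> bool" where
  "integral_curve M W J \<sigma> \<longleftrightarrow>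
     continuous_on J \<sigma> \<and>
     (\<forall>t\<in>J. ((snd (chart_at M (\<sigma> t)) \<circ> \<sigma>) has_vector_derivative W (\<sigma> t)) (at t))"

text \<open>\<open>\<phi>\<close> is the flow of \<open>W\<close> with flow domain \<open>D\<close>: the maximal smooth flow generated by \<open>W\<close>, i.e.\ every
  curve \<open>t \<mapsto> \<phi> t p\<close> is the maximal integral curve starting at \<open>p\<close>, and \<open>\<phi>\<close> is jointly smooth on its
  open domain. The values of \<open>\<phi>\<close> outside of \<open>D\<close> are irrelevant; \<open>W\<close> need not be complete.\<close>

definition is_flow ::
  "('m::topological_space, 'e::euclidean_space) chart set \<Rightarrow> ('m \<Rightarrow> 'e) \<Rightarrow> (real \<times> 'm) set \<Rightarrow>
     (real \<Rightarrow> 'm \<Rightarrow> 'm) \<Rightarrow> bool" where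
  "is_flow M W D \<phi> \<longleftrightarrow>
     open D \<and>
     (\<forall>p. (0, p) \<in> D \<and> is_interval {t. (t, p) \<in> D}) \<and>
     (\<forall>p. \<phi> 0 p = p \<and> integral_curve M W {t. (t, p) \<in> D} (\<lambda>t. \<phi> t p)) \<and>
     (\<forall>p J \<sigma>. open J \<and> is_interval J \<and> 0 \<in> J \<and> integral_curve M W J \<sigma> \<and> \<sigma> 0 = p \<longrightarrow>
        (\<forall>t\<in>J. (t, p) \<in> D \<and> \<sigma> t = \<phi> t p)) \<and>
     continuous_on D (\<lambda>(t, p). \<phi> t p) \<and>
     (\<forall>c\<in>M. \<forall>d\<in>M.
        smooth_on {(t, x). x \<in> snd c ` fst c \<and> (t, chart_inv c x) \<in> D \<and> \<phi> t (chart_inv c x) \<in> fst d}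
          (\<lambda>(t, x). snd d (\<phi> t (chart_inv c x))))"

definition riemannian_metric ::
  "('m, 'e::euclidean_space) chart set \<Rightarrow> ('m \<Rightarrow> 'e \<Rightarrow> 'e \<Rightarrow> real) \<Rightarrow> bool" where
  "riemannian_metric M h \<longleftrightarrow>
     (\<forall>p. bilinear (h p)) \<and> (\<forall>p U V. h p U V = h p V U) \<and> (\<forall>p V. V \<noteq> 0 \<longrightarrow> h p V V > 0) \<and>
     (\<forall>c\<in>M. \<forall>u v. smooth_on (snd c ` fst c)
        (\<lambda>x. h (chart_inv c x) (from_chart M c (chart_inv c x) u) (from_chart M c (chart_inv c x) v)))"

text \<open>The Lie derivative of \<open>h\<close> along the generator of \<open>\<phi>\<close> is the derivative at \<open>t = 0\<close> of the
  pullbacks \<open>\<phi>\<^sub>t\<^sup>* h\<close>; a Killing field is one for which it vanishes.\<close>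

definition has_lie_derivative ::
  "('m, 'e::euclidean_space) chart set \<Rightarrow> (real \<Rightarrow> 'm \<Rightarrow> 'm) \<Rightarrow> ('m \<Rightarrow> 'e \<Rightarrow> 'e \<Rightarrow> real) \<Rightarrow>
     ('m \<Rightarrow> 'e \<Rightarrow> 'e \<Rightarrow> real) \<Rightarrow> bool" where
  "has_lie_derivative M \<phi> h L \<longleftrightarrow>
     (\<forall>p U V. ((\<lambda>t. h (\<phi> t p) (differential_at M (\<phi> t) p U) (differential_at M (\<phi> t) p V))
        has_real_derivative L p U V) (at 0))"

definition killing_flow ::
  "('m, 'e::euclidean_space) chart set \<Rightarrow> (real \<Rightarrow> 'm \<Rightarrow> 'm) \<Rightarrow> ('m \<Rightarrow> 'e \<Rightarrow> 'e \<Rightarrow> real) \<Rightarrow> bool" where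
  "killing_flow M \<phi> h \<longleftrightarrow> has_lie_derivative M \<phi> h (\<lambda>p U V. 0)"


section \<open>Finsler metrics, distance and geodesics\<close>

definition riemannian_norm :: "('m \<Rightarrow> 'e \<Rightarrow> 'e \<Rightarrow> real) \<Rightarrow> 'm \<Rightarrow> 'e \<Rightarrow> real" where
  "riemannian_norm h p V = sqrt (h p V V)"

definition randers_metric ::
  "('m \<Rightarrow> 'e \<Rightarrow> 'e \<Rightarrow> real) \<Rightarrow> ('m \<Rightarrow> 'e) \<Rightarrow> 'm \<Rightarrow> 'e \<Rightarrow> real" where
  "randers_metric h W p V =
     (let l = 1 - h p (W p) (W p)
      in (sqrt ((h p (W p) V)\<^sup>2 + l * h p V V) - h p (W p) V) / l)"

definition fundamental_tensor ::
  "('m \<Rightarrow> 'e::euclidean_space \<Rightarrow> real) \<Rightarrow> 'm \<Rightarrow> 'e \<Rightarrow> 'e \<Rightarrow> 'e \<Rightarrow> real" where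
  "fundamental_tensor F p V X U =
     1/2 * deriv (\<lambda>t. deriv (\<lambda>s. (F p (V + t *\<^sub>R X + s *\<^sub>R U))\<^sup>2) 0) 0"

definition finsler_orthogonal ::
  "('m::topological_space, 'e::euclidean_space) chart set \<Rightarrow> ('m \<Rightarrow> 'e \<Rightarrow> real) \<Rightarrow> 'm set \<Rightarrow> 'm \<Rightarrow>
     'e \<Rightarrow> bool" where
  "finsler_orthogonal M F A p V \<longleftrightarrow>
     V \<noteq> 0 \<and> (\<forall>U\<in>tangent_to M A p. fundamental_tensor F p V V U = 0)"

definition riemannian_orthogonal ::
  "('m::topological_space, 'e::euclidean_space) chart set \<Rightarrow> ('m \<Rightarrow> 'e \<Rightarrow> 'e \<Rightarrow> real) \<Rightarrow> 'm set \<Rightarrow>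
     'm \<Rightarrow> 'e \<Rightarrow> bool" where
  "riemannian_orthogonal M h A p X \<longleftrightarrow> (\<forall>U\<in>tangent_to M A p. h p X U = 0)"

definition curve_length ::
  "('m, 'e::euclidean_space) chart set \<Rightarrow> ('m \<Rightarrow> 'e \<Rightarrow> real) \<Rightarrow> real \<Rightarrow> real \<Rightarrow> (real \<Rightarrow> 'm) \<Rightarrow> real"
  where
  "curve_length M F a b \<gamma> = integral {a..b} (\<lambda>t. F (\<gamma> t) (velocity M {a..b} \<gamma> t))"

text \<open>Distances are extended reals: points in different components have distance \<open>\<infinity>\<close>. The first
  argument is the starting point, since the distance need not be symmetric.\<close>

definition finsler_dist ::
  "('m::topological_space, 'e::euclidean_space) chart set \<Rightarrow> ('m \<Rightarrow> 'e \<Rightarrow> real) \<Rightarrow> 'm \<Rightarrow> 'm \<Rightarrow> ereal"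
  where
  "finsler_dist M F p q =
     (INF \<gamma> \<in> {\<gamma>. piecewise_smooth_curve M 0 1 \<gamma> \<and> \<gamma> 0 = p \<and> \<gamma> 1 = q}.
        ereal (curve_length M F 0 1 \<gamma>))"

definition dist_from ::
  "('m::topological_space, 'e::euclidean_space) chart set \<Rightarrow> ('m \<Rightarrow> 'e \<Rightarrow> real) \<Rightarrow> 'm set \<Rightarrow> 'm \<Rightarrow>
     ereal" where
  "dist_from M F A q = (INF p\<in>A. finsler_dist M F p q)"

text \<open>A geodesic on \<open>[0,b]\<close> is a smooth curve that is locally shortest. For \<open>F = riemannian_norm h\<close>,
  which is the Randers metric with zero wind, these are the \<open>h\<close>-geodesics (up to parametrization).\<close>

definition geodesic ::
  "('m::topological_space, 'e::euclidean_space) chart set \<Rightarrow> ('m \<Rightarrow> 'e \<Rightarrow> real) \<Rightarrow> real \<Rightarrow>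
     (real \<Rightarrow> 'm) \<Rightarrow> bool" where
  "geodesic M F b \<gamma> \<longleftrightarrow>
     smooth_curve M {0..b} \<gamma> \<and>
     (\<forall>t\<in>{0..b}. \<exists>e>0. \<forall>s1 s2. {s1, s2} \<subseteq> {0..b} \<inter> {t - e<..<t + e} \<and> s1 \<le> s2 \<longrightarrow>
        finsler_dist M F (\<gamma> s1) (\<gamma> s2) = ereal (curve_length M F s1 s2 \<gamma>))"

definition unit_speed ::
  "('m, 'e::euclidean_space) chart set \<Rightarrow> ('m \<Rightarrow> 'e \<Rightarrow> real) \<Rightarrow> real \<Rightarrow> (real \<Rightarrow> 'm) \<Rightarrow> bool" where
  "unit_speed M F b \<gamma> \<longleftrightarrow> (\<forall>t\<in>{0..b}. F (\<gamma> t) (velocity M {0..b} \<gamma> t) = 1)"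


section \<open>The fire model\<close>

definition wavefront ::
  "('m::topological_space, 'e::euclidean_space) chart set \<Rightarrow> ('m \<Rightarrow> 'e \<Rightarrow> real) \<Rightarrow> 'm set \<Rightarrow> real \<Rightarrow>
     'm set" where
  "wavefront M F A \<tau> = {q. dist_from M F A q = ereal \<tau>}"

definition spherical_wavefront ::
  "('m::topological_space, 'e::euclidean_space) chart set \<Rightarrow> ('m \<Rightarrow> 'e \<Rightarrow> real) \<Rightarrow> 'm \<Rightarrow> real \<Rightarrow>
     'm set" where
  "spherical_wavefront M F p \<tau> = wavefront M F {p} \<tau>"

definition wave_ray ::
  "('m::topological_space, 'e::euclidean_space) chart set \<Rightarrow> ('m \<Rightarrow> 'e \<Rightarrow> real) \<Rightarrow> 'm set \<Rightarrow> real \<Rightarrow>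
     (real \<Rightarrow> 'm) \<Rightarrow> bool" where
  "wave_ray M F A b \<gamma> \<longleftrightarrow>
     smooth_curve M {0..b} \<gamma> \<and> unit_speed M F b \<gamma> \<and> \<gamma> 0 \<in> A \<and>
     (\<forall>t\<in>{0..b}. dist_from M F A (\<gamma> t) = ereal t)"

definition orthogonal_finsler_geodesic ::
  "('m::topological_space, 'e::euclidean_space) chart set \<Rightarrow> ('m \<Rightarrow> 'e \<Rightarrow> real) \<Rightarrow> 'm set \<Rightarrow> real \<Rightarrow>
     (real \<Rightarrow> 'm) \<Rightarrow> bool" where
  "orthogonal_finsler_geodesic M F A b \<gamma> \<longleftrightarrow>
     geodesic M F b \<gamma> \<and> unit_speed M F b \<gamma> \<and> \<gamma> 0 \<in> A \<and>
     finsler_orthogonal M F A (\<gamma> 0) (velocity M {0..b} \<gamma> 0)"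

definition orthogonal_riemannian_geodesic ::
  "('m::topological_space, 'e::euclidean_space) chart set \<Rightarrow> ('m \<Rightarrow> 'e \<Rightarrow> 'e \<Rightarrow> real) \<Rightarrow> 'm set \<Rightarrow>
     real \<Rightarrow> (real \<Rightarrow> 'm) \<Rightarrow> bool" where
  "orthogonal_riemannian_geodesic M h A b \<gamma> \<longleftrightarrow>
     geodesic M (riemannian_norm h) b \<gamma> \<and> unit_speed M (riemannian_norm h) b \<gamma> \<and> \<gamma> 0 \<in> A \<and>
     riemannian_orthogonal M h A (\<gamma> 0) (velocity M {0..b} \<gamma> 0)"

text \<open>The fire is stopped at a time \<open>r\<close> before cut loci or singularities appear: geodesics leaving
  \<open>A\<close> orthogonally can be continued up to time \<open>r\<close> (for \<open>F\<close> and for \<open>h\<close>), the \<open>F\<close>-geodesics among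
  them realise the distance from \<open>A\<close> and reach all points at distance at most \<open>r\<close>, and the
  flow lines of the wind that relate the two kinds of geodesics exist (for time \<open>t\<close> from
  the \<open>h\<close>-geodesic at time \<open>t\<close>, and for time \<open>-t\<close> from the \<open>F\<close>-geodesic at time \<open>t\<close>). For \<open>A = {p}\<close>,
  orthogonality to \<open>A\<close> is no restriction on the direction.\<close>

definition no_cut_before ::
  "('m::topological_space, 'e::euclidean_space) chart set \<Rightarrow> ('m \<Rightarrow> 'e \<Rightarrow> 'e \<Rightarrow> real) \<Rightarrow>
     ('m \<Rightarrow> 'e) \<Rightarrow> (real \<times> 'm) set \<Rightarrow> 'm set \<Rightarrow> real \<Rightarrow> bool" where
  "no_cut_before M h W D A r \<longleftrightarrow>
     0 < r \<and>
     (\<forall>b\<in>{0<..r}. \<forall>\<gamma>. orthogonal_finsler_geodesic M (randers_metric h W) A b \<gamma> \<longrightarrow>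
        (\<exists>\<sigma>. orthogonal_finsler_geodesic M (randers_metric h W) A r \<sigma> \<and>
           (\<forall>t\<in>{0..b}. \<sigma> t = \<gamma> t) \<and>
           (\<forall>t\<in>{0..r}. dist_from M (randers_metric h W) A (\<sigma> t) = ereal t \<and> (-t, \<sigma> t) \<in> D))) \<and>
     (\<forall>b\<in>{0<..r}. \<forall>\<gamma>. orthogonal_riemannian_geodesic M h A b \<gamma> \<longrightarrow>
        (\<exists>\<sigma>. orthogonal_riemannian_geodesic M h A r \<sigma> \<and>
           (\<forall>t\<in>{0..b}. \<sigma> t = \<gamma> t) \<and>
           (\<forall>t\<in>{0..r}. (t, \<sigma> t) \<in> D))) \<and>
     (\<forall>q. 0 < dist_from M (randers_metric h W) A q \<and> dist_from M (randers_metric h W) A q \<le> ereal r \<longrightarrow>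
        (\<exists>\<sigma>. orthogonal_finsler_geodesic M (randers_metric h W) A r \<sigma> \<and>
           \<sigma> (real_of_ereal (dist_from M (randers_metric h W) A q)) = q))"

end

theory Submission
  imports Defs
begin

text \<open>The theorem is Galilean relativity for fires: an observer drifting with the wind sees the fire spread as
  in still air.

  The unit ball of the Randers metric \<open>F\<close> is the unit ball of \<open>h\<close> translated by \<open>W\<close>; that is,
  \<open>F(V) < l\<close> holds if and only if \<open>l > 0\<close> and \<open>V - l W\<close> has \<open>h\<close>-length less than \<open>l\<close>. If a curve \<open>\<sigma>\<close> is traversed
  with a clock \<open>\<tau>\<close> and carried along by the flow, the curve \<open>\<phi>(\<tau>, \<sigma>)\<close> has the velocity \<open>\<tau>' W + d\<phi> \<sigma>'\<close>
  (\<open>moved_curve_velocity\<close>). As \<open>W\<close> is Killing, \<open>d\<phi>\<close> is isometric (\<open>flow_isometry\<close>), so the moved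
  curve is slower than the clock with respect to \<open>F\<close> precisely if \<open>\<sigma>\<close> is slower than the clock with respect to \<open>h\<close>.
  The flow backwards in time reverses this, since it preserves \<open>W\<close> (\<open>flow_preserves_wind\<close>).

  Geodesics are locally shortest curves here, so no geodesic equation is involved: a curve that is faster than
  \<open>\<phi>(t, \<gamma>\<^sub>h(t))\<close> between two of its points is transported by the flow to a curve that is shorter than
  \<open>\<gamma>\<^sub>h\<close> between the corresponding points, and conversely (\<open>transport_piecewise\<close>, \<open>moved_geodesic\<close>). Two technical
  points have to be taken care of. The clock must be smooth, which arc length need not be (\<open>exists_clock\<close>); and
  the flow need not be complete, so competitors must be confined to a small region
  (\<open>short_curves_stay_near\<close>).

  At time \<open>0\<close> the velocities differ by \<open>W\<close>. Since \<open>g\<^sub>V(V, U)\<close> is a positive multiple of \<open>h(V - W, U)\<close> if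
  \<open>F(V) = 1\<close> (\<open>fundamental_tensor_self\<close>), the \<open>F\<close>-geodesics that leave \<open>A\<close> orthogonally correspond to the
  \<open>h\<close>-geodesics that leave \<open>A\<close> orthogonally (\<open>orthogonal_geodesic_iff_moved\<close>). The former are the wave
  rays, by the first variation of length (\<open>shortest_time_orthogonal\<close>) and the assumption on the stopping time, and
  the wavefront consists of their end points. A spherical wavefront is the case of a single
  point \<open>A\<close>, which has no nonzero tangent vectors.\<close>

section \<open>Calculus of smooth maps\<close>

lemma Ck_on_subset: "Ck_on k f S \<Longrightarrow> T \<subseteq> S \<Longrightarrow> Ck_on k f T"
  by (induction k arbitrary: f) (auto intro: continuous_on_subset)

lemma Ck_on_cong:
  assumes "open S" "\<And>x. x \<in> S \<Longrightarrow> f x = g x" "Ck_on k f S"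
  shows "Ck_on k g S"
  using assms(2,3)
proof (induction k arbitrary: f g)
  case 0
  then show ?case by (simp cong: continuous_on_cong)
next
  case (Suc k)
  have g: "(g has_derivative frechet_derivative f (at x)) (at x)" if "x \<in> S" for x
    using has_derivative_transform_within_open[OF _ \<open>open S\<close> that Suc.prems(1)] Suc.prems(2) that
    by (auto simp: frechet_derivative_works)
  show ?case
  proof (simp, intro conjI ballI allI)
    fix x assume "x \<in> S" then show "g differentiable (at x)"
      using g differentiableI by blast
  next
    fix v
    show "Ck_on k (\<lambda>x. frechet_derivative g (at x) v) S"
      by (rule Suc.IH[of "\<lambda>x. frechet_derivative f (at x) v"])
         (use Suc.prems(2) frechet_derivative_at[OF g] in auto)
  qed
qed

lemma Ck_on_has_derivative:
  "Ck_on (Suc k) f S \<Longrightarrow> x \<in> S \<Longrightarrow> (f has_derivative frechet_derivative f (at x)) (at x)"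
  by (simp add: frechet_derivative_works)

lemma Ck_on_SucI:
  assumes "open S" "\<And>x. x \<in> S \<Longrightarrow> (f has_derivative f' x) (at x)" "\<And>v. Ck_on k (\<lambda>x. f' x v) S"
  shows "Ck_on (Suc k) f S"
proof (simp, intro conjI ballI allI)
  fix x assume "x \<in> S" then show "f differentiable (at x)"
    using assms(2) differentiableI by blast
next
  fix v
  show "Ck_on k (\<lambda>x. frechet_derivative f (at x) v) S"
    by (rule Ck_on_cong[OF assms(1) _ assms(3)[of v]]) (use frechet_derivative_at[OF assms(2)] in auto)
qed

lemma Ck_on_SucD: "Ck_on (Suc k) f S \<Longrightarrow> Ck_on k f S"
proof (induction k arbitrary: f)
  case 0
  then show ?case
    by (simp add: continuous_at_imp_continuous_on differentiable_imp_continuous_within)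
qed simp

lemma Ck_on_const: "Ck_on k (\<lambda>x. c) S"
proof (induction k arbitrary: c)
  case (Suc k)
  have "(\<lambda>x. frechet_derivative (\<lambda>x. c) (at x) v) = (\<lambda>x. 0)" for v :: 'b and c :: 'a
    by (simp add: frechet_derivative_const)
  with Suc show ?case by simp
qed simp

lemma Ck_on_bounded_linear:
  assumes "bounded_linear L" "open S" "Ck_on k f S"
  shows "Ck_on k (\<lambda>x. L (f x)) S"
  using assms(3)
proof (induction k arbitrary: f)
  case 0
  then show ?case using assms(1) by (simp add: bounded_linear.continuous_on)
next
  case (Suc k)
  show ?case
  proof (rule Ck_on_SucI[OF assms(2)])
    show "((\<lambda>x. L (f x)) has_derivative (\<lambda>v. L (frechet_derivative f (at x) v))) (at x)"
      if "x \<in> S" for x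
      by (rule bounded_linear.has_derivative[OF assms(1) Ck_on_has_derivative[OF Suc.prems that]])
    show "Ck_on k (\<lambda>x. L (frechet_derivative f (at x) v)) S" for v
      using Suc by simp
  qed
qed

lemma Ck_on_ident: "open S \<Longrightarrow> Ck_on k (\<lambda>x. x) S"
proof (induction k)
  case (Suc k)
  show ?case
    by (rule Ck_on_SucI[OF Suc.prems, where f' = "\<lambda>x v. v"]) (auto intro: Ck_on_const)
qed simp

lemma Ck_on_linear: "bounded_linear L \<Longrightarrow> open S \<Longrightarrow> Ck_on k L S"
  using Ck_on_bounded_linear[OF _ _ Ck_on_ident] by blast

lemma Ck_on_add:
  assumes "open S" "Ck_on k f S" "Ck_on k g S"
  shows "Ck_on k (\<lambda>x. f x + g x) S"
  using assms(2,3)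
proof (induction k arbitrary: f g)
  case (Suc k)
  show ?case
  proof (rule Ck_on_SucI[OF assms(1)])
    show "((\<lambda>x. f x + g x) has_derivative
        (\<lambda>v. frechet_derivative f (at x) v + frechet_derivative g (at x) v)) (at x)" if "x \<in> S" for x
      by (rule has_derivative_add[OF Ck_on_has_derivative Ck_on_has_derivative]; fact)
    show "Ck_on k (\<lambda>x. frechet_derivative f (at x) v + frechet_derivative g (at x) v) S" for v
      using Suc by simp
  qed
qed (simp add: continuous_on_add)

lemma Ck_on_sum:
  assumes "open S" "\<And>i. i \<in> I \<Longrightarrow> Ck_on k (f i) S"
  shows "Ck_on k (\<lambda>x. \<Sum>i\<in>I. f i x) S"
  using assms(2)
  by (induction I rule: infinite_finite_induct) (auto simp: Ck_on_const intro!: Ck_on_add[OF assms(1)])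

lemma Ck_on_scaleR:
  assumes "open S" "Ck_on k f S" "Ck_on k g S"
  shows "Ck_on k (\<lambda>x. f x *\<^sub>R g x) S"
  using assms(2,3)
proof (induction k arbitrary: f g)
  case (Suc k)
  show ?case
  proof (rule Ck_on_SucI[OF assms(1)])
    show "((\<lambda>x. f x *\<^sub>R g x) has_derivative
        (\<lambda>v. f x *\<^sub>R frechet_derivative g (at x) v + frechet_derivative f (at x) v *\<^sub>R g x)) (at x)"
      if "x \<in> S" for x
      by (rule has_derivative_scaleR[OF Ck_on_has_derivative Ck_on_has_derivative]; fact)
    show "Ck_on k (\<lambda>x. f x *\<^sub>R frechet_derivative g (at x) v + frechet_derivative f (at x) v *\<^sub>R g x) S"
      for v
      using Suc.prems Ck_on_SucD[OF Suc.prems(1)] Ck_on_SucD[OF Suc.prems(2)]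
      by (intro Ck_on_add[OF assms(1)] Suc.IH) auto
  qed
qed (simp add: continuous_on_scaleR)

text \<open>As \<open>Ck_on\<close> speaks of directional derivatives only, the inner derivative is expanded in the basis, so
  that the derivative of the composition becomes a sum of products to which the induction hypothesis
  applies: the outer factors are the partial derivatives of \<open>g\<close>, composed with \<open>f\<close>.\<close>

lemma Ck_on_compose:
  fixes f :: "'a::euclidean_space \<Rightarrow> 'b::euclidean_space" and g :: "'b \<Rightarrow> 'c::euclidean_space"
  assumes "open S" "open T" "f ` S \<subseteq> T" "Ck_on k f S" "Ck_on k g T"
  shows "Ck_on k (\<lambda>x. g (f x)) S"
  using assms(4,5)
proof (induction k arbitrary: g)
  case 0
  then show ?case
    using assms(3) continuous_on_compose2 by auto
next
  case (Suc k)
  let ?D = "\<lambda>x v. \<Sum>i\<in>Basis. (frechet_derivative f (at x) v \<bullet> i) *\<^sub>R frechet_derivative g (at (f x)) i"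
  have g: "linear (frechet_derivative g (at (f x)))" if "x \<in> S" for x
    using Ck_on_has_derivative[OF Suc.prems(2)] that assms(3) has_derivative_linear by blast
  show ?case
  proof (rule Ck_on_SucI[OF assms(1), where f' = ?D])
    fix x assume x: "x \<in> S"
    have g': "((\<lambda>x. g (f x)) has_derivative
        (\<lambda>v. frechet_derivative g (at (f x)) (frechet_derivative f (at x) v))) (at x)"
      by (rule has_derivative_compose[OF Ck_on_has_derivative[OF Suc.prems(1) x]
            Ck_on_has_derivative[OF Suc.prems(2)]]) (use x assms(3) in auto)
    have D: "frechet_derivative g (at (f x)) w
        = (\<Sum>i\<in>Basis. (w \<bullet> i) *\<^sub>R frechet_derivative g (at (f x)) i)" for w
      using linear_sum[OF g[OF x], of "\<lambda>i. (w \<bullet> i) *\<^sub>R i" Basis] linear_scale[OF g[OF x]]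
      by (simp add: euclidean_representation)
    have "(\<lambda>v. frechet_derivative g (at (f x)) (frechet_derivative f (at x) v)) = ?D x"
      by (rule ext, rule D)
    with g' show "((\<lambda>x. g (f x)) has_derivative ?D x) (at x)" by (simp only:)
  next
    fix v
    show "Ck_on k (\<lambda>x. ?D x v) S"
    proof (intro Ck_on_sum[OF assms(1)] Ck_on_scaleR[OF assms(1)])
      fix i :: 'b assume "i \<in> Basis"
      show "Ck_on k (\<lambda>x. frechet_derivative f (at x) v \<bullet> i) S"
        by (rule Ck_on_bounded_linear[OF bounded_linear_inner_left assms(1)])
           (use Suc.prems in simp)
      show "Ck_on k (\<lambda>x. frechet_derivative g (at (f x)) i) S"
        using Suc.prems(2) by (intro Suc.IH[OF Ck_on_SucD[OF Suc.prems(1)]]) simp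
    qed
  qed
qed

lemma smooth_onE:
  assumes "smooth_on S f" "x \<in> S"
  obtains N g where "open N" "x \<in> N" "\<And>k. Ck_on k g N" "\<And>y. y \<in> S \<Longrightarrow> y \<in> N \<Longrightarrow> g y = f y"
proof -
  have "\<exists>N g. open N \<and> x \<in> N \<and> (\<forall>k. Ck_on k g N) \<and> (\<forall>y\<in>S \<inter> N. g y = f y)"
    using assms unfolding smooth_on_def by (rule bspec)
  then obtain N g where "open N" "x \<in> N" "\<forall>k. Ck_on k g N" "\<forall>y\<in>S \<inter> N. g y = f y"
    by (elim exE conjE)
  then show thesis by (intro that[of N g]) auto
qed

lemma smooth_onI:
  assumes "\<And>x. x \<in> S \<Longrightarrow>
    \<exists>N g. open N \<and> x \<in> N \<and> (\<forall>k. Ck_on k g N) \<and> (\<forall>y\<in>S \<inter> N. g y = f y)"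
  shows "smooth_on S f"
  unfolding smooth_on_def by (rule ballI, rule assms)

lemma smooth_on_subset:
  assumes "smooth_on S f" "T \<subseteq> S"
  shows "smooth_on T f"
proof (rule smooth_onI)
  fix x assume "x \<in> T"
  then have "x \<in> S" using assms(2) by blast
  then obtain N g where
    "open N" "x \<in> N" "\<And>k. Ck_on k g N" "\<And>y. y \<in> S \<Longrightarrow> y \<in> N \<Longrightarrow> g y = f y"
    using smooth_onE[OF assms(1)] by blast
  then show "\<exists>N g. open N \<and> x \<in> N \<and> (\<forall>k. Ck_on k g N) \<and> (\<forall>y\<in>T \<inter> N. g y = f y)"
    using assms(2) by (intro exI[of _ N] exI[of _ g]) auto
qed

lemma smooth_on_cong: "smooth_on S f \<Longrightarrow> (\<And>x. x \<in> S \<Longrightarrow> f x = g x) \<Longrightarrow> smooth_on S g"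
  unfolding smooth_on_def by (metis IntD1)

lemma smooth_on_open: "open S \<Longrightarrow> (\<And>k. Ck_on k f S) \<Longrightarrow> smooth_on S f"
  unfolding smooth_on_def by blast

lemma smooth_on_local:
  assumes "\<And>x. x \<in> S \<Longrightarrow> \<exists>N. open N \<and> x \<in> N \<and> smooth_on (S \<inter> N) f"
  shows "smooth_on S f"
proof (rule smooth_onI)
  fix x assume x: "x \<in> S"
  obtain N where N: "open N" "x \<in> N" "smooth_on (S \<inter> N) f" using assms[OF x] by blast
  then obtain N' g where "open N'" "x \<in> N'" "\<And>k. Ck_on k g N'"
      "\<And>y. y \<in> S \<inter> N \<Longrightarrow> y \<in> N' \<Longrightarrow> g y = f y"
    using smooth_onE[OF N(3), of x] x by blast
  then show "\<exists>N g. open N \<and> x \<in> N \<and> (\<forall>k. Ck_on k g N) \<and> (\<forall>y\<in>S \<inter> N. g y = f y)"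
    using N by (intro exI[of _ "N \<inter> N'"] exI[of _ g]) (auto intro: Ck_on_subset)
qed

lemma smooth_on_compose:
  assumes f: "smooth_on S f" and g: "smooth_on T g" and sub: "f ` S \<subseteq> T"
  shows "smooth_on S (\<lambda>x. g (f x))"
proof (rule smooth_onI)
  fix x assume x: "x \<in> S"
  obtain N f' where N: "open N" "x \<in> N" "\<And>k. Ck_on k f' N" "\<And>y. y \<in> S \<Longrightarrow> y \<in> N \<Longrightarrow> f' y = f y"
    using smooth_onE[OF f x] by blast
  obtain N' g' where N': "open N'" "f x \<in> N'" "\<And>k. Ck_on k g' N'" "\<And>y. y \<in> T \<Longrightarrow> y \<in> N' \<Longrightarrow> g' y = g y"
    using smooth_onE[OF g] x sub by blast
  define K where "K = N \<inter> f' -` N'"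
  have "continuous_on N f'" using N(3)[of 0] by simp
  then have K: "open K" using N(1) N'(1) unfolding K_def
    by (metis Int_commute continuous_on_open_vimage)
  have "Ck_on k (\<lambda>x. g' (f' x)) K" for k
    by (rule Ck_on_compose[OF K N'(1)]) (auto simp: K_def intro: Ck_on_subset N N')
  moreover have "x \<in> K" "\<forall>y\<in>S \<inter> K. g' (f' y) = g (f y)"
    using x N N' sub unfolding K_def by (auto simp: image_subset_iff)
  ultimately show "\<exists>N ga. open N \<and> x \<in> N \<and> (\<forall>k. Ck_on k ga N) \<and> (\<forall>y\<in>S \<inter> N. ga y = g (f y))"
    using K by blast
qed

lemma smooth_on_Pair:
  assumes f: "smooth_on S f" and g: "smooth_on S g"
  shows "smooth_on S (\<lambda>x. (f x, g x))"
proof (rule smooth_onI)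
  fix x assume x: "x \<in> S"
  obtain N f' where N: "open N" "x \<in> N" "\<And>k. Ck_on k f' N" "\<And>y. y \<in> S \<Longrightarrow> y \<in> N \<Longrightarrow> f' y = f y"
    using smooth_onE[OF f x] by blast
  obtain N' g' where N': "open N'" "x \<in> N'" "\<And>k. Ck_on k g' N'" "\<And>y. y \<in> S \<Longrightarrow> y \<in> N' \<Longrightarrow> g' y = g y"
    using smooth_onE[OF g x] by blast
  have o: "open (N \<inter> N')" using N N' by blast
  have "Ck_on k (\<lambda>x. (f' x, 0) + (0, g' x)) (N \<inter> N')" for k
    by (intro Ck_on_add[OF o] Ck_on_bounded_linear[OF _ o, where L="\<lambda>y. (y, 0)"]
          Ck_on_bounded_linear[OF _ o, where L="\<lambda>y. (0, y)"])
       (auto intro: Ck_on_subset N N' bounded_linear_Pair bounded_linear_ident bounded_linear_zero)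
  then show "\<exists>N ga. open N \<and> x \<in> N \<and> (\<forall>k. Ck_on k ga N) \<and> (\<forall>y\<in>S \<inter> N. ga y = (f y, g y))"
    using o N N' by (intro exI[of _ "N \<inter> N'"] exI[of _ "\<lambda>x. (f' x, g' x)"]) auto
qed

lemma smooth_on_imp_continuous_on: "smooth_on S f \<Longrightarrow> continuous_on S f"
  unfolding continuous_on_eq_continuous_within
proof
  fix x assume f: "smooth_on S f" and x: "x \<in> S"
  obtain N g where N: "open N" "x \<in> N" "\<And>k. Ck_on k g N" "\<And>y. y \<in> S \<Longrightarrow> y \<in> N \<Longrightarrow> g y = f y"
    using smooth_onE[OF f x] by blast
  have "continuous_on N g" using N(3)[of 0] by simp
  then have "isCont g x" using N continuous_on_eq_continuous_at by blast
  then have "continuous (at x within S) g" by (rule continuous_at_imp_continuous_within)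
  moreover have "\<forall>\<^sub>F y in at x within S. g y = f y"
    unfolding eventually_at_topological using N(1,2,4) by (metis IntI)
  ultimately show "continuous (at x within S) f"
    unfolding continuous_within using N(4)[of x] x N(2) by (simp add: Lim_transform_eventually)
qed

lemma smooth_on_imp_differentiable:
  assumes "smooth_on S f" "x \<in> S"
  shows "f differentiable (at x within S)"
proof -
  obtain N g where N: "open N" "x \<in> N" "\<And>k. Ck_on k g N" "\<And>y. y \<in> S \<Longrightarrow> y \<in> N \<Longrightarrow> g y = f y"
    using smooth_onE[OF assms] by blast
  have "(g has_derivative frechet_derivative g (at x)) (at x within S)"
    using Ck_on_has_derivative[OF N(3) N(2)] has_derivative_at_withinI by blast
  moreover obtain d where "d > 0" "ball x d \<subseteq> N" using N openE by blast
  ultimately have "(f has_derivative frechet_derivative g (at x)) (at x within S)"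
    using N(4) assms(2)
    by (intro has_derivative_transform_within[of g _ x S d f]) (auto simp: dist_commute subset_iff)
  then show ?thesis unfolding differentiable_def by blast
qed

lemma smooth_on_imp_differentiable_at:
  "smooth_on S f \<Longrightarrow> open S \<Longrightarrow> x \<in> S \<Longrightarrow> f differentiable (at x)"
  using smooth_on_imp_differentiable at_within_open by metis

lemma smooth_on_affine:
  fixes v w :: "'a::euclidean_space"
  shows "smooth_on (S :: real set) (\<lambda>t. v + t *\<^sub>R w)"
proof (rule smooth_on_subset[of UNIV])
  show "smooth_on UNIV (\<lambda>t::real. v + t *\<^sub>R w)"
    by (intro smooth_on_open Ck_on_add Ck_on_const Ck_on_linear bounded_linear_scaleR_left) auto
qed simp

text \<open>Integrals of polynomials will be the clocks along curves; this makes them smooth.\<close>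

lemma smooth_on_antiderivative:
  fixes f q :: "real \<Rightarrow> real"
  assumes "open S" "\<And>k. Ck_on k q S" "\<And>x. x \<in> S \<Longrightarrow> (f has_real_derivative q x) (at x)"
  shows "smooth_on S f"
proof (rule smooth_on_open[OF assms(1)])
  show "Ck_on k f S" for k
  proof (rule Ck_on_SucD, rule Ck_on_SucI[OF assms(1)])
    show "(f has_derivative (\<lambda>v. v * q x)) (at x)" if "x \<in> S" for x
      using assms(3)[OF that] by (simp add: has_field_derivative_def mult_commute_abs)
    show "Ck_on k (\<lambda>x. v * q x) S" for v
      using Ck_on_scaleR[OF assms(1) Ck_on_const[where c = v] assms(2)] by simp
  qed
qed

lemma Ck_on_real_polynomial:
  "real_polynomial_function p \<Longrightarrow> Ck_on k p (UNIV :: 'a::euclidean_space set)"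
proof (induction p rule: real_polynomial_function.induct)
  case (mult f g)
  then show ?case using Ck_on_scaleR[of UNIV k f g] by simp
qed (auto intro: Ck_on_linear Ck_on_const Ck_on_add)

section \<open>Charts and velocities\<close>

text \<open>In contrast to \<open>velocity\<close>, this includes that the derivative exists. Continuity is a separate requirement
  because the coordinate map is arbitrary outside of its domain, so that differentiability of the
  coordinates alone would not keep the curve near \<open>\<gamma> t\<close>.\<close>

definition has_velocity ::
  "('m::topological_space, 'e::euclidean_space) chart set \<Rightarrow> (real \<Rightarrow> 'm) \<Rightarrow> 'e \<Rightarrow> real \<Rightarrow> real set \<Rightarrow> bool"
  where
  "has_velocity M \<gamma> V t I \<longleftrightarrow> continuous (at t within I) \<gamma> \<and>
     ((\<lambda>s. snd (chart_at M (\<gamma> t)) (\<gamma> s)) has_vector_derivative V) (at t within I)"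

locale smooth_manifold =
  fixes M :: "('m::{t2_space, second_countable_topology}, 'e::euclidean_space) chart set"
  assumes atlas: "smooth_atlas M"
begin

lemma is_chart: "c \<in> M \<Longrightarrow> is_chart c"
  using atlas unfolding smooth_atlas_def by blast

lemma chart_open: "c \<in> M \<Longrightarrow> open (fst c)"
  and chart_image_open: "c \<in> M \<Longrightarrow> open (snd c ` fst c)"
  and chart_continuous: "c \<in> M \<Longrightarrow> continuous_on (fst c) (snd c)"
  and chart_inv_continuous: "c \<in> M \<Longrightarrow> continuous_on (snd c ` fst c) (chart_inv c)"
  and chart_inv_left: "c \<in> M \<Longrightarrow> p \<in> fst c \<Longrightarrow> chart_inv c (snd c p) = p"
  and chart_inv_right: "c \<in> M \<Longrightarrow> x \<in> snd c ` fst c \<Longrightarrow> snd c (chart_inv c x) = x"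
  and chart_inv_in: "c \<in> M \<Longrightarrow> x \<in> snd c ` fst c \<Longrightarrow> chart_inv c x \<in> fst c"
  using is_chart unfolding is_chart_def homeomorphism_def by blast+

lemma chart_at_in: "chart_at M p \<in> M" "p \<in> fst (chart_at M p)"
proof -
  have "p \<in> (\<Union>c\<in>M. fst c)" using atlas unfolding smooth_atlas_def by simp
  then have "\<exists>c. c \<in> M \<and> p \<in> fst c" by blast
  from someI_ex[OF this] show "chart_at M p \<in> M" "p \<in> fst (chart_at M p)"
    unfolding chart_at_def by auto
qed

lemma chart_open_image:
  assumes "c \<in> M" "open U" "U \<subseteq> fst c"
  shows "open (snd c ` U)"
proof -
  have "snd c ` U = snd c ` fst c \<inter> chart_inv c -` U"
    using assms chart_inv_left[OF assms(1)] by force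
  then show ?thesis
    using continuous_on_open_vimage[OF chart_image_open[OF assms(1)]] chart_inv_continuous[OF assms(1)] assms(2)
    by (metis Int_commute)
qed

lemma transition_smooth:
  "c \<in> M \<Longrightarrow> d \<in> M \<Longrightarrow> smooth_on (snd c ` (fst c \<inter> fst d)) (\<lambda>x. snd d (chart_inv c x))"
  using atlas unfolding smooth_atlas_def compatible_def comp_def by blast

lemma transition_open: "c \<in> M \<Longrightarrow> d \<in> M \<Longrightarrow> open (snd c ` (fst c \<inter> fst d))"
  by (intro chart_open_image) (auto simp: chart_open)

lemma transition_differentiable:
  assumes "c \<in> M" "d \<in> M" "p \<in> fst c" "p \<in> fst d"
  shows "(\<lambda>x. snd d (chart_inv c x)) differentiable (at (snd c p))"
  using smooth_on_imp_differentiable_at[OF transition_smooth transition_open] assms by blast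

lemma to_chart_has_derivative:
  assumes "c \<in> M" "p \<in> fst c"
  shows "((\<lambda>x. snd c (chart_inv (chart_at M p) x)) has_derivative to_chart M c p)
    (at (snd (chart_at M p) p))"
  using transition_differentiable[OF chart_at_in(1) assms(1) chart_at_in(2) assms(2)]
  unfolding frechet_derivative_works to_chart_def comp_def .

lemma from_chart_has_derivative:
  assumes "c \<in> M" "p \<in> fst c"
  shows "((\<lambda>x. snd (chart_at M p) (chart_inv c x)) has_derivative from_chart M c p) (at (snd c p))"
  using transition_differentiable[OF assms(1) chart_at_in(1) assms(2) chart_at_in(2)]
  unfolding frechet_derivative_works from_chart_def comp_def .

lemma to_chart_linear: "c \<in> M \<Longrightarrow> p \<in> fst c \<Longrightarrow> linear (to_chart M c p)"
  using to_chart_has_derivative has_derivative_linear by blast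

lemma from_chart_linear: "c \<in> M \<Longrightarrow> p \<in> fst c \<Longrightarrow> linear (from_chart M c p)"
  using from_chart_has_derivative has_derivative_linear by blast

lemma transition_inverse:
  assumes c: "c \<in> M" and d: "d \<in> M" and p: "p \<in> fst c" "p \<in> fst d"
    and f: "((\<lambda>x. snd d (chart_inv c x)) has_derivative f) (at (snd c p))"
    and g: "((\<lambda>x. snd c (chart_inv d x)) has_derivative g) (at (snd d p))"
  shows "g (f v) = v"
proof -
  have "((\<lambda>x. snd c (chart_inv d (snd d (chart_inv c x)))) has_derivative (\<lambda>v. g (f v))) (at (snd c p))"
    by (rule has_derivative_compose[OF f]) (simp add: chart_inv_left c p g)
  then have "((\<lambda>x. x) has_derivative (\<lambda>v. g (f v))) (at (snd c p))"
    by (rule has_derivative_transform_within_open[OF _ transition_open[OF c d]])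
       (use p in \<open>auto simp: chart_inv_left c d\<close>)
  from has_derivative_unique[OF this has_derivative_ident] show ?thesis by meson
qed

lemma from_to_chart:
  assumes "c \<in> M" "p \<in> fst c"
  shows "from_chart M c p (to_chart M c p V) = V"
  by (rule transition_inverse[OF chart_at_in(1) assms(1) chart_at_in(2) assms(2)
        to_chart_has_derivative[OF assms] from_chart_has_derivative[OF assms]])

lemma to_from_chart:
  assumes "c \<in> M" "p \<in> fst c"
  shows "to_chart M c p (from_chart M c p v) = v"
  by (rule transition_inverse[OF assms(1) chart_at_in(1) assms(2) chart_at_in(2)
        from_chart_has_derivative[OF assms] to_chart_has_derivative[OF assms]])

lemma to_chart_at: "to_chart M (chart_at M p) p V = V"
proof -
  have "((\<lambda>x. x) has_derivative to_chart M (chart_at M p) p) (at (snd (chart_at M p) p))"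
    by (rule has_derivative_transform_within_open[OF to_chart_has_derivative[OF chart_at_in]
          chart_image_open[OF chart_at_in(1)]])
       (auto simp: chart_at_in chart_inv_right)
  from has_derivative_unique[OF this has_derivative_ident] show ?thesis by meson
qed

lemma has_velocity_continuous: "has_velocity M \<gamma> V t I \<Longrightarrow> continuous (at t within I) \<gamma>"
  unfolding has_velocity_def by blast

lemma eventually_in_open:
  assumes "continuous (at t within I) \<gamma>" "open U" "\<gamma> t \<in> U"
  shows "\<forall>\<^sub>F s in at t within I. \<gamma> s \<in> U"
  using assms(1) unfolding continuous_within by (rule topological_tendstoD) (use assms in auto)

lemma vector_derivative_transition:
  assumes c: "c \<in> M" "d \<in> M" "\<gamma> t \<in> fst c" "\<gamma> t \<in> fst d"
    and t: "t \<in> I" and cont: "continuous (at t within I) \<gamma>"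
    and v: "((\<lambda>s. snd c (\<gamma> s)) has_vector_derivative v) (at t within I)"
    and f: "((\<lambda>x. snd d (chart_inv c x)) has_derivative f) (at (snd c (\<gamma> t)))"
  shows "((\<lambda>s. snd d (\<gamma> s)) has_vector_derivative f v) (at t within I)"
proof -
  have "((\<lambda>s. snd d (chart_inv c (snd c (\<gamma> s)))) has_derivative (\<lambda>s. f (s *\<^sub>R v))) (at t within I)"
    using has_derivative_compose[OF v[unfolded has_vector_derivative_def] f] .
  moreover have "\<forall>\<^sub>F s in at t within I. snd d (chart_inv c (snd c (\<gamma> s))) = snd d (\<gamma> s)"
    using eventually_in_open[OF cont chart_open[OF c(1)] c(3)]
    by eventually_elim (simp add: chart_inv_left c)
  ultimately have "((\<lambda>s. snd d (\<gamma> s)) has_derivative (\<lambda>s. f (s *\<^sub>R v))) (at t within I)"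
    by (rule has_derivative_transform_eventually) (simp_all add: chart_inv_left c t)
  then show ?thesis
    unfolding has_vector_derivative_def
    using linear_scale[OF has_derivative_linear[OF f]] by simp
qed

text \<open>Velocities are defined by charts that change from point to point. This transfers them to a chart of
  one's choice, in which the curve can be followed for some time.\<close>

lemma has_velocity_chart:
  assumes "c \<in> M" "\<gamma> t \<in> fst c" "t \<in> I"
  shows "has_velocity M \<gamma> V t I \<longleftrightarrow> continuous (at t within I) \<gamma> \<and>
    ((\<lambda>s. snd c (\<gamma> s)) has_vector_derivative to_chart M c (\<gamma> t) V) (at t within I)"
proof (cases "continuous (at t within I) \<gamma>")
  case True
  show ?thesis
  proof
    assume "has_velocity M \<gamma> V t I"
    then show "continuous (at t within I) \<gamma> \<and>
        ((\<lambda>s. snd c (\<gamma> s)) has_vector_derivative to_chart M c (\<gamma> t) V) (at t within I)"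
      unfolding has_velocity_def
      using vector_derivative_transition[OF chart_at_in(1) assms(1) chart_at_in(2) assms(2) assms(3) True _
          to_chart_has_derivative[OF assms(1,2)]] by blast
  next
    assume "continuous (at t within I) \<gamma> \<and>
        ((\<lambda>s. snd c (\<gamma> s)) has_vector_derivative to_chart M c (\<gamma> t) V) (at t within I)"
    then have "((\<lambda>s. snd (chart_at M (\<gamma> t)) (\<gamma> s)) has_vector_derivative
        from_chart M c (\<gamma> t) (to_chart M c (\<gamma> t) V)) (at t within I)"
      using vector_derivative_transition[OF assms(1) chart_at_in(1) assms(2) chart_at_in(2) assms(3) True _
          from_chart_has_derivative[OF assms(1,2)]] by blast
    then show "has_velocity M \<gamma> V t I"
      unfolding has_velocity_def from_to_chart[OF assms(1,2)] using True by blast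
  qed
qed (simp add: has_velocity_def)

lemma has_velocity_chartI:
  assumes "c \<in> M" "\<gamma> t \<in> fst c" "t \<in> I" "continuous (at t within I) \<gamma>"
    "((\<lambda>s. snd c (\<gamma> s)) has_vector_derivative v) (at t within I)"
  shows "has_velocity M \<gamma> (from_chart M c (\<gamma> t) v) t I"
  unfolding has_velocity_chart[where \<gamma> = \<gamma> and t = t, OF assms(1-3)] to_from_chart[OF assms(1,2)]
  using assms(4,5) by blast

lemma has_velocity_within_subset:
  "has_velocity M \<gamma> V t I \<Longrightarrow> J \<subseteq> I \<Longrightarrow> has_velocity M \<gamma> V t J"
  unfolding has_velocity_def
  by (meson continuous_within_subset has_vector_derivative_within_subset)

lemma has_velocity_cong:
  assumes "has_velocity M \<gamma> V t I" "t \<in> I" "\<And>s. s \<in> I \<Longrightarrow> \<gamma> s = \<sigma> s"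
  shows "has_velocity M \<sigma> V t I"
proof -
  have "((\<lambda>s. snd (chart_at M (\<gamma> t)) (\<sigma> s)) has_vector_derivative V) (at t within I)"
  proof (rule has_vector_derivative_transform[OF assms(2)])
    show "((\<lambda>s. snd (chart_at M (\<gamma> t)) (\<gamma> s)) has_vector_derivative V) (at t within I)"
      using assms(1) unfolding has_velocity_def by (rule conjunct2)
  qed (simp add: assms(3))
  moreover have "continuous (at t within I) \<sigma>"
    by (rule continuous_transform_within[of t I \<gamma> 1])
       (simp_all add: assms(2,3) has_velocity_continuous[OF assms(1)])
  ultimately show ?thesis
    unfolding has_velocity_def using assms(2,3) by simp
qed

lemma has_velocity_unique_at:
  assumes "has_velocity M \<gamma> V t I" "has_velocity M \<gamma> V' t I" "at t within I \<noteq> bot"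
  shows "V = V'"
  using assms vector_derivative_unique_within unfolding has_velocity_def by blast

lemma has_velocity_imp_velocity:
  assumes "has_velocity M \<gamma> V t {a..b}" "a < b" "t \<in> {a..b}"
  shows "velocity M {a..b} \<gamma> t = V"
  using assms unfolding has_velocity_def velocity_def comp_def
  by (intro vector_derivative_within_closed_interval) auto

text \<open>Smoothness on \<open>I\<close> is by definition the existence of local extensions. The extension \<open>x\<close> provides the
  one-sided velocities at the end points of an interval and the continuity of the velocity in charts.\<close>

lemma smooth_curve_local:
  assumes \<gamma>: "smooth_curve M I \<gamma>" and c: "c \<in> M" and u: "u \<in> I" "\<gamma> u \<in> fst c"
  obtains N x x' where "open N" "u \<in> N" "\<forall>s\<in>N \<inter> I. \<gamma> s \<in> fst c \<and> snd c (\<gamma> s) = x s"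
    "\<forall>s\<in>N. (x has_vector_derivative x' s) (at s)" "continuous_on N x'"
proof -
  have smooth: "smooth_on (I \<inter> \<gamma> -` fst c) (snd c \<circ> \<gamma>)" and cont: "continuous_on I \<gamma>"
    using \<gamma> c unfolding smooth_curve_def by blast+
  have "u \<in> I \<inter> \<gamma> -` fst c" using u by blast
  from bspec[OF smooth[unfolded smooth_on_def] this] obtain N1 x where N1: "open N1" "u \<in> N1"
    "\<forall>k. Ck_on k x N1" "\<forall>s\<in>I \<inter> \<gamma> -` fst c \<inter> N1. x s = (snd c \<circ> \<gamma>) s"
    by (elim exE conjE)
  obtain N2 where N2: "open N2" "N2 \<inter> I = \<gamma> -` fst c \<inter> I"
    using cont chart_open[OF c] unfolding continuous_on_open_invariant by blast
  show thesis
  proof (rule that[of "N1 \<inter> N2" x "\<lambda>s. frechet_derivative x (at s) 1"])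
    show "\<forall>s\<in>(N1 \<inter> N2) \<inter> I. \<gamma> s \<in> fst c \<and> snd c (\<gamma> s) = x s"
    proof
      fix s assume s: "s \<in> (N1 \<inter> N2) \<inter> I"
      then have "\<gamma> s \<in> fst c" using N2(2) by blast
      then show "\<gamma> s \<in> fst c \<and> snd c (\<gamma> s) = x s" using N1(4) s by simp
    qed
    show "\<forall>s\<in>N1 \<inter> N2. (x has_vector_derivative frechet_derivative x (at s) 1) (at s)"
    proof
      fix s assume s: "s \<in> N1 \<inter> N2"
      have D: "(x has_derivative frechet_derivative x (at s)) (at s)"
        using Ck_on_has_derivative[of 0 x N1 s] N1(3) s by blast
      have "frechet_derivative x (at s) h = h *\<^sub>R frechet_derivative x (at s) 1" for h
        using linear_scale[OF has_derivative_linear[OF D], of h 1] by simp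
      then have "frechet_derivative x (at s) = (\<lambda>h. h *\<^sub>R frechet_derivative x (at s) 1)"
        by (rule ext)
      with D show "(x has_vector_derivative frechet_derivative x (at s) 1) (at s)"
        unfolding has_vector_derivative_def by (simp only:)
    qed
    show "continuous_on (N1 \<inter> N2) (\<lambda>s. frechet_derivative x (at s) 1)"
      using N1(3)[THEN spec, of "Suc 0"] by (auto intro: continuous_on_subset)
  qed (use N1 N2 u in auto)
qed

lemma smooth_curve_has_velocity:
  assumes \<gamma>: "smooth_curve M {a..b} \<gamma>" and "a < b" and t: "t \<in> {a..b}"
  shows "has_velocity M \<gamma> (velocity M {a..b} \<gamma> t) t {a..b}"
proof -
  let ?c = "chart_at M (\<gamma> t)"
  obtain N x x' where N: "open N" "t \<in> N"
      "\<forall>s\<in>N \<inter> {a..b}. \<gamma> s \<in> fst ?c \<and> snd ?c (\<gamma> s) = x s"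
      "\<forall>s\<in>N. (x has_vector_derivative x' s) (at s)" "continuous_on N x'"
    by (rule smooth_curve_local[OF \<gamma> chart_at_in(1) t chart_at_in(2)]) (rule that)
  have x': "(x has_vector_derivative x' t) (at t within {a..b})"
    by (rule has_vector_derivative_at_within[OF bspec[OF N(4,2)]])
  obtain d where d: "d > 0" "ball t d \<subseteq> N"
    by (rule openE[OF N(1,2)])
  have x: "x s = snd ?c (\<gamma> s)" if "s \<in> {a..b}" "dist s t < d" for s
    using N(3) that d(2) by (simp add: dist_commute subset_iff)
  have "((\<lambda>s. snd ?c (\<gamma> s)) has_vector_derivative x' t) (at t within {a..b})"
    by (rule has_vector_derivative_transform_within[OF x' d(1) t x])
  moreover have "continuous (at t within {a..b}) \<gamma>"
    using \<gamma> t unfolding smooth_curve_def by (simp add: continuous_on_eq_continuous_within)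
  ultimately have *: "has_velocity M \<gamma> (x' t) t {a..b}"
    unfolding has_velocity_def by blast
  show ?thesis using has_velocity_imp_velocity[OF * \<open>a < b\<close> t] * by simp
qed

lemma smooth_curve_local_velocity:
  assumes \<gamma>: "smooth_curve M {a..b} \<gamma>" and ab: "a < b" and c: "c \<in> M" and u: "u \<in> {a..b}" "\<gamma> u \<in> fst c"
  obtains N x x' where "open N" "u \<in> N"
    "\<forall>s\<in>N \<inter> {a..b}. \<gamma> s \<in> fst c \<and> snd c (\<gamma> s) = x s \<and> velocity M {a..b} \<gamma> s = from_chart M c (\<gamma> s) (x' s)"
    "\<forall>s\<in>N. (x has_vector_derivative x' s) (at s)" "continuous_on N x'"
proof -
  obtain N x x' where N: "open N" "u \<in> N" "\<forall>s\<in>N \<inter> {a..b}. \<gamma> s \<in> fst c \<and> snd c (\<gamma> s) = x s"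
      "\<forall>s\<in>N. (x has_vector_derivative x' s) (at s)" "continuous_on N x'"
    by (rule smooth_curve_local[OF \<gamma> c u]) (rule that)
  have "velocity M {a..b} \<gamma> s = from_chart M c (\<gamma> s) (x' s)" if s: "s \<in> N \<inter> {a..b}" for s
  proof -
    have s': "s \<in> {a..b}" "\<gamma> s \<in> fst c" using s N(3) by auto
    obtain d where d: "d > 0" "ball s d \<subseteq> N"
      using openE[OF N(1)] s by blast
    have x': "(x has_vector_derivative x' s) (at s within {a..b})"
      using N(4) s by (auto intro: has_vector_derivative_at_within)
    have x: "x t = snd c (\<gamma> t)" if "t \<in> {a..b}" "dist t s < d" for t
      using N(3) that d(2) by (simp add: dist_commute subset_iff)
    have "((\<lambda>t. snd c (\<gamma> t)) has_vector_derivative x' s) (at s within {a..b})"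
      by (rule has_vector_derivative_transform_within[OF x' d(1) s'(1) x])
    then have "has_velocity M \<gamma> (from_chart M c (\<gamma> s) (x' s)) s {a..b}"
      using has_velocity_continuous[OF smooth_curve_has_velocity[OF \<gamma> ab s'(1)]]
      by (intro has_velocity_chartI[where \<gamma> = \<gamma> and t = s, OF c s'(2) s'(1)])
    then show ?thesis by (rule has_velocity_imp_velocity[OF _ ab s'(1)])
  qed
  then show thesis using N by (intro that[of N x x']) auto
qed

text \<open>One chart around each point of the curve suffices, since the transition maps are smooth.\<close>

lemma smooth_curveI:
  assumes "\<And>u. u \<in> I \<Longrightarrow> \<exists>c N. c \<in> M \<and> open N \<and> u \<in> N \<and> (\<forall>s\<in>I \<inter> N. \<gamma> s \<in> fst c) \<and>
      smooth_on (I \<inter> N) (\<lambda>s. snd c (\<gamma> s))"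
  shows "smooth_curve M I \<gamma>"
  unfolding smooth_curve_def
proof (intro conjI ballI)
  show "continuous_on I \<gamma>"
    unfolding continuous_on_eq_continuous_within
  proof
    fix u assume u: "u \<in> I"
    obtain c N where c: "c \<in> M" "open N" "u \<in> N" "\<forall>s\<in>I \<inter> N. \<gamma> s \<in> fst c"
      and s: "smooth_on (I \<inter> N) (\<lambda>s. snd c (\<gamma> s))" using assms[OF u] by blast
    have "continuous_on (I \<inter> N) (\<lambda>s. chart_inv c (snd c (\<gamma> s)))"
      using c by (intro continuous_on_compose2[OF chart_inv_continuous[OF c(1)]
                    smooth_on_imp_continuous_on[OF s]]) auto
    then have "continuous_on (I \<inter> N) \<gamma>"
      by (rule continuous_on_eq) (use c chart_inv_left in auto)
    then have "continuous (at u within I \<inter> N) \<gamma>"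
      using u c by (simp add: continuous_on_eq_continuous_within)
    moreover have "at u within I \<inter> N = at u within I"
      using c by (intro at_within_nhd[of u N]) auto
    ultimately show "continuous (at u within I) \<gamma>" by simp
  qed
next
  fix d assume d: "d \<in> M"
  show "smooth_on (I \<inter> \<gamma> -` fst d) (snd d \<circ> \<gamma>)"
  proof (rule smooth_on_local)
    fix u assume u: "u \<in> I \<inter> \<gamma> -` fst d"
    obtain c N where c: "c \<in> M" "open N" "u \<in> N" "\<forall>s\<in>I \<inter> N. \<gamma> s \<in> fst c"
      and s: "smooth_on (I \<inter> N) (\<lambda>s. snd c (\<gamma> s))" using assms[of u] u by blast
    have "smooth_on (I \<inter> \<gamma> -` fst d \<inter> N) (\<lambda>s. snd d (chart_inv c (snd c (\<gamma> s))))"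
      by (rule smooth_on_compose[OF smooth_on_subset[OF s] transition_smooth[OF c(1) d]])
         (use c in auto)
    then have "smooth_on (I \<inter> \<gamma> -` fst d \<inter> N) (snd d \<circ> \<gamma>)"
      by (rule smooth_on_cong) (use c in \<open>auto simp: chart_inv_left\<close>)
    then show "\<exists>N. open N \<and> u \<in> N \<and> smooth_on (I \<inter> \<gamma> -` fst d \<inter> N) (snd d \<circ> \<gamma>)"
      using c by blast
  qed
qed

lemma smooth_curve_subset:
  "smooth_curve M I \<gamma> \<Longrightarrow> J \<subseteq> I \<Longrightarrow> smooth_curve M J \<gamma>"
  unfolding smooth_curve_def
  by (meson Int_mono continuous_on_subset order_refl smooth_on_subset)

lemma smooth_curve_cong:
  assumes "smooth_curve M I \<gamma>" "\<And>s. s \<in> I \<Longrightarrow> \<gamma> s = \<sigma> s"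
  shows "smooth_curve M I \<sigma>"
  unfolding smooth_curve_def
proof (intro conjI ballI)
  show "continuous_on I \<sigma>"
    by (rule continuous_on_eq[of I \<gamma>]) (use assms in \<open>auto simp: smooth_curve_def\<close>)
next
  fix c assume "c \<in> M"
  then have "smooth_on (I \<inter> \<gamma> -` fst c) (snd c \<circ> \<gamma>)"
    using assms(1) unfolding smooth_curve_def by blast
  moreover have "I \<inter> \<gamma> -` fst c = I \<inter> \<sigma> -` fst c"
    using assms(2) by auto
  ultimately show "smooth_on (I \<inter> \<sigma> -` fst c) (snd c \<circ> \<sigma>)"
    using smooth_on_cong[of "I \<inter> \<sigma> -` fst c" "snd c \<circ> \<gamma>" "snd c \<circ> \<sigma>"] assms(2) by simp
qed

lemma smooth_curve_coordinates:
  assumes "smooth_curve M I \<gamma>" "c \<in> M" "u \<in> I" "\<gamma> u \<in> fst c"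
  obtains N where "open N" "u \<in> N" "\<forall>s\<in>I \<inter> N. \<gamma> s \<in> fst c" "smooth_on (I \<inter> N) (\<lambda>s. snd c (\<gamma> s))"
proof -
  obtain N where N: "open N" "N \<inter> I = \<gamma> -` fst c \<inter> I"
    using assms chart_open[of c] unfolding continuous_on_open_invariant smooth_curve_def by blast
  moreover have "smooth_on (I \<inter> N) (\<lambda>s. snd c (\<gamma> s))"
    using assms N unfolding smooth_curve_def comp_def by (metis Int_commute)
  ultimately show thesis using assms that[of N] by blast
qed

end

section \<open>Randers metrics\<close>

text \<open>The Zermelo condition \<open>h (V - tX) (V - tX) = t\<^sup>2\<close> is a quadratic equation for \<open>t\<close>, with
  \<open>v = h V V\<close>, \<open>b = h X V\<close> and \<open>w = h X X\<close>, and the Randers metric \<open>f\<close> is its nonnegative root.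
  The value of the quadratic at \<open>t\<close> is the product of \<open>t - f\<close> and a factor which is positive
  for \<open>t > 0\<close>; uniqueness of the root and the comparison of \<open>f\<close> with \<open>t\<close> follow.\<close>

lemma randers_root:
  fixes b v w :: real
  defines "f \<equiv> (sqrt (b\<^sup>2 + (1 - w) * v) - b) / (1 - w)"
  assumes w: "w < 1" and v: "v \<ge> 0" and b: "v = 0 \<Longrightarrow> b = 0"
  shows "f \<ge> 0" "v - 2 * f * b + f\<^sup>2 * w = f\<^sup>2" "v > 0 \<Longrightarrow> f > 0"
    "t \<ge> 0 \<Longrightarrow> v - 2 * t * b + t\<^sup>2 * w = t\<^sup>2 \<Longrightarrow> f = t"
    "f < t \<longleftrightarrow> t > 0 \<and> v - 2 * t * b + t\<^sup>2 * w < t\<^sup>2"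
proof -
  define l where "l = 1 - w"
  have l: "l > 0" "w = 1 - l" using w by (auto simp: l_def)
  define s where "s = sqrt (b\<^sup>2 + l * v)"
  have nn: "b\<^sup>2 + l * v \<ge> 0" using l v by simp
  have s2: "s\<^sup>2 = b\<^sup>2 + l * v" unfolding s_def using nn by simp
  have s0: "s \<ge> 0" unfolding s_def using nn by simp
  have "\<bar>b\<bar> \<le> s" unfolding s_def using l v by (intro real_le_rsqrt) simp
  then have sb: "s \<ge> b" "s \<ge> - b" by auto
  have f: "f = (s - b) / l" unfolding f_def s_def l_def ..
  show f0: "f \<ge> 0" unfolding f using sb l by simp
  have fl: "f * l = s - b" unfolding f using l by simp
  have "l * (f\<^sup>2 * l + 2 * f * b) = l * v"
  proof -
    have "l * (f\<^sup>2 * l + 2 * f * b) = (f * l)\<^sup>2 + 2 * (f * l) * b" by (simp add: power2_eq_square algebra_simps)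
    also have "\<dots> = s\<^sup>2 - b\<^sup>2" unfolding fl by (simp add: power2_eq_square algebra_simps)
    finally show ?thesis using s2 by simp
  qed
  then have quad: "f\<^sup>2 * l + 2 * f * b = v" using l by simp
  then show fq: "v - 2 * f * b + f\<^sup>2 * w = f\<^sup>2" unfolding l(2) by (simp add: algebra_simps)
  show fp: "f > 0" if "v > 0"
  proof -
    have "f \<noteq> 0" using quad that by auto
    then show ?thesis using f0 by simp
  qed
  have diff: "(t - f) * (l * (t + f) + 2 * b) = t\<^sup>2 * l + 2 * t * b - v" for t
    unfolding quad[symmetric] by (simp add: power2_eq_square algebra_simps)
  have pos: "l * (t + f) + 2 * b > 0" if "t > 0" for t
  proof (cases "v = 0")
    case True
    then show ?thesis using b l f0 that by (simp add: add_pos_nonneg)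
  next
    case False
    then have "v > 0" using v by simp
    have "f * (f * l + 2 * b) = v" using quad by (simp add: power2_eq_square algebra_simps)
    then have "f * l + 2 * b > 0"
      using \<open>v > 0\<close> fp by (metis zero_less_mult_pos)
    moreover have "l * t > 0" using l that by simp
    ultimately show ?thesis by (simp add: algebra_simps)
  qed
  show "f = t" if "t \<ge> 0" "v - 2 * t * b + t\<^sup>2 * w = t\<^sup>2"
  proof (cases "t = 0")
    case True
    then have "v = 0" using that by simp
    then show ?thesis using b quad l True by simp
  next
    case False
    then have t: "t > 0" using that by simp
    have "(t - f) * (l * (t + f) + 2 * b) = 0"
      unfolding diff using that(2) l(2) by (simp add: algebra_simps)
    then show ?thesis using pos[OF t] by simp
  qed
  show "f < t \<longleftrightarrow> t > 0 \<and> v - 2 * t * b + t\<^sup>2 * w < t\<^sup>2"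
  proof (cases "t > 0")
    case True
    have "f < t \<longleftrightarrow> 0 < (t - f) * (l * (t + f) + 2 * b)"
      using pos[OF True] by (simp add: zero_less_mult_iff)
    then show ?thesis using True unfolding diff unfolding l(2) by (simp add: algebra_simps)
  qed (use f0 in auto)
qed

locale riemannian_manifold = smooth_manifold M
  for M :: "('m::{t2_space, second_countable_topology}, 'e::euclidean_space) chart set" +
  fixes h :: "'m \<Rightarrow> 'e \<Rightarrow> 'e \<Rightarrow> real"
  assumes metric: "riemannian_metric M h"
begin

lemma h_bilinear: "bilinear (h p)"
  and h_sym: "h p U V = h p V U"
  and h_pos: "V \<noteq> 0 \<Longrightarrow> h p V V > 0"
  using metric unfolding riemannian_metric_def by blast+

lemmas h_simps = bilinear_ladd[OF h_bilinear] bilinear_radd[OF h_bilinear]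
  bilinear_lmul[OF h_bilinear] bilinear_rmul[OF h_bilinear]
  bilinear_lsub[OF h_bilinear] bilinear_rsub[OF h_bilinear]
  bilinear_lneg[OF h_bilinear] bilinear_rneg[OF h_bilinear]
  bilinear_lzero[OF h_bilinear] bilinear_rzero[OF h_bilinear]

lemma h_nonneg: "h p V V \<ge> 0"
  using h_pos[of V p] h_simps by (cases "V = 0") auto

lemma h_eq_0: "h p V V = 0 \<longleftrightarrow> V = 0"
  using h_pos[of V p] h_simps by (cases "V = 0") auto

abbreviation (input) "randers X \<equiv> randers_metric h X"
abbreviation (input) "wind_length X \<equiv> curve_length M (randers_metric h X)"
abbreviation (input) "wind_dist X \<equiv> finsler_dist M (randers_metric h X)"

text \<open>The zero wind is admitted, with the Riemannian norm as its Randers metric. Facts about lengths and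
  distances are thus shared by \<open>F\<close> and \<open>h\<close>, and the passage between the two is symmetric.\<close>

definition mild_wind :: "('m \<Rightarrow> 'e) \<Rightarrow> bool" where
  "mild_wind X \<longleftrightarrow> smooth_vector_field M X \<and> (\<forall>p. h p (X p) (X p) < 1)"

lemma mild_wind_lt_1: "mild_wind X \<Longrightarrow> h p (X p) (X p) < 1"
  unfolding mild_wind_def by blast

lemma no_wind_mild: "mild_wind (\<lambda>_. 0)"
  unfolding mild_wind_def smooth_vector_field_def
proof (intro conjI ballI allI)
  fix c assume c: "c \<in> M"
  show "smooth_on (snd c ` fst c) (\<lambda>x. to_chart M c (chart_inv c x) 0)"
    by (rule smooth_on_cong[of _ "\<lambda>x. 0"])
       (auto intro: smooth_on_open Ck_on_const chart_image_open[OF c]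
         simp: chart_inv_left c linear_0[OF to_chart_linear])
qed (simp add: h_simps)

lemma randers_no_wind: "randers_metric h (\<lambda>_. 0) = riemannian_norm h"
  unfolding randers_metric_def riemannian_norm_def Let_def fun_eq_iff by (simp add: h_simps)

lemma zermelo_expand:
  "h p (V - t *\<^sub>R X) (V - t *\<^sub>R X) = h p V V - 2 * t * h p X V + t\<^sup>2 * h p X X"
  by (simp add: h_simps h_sym[of p V X] power2_eq_square algebra_simps)

text \<open>As the representation of tangent vectors depends on the point in an arbitrary way, a Finsler metric is
  continuous only after passing to the components in a fixed chart.\<close>

definition chart_metric :: "('m, 'e) chart \<Rightarrow> ('m \<Rightarrow> 'e \<Rightarrow> real) \<Rightarrow> 'e \<times> 'e \<Rightarrow> real" where
  "chart_metric c G = (\<lambda>(x, v). G (chart_inv c x) (from_chart M c (chart_inv c x) v))"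

lemma chart_h_continuous:
  assumes c: "c \<in> M"
  shows "continuous_on (snd c ` fst c) (\<lambda>x. h (chart_inv c x) (from_chart M c (chart_inv c x) u)
    (from_chart M c (chart_inv c x) v))"
  using metric c smooth_on_imp_continuous_on unfolding riemannian_metric_def by blast

text \<open>By bilinearity, continuity of the components of \<open>h\<close> for fixed vectors gives joint continuity.\<close>

lemma chart_h_continuous2:
  assumes c: "c \<in> M" and x: "continuous_on S x" "x ` S \<subseteq> snd c ` fst c"
    and u: "continuous_on S u" and v: "continuous_on S v"
  shows "continuous_on S (\<lambda>s. h (chart_inv c (x s)) (from_chart M c (chart_inv c (x s)) (u s))
    (from_chart M c (chart_inv c (x s)) (v s)))"
proof -
  have lin: "linear (from_chart M c (chart_inv c (x s)))" if "s \<in> S" for s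
    using from_chart_linear[OF c chart_inv_in[OF c]] x that by blast
  have "h (chart_inv c (x s)) (from_chart M c (chart_inv c (x s)) (u s)) (from_chart M c (chart_inv c (x s)) (v s))
     = (\<Sum>i\<in>Basis. \<Sum>j\<in>Basis. (u s \<bullet> i) * (v s \<bullet> j) *
         h (chart_inv c (x s)) (from_chart M c (chart_inv c (x s)) i) (from_chart M c (chart_inv c (x s)) j))"
    if s: "s \<in> S" for s
  proof -
    let ?f = "from_chart M c (chart_inv c (x s))"
    have *: "?f w = (\<Sum>i\<in>Basis. (w \<bullet> i) *\<^sub>R ?f i)" for w
      using linear_sum[OF lin[OF s], of "\<lambda>i. (w \<bullet> i) *\<^sub>R i" Basis] linear_scale[OF lin[OF s]]
      by (simp add: euclidean_representation)
    have "h (chart_inv c (x s)) (?f (u s)) (?f (v s)) =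
        h (chart_inv c (x s)) (\<Sum>i\<in>Basis. (u s \<bullet> i) *\<^sub>R ?f i) (\<Sum>j\<in>Basis. (v s \<bullet> j) *\<^sub>R ?f j)"
      using *[of "u s"] *[of "v s"] by (simp only:)
    also have "\<dots> = (\<Sum>(i, j)\<in>Basis \<times> Basis.
        h (chart_inv c (x s)) ((u s \<bullet> i) *\<^sub>R ?f i) ((v s \<bullet> j) *\<^sub>R ?f j))"
      by (rule bilinear_sum[OF h_bilinear])
    finally show ?thesis
      by (simp add: h_simps sum.cartesian_product mult.assoc mult.left_commute case_prod_unfold)
  qed
  moreover have "continuous_on S (\<lambda>s. \<Sum>i\<in>Basis. \<Sum>j\<in>Basis. (u s \<bullet> i) * (v s \<bullet> j) *
         h (chart_inv c (x s)) (from_chart M c (chart_inv c (x s)) i) (from_chart M c (chart_inv c (x s)) j))"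
    by (intro continuous_intros u v continuous_on_compose2[OF chart_h_continuous[OF c] x])
  ultimately show ?thesis
    by (simp cong: continuous_on_cong)
qed

context
  fixes X :: "'m \<Rightarrow> 'e"
  assumes X: "mild_wind X"
begin

lemma h_eq_0_imp: "h p V V = 0 \<Longrightarrow> h p (X p) V = 0"
  by (simp add: h_eq_0 h_simps)

lemmas randers_roots = randers_root[OF mild_wind_lt_1[OF X] h_nonneg h_eq_0_imp]

lemma randers_root_eq:
  "randers X p V = (sqrt ((h p (X p) V)\<^sup>2 + (1 - h p (X p) (X p)) * h p V V) - h p (X p) V) / (1 - h p (X p) (X p))"
  unfolding randers_metric_def Let_def ..

lemma randers_nonneg: "randers X p V \<ge> 0"
  unfolding randers_root_eq by (rule randers_roots(1))

lemma randers_pos: "V \<noteq> 0 \<Longrightarrow> randers X p V > 0"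
  unfolding randers_root_eq by (rule randers_roots(3)) (simp_all add: h_pos)

lemma zermelo_identity: "h p (V - randers X p V *\<^sub>R X p) (V - randers X p V *\<^sub>R X p) = (randers X p V)\<^sup>2"
  unfolding zermelo_expand unfolding randers_root_eq by (rule randers_roots(2))

lemma randers_eqI: "t \<ge> 0 \<Longrightarrow> h p (V - t *\<^sub>R X p) (V - t *\<^sub>R X p) = t\<^sup>2 \<Longrightarrow> randers X p V = t"
  unfolding zermelo_expand unfolding randers_root_eq by (rule randers_roots(4))

lemma randers_less_iff: "randers X p V < t \<longleftrightarrow> t > 0 \<and> h p (V - t *\<^sub>R X p) (V - t *\<^sub>R X p) < t\<^sup>2"
  unfolding zermelo_expand unfolding randers_root_eq by (rule randers_roots(5))

lemma randers_scale:
  assumes "k \<ge> 0"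
  shows "randers X p (k *\<^sub>R V) = k * randers X p V"
proof (rule randers_eqI)
  have "k *\<^sub>R V - (k * randers X p V) *\<^sub>R X p = k *\<^sub>R (V - randers X p V *\<^sub>R X p)"
    by (simp add: algebra_simps)
  moreover have "h p (k *\<^sub>R Z) (k *\<^sub>R Z) = k\<^sup>2 * h p Z Z" for Z
    by (simp add: h_simps power2_eq_square)
  ultimately show "h p (k *\<^sub>R V - (k * randers X p V) *\<^sub>R X p) (k *\<^sub>R V - (k * randers X p V) *\<^sub>R X p) = (k * randers X p V)\<^sup>2"
    using zermelo_identity[of p V] by (simp only: power_mult_distrib)
qed (use assms randers_nonneg in simp)

lemma randers_zero: "randers X p 0 = 0"
  using randers_scale[of 0 p 0] by simp

lemma chart_metric_continuous:
  assumes c: "c \<in> M"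
  shows "continuous_on ((snd c ` fst c) \<times> UNIV) (chart_metric c (randers X))"
proof -
  let ?S = "(snd c ` fst c) \<times> (UNIV :: 'e set)"
  let ?X = "\<lambda>z. to_chart M c (chart_inv c (fst z)) (X (chart_inv c (fst z)))"
  let ?h = "\<lambda>u v z. h (chart_inv c (fst z)) (from_chart M c (chart_inv c (fst z)) (u z))
    (from_chart M c (chart_inv c (fst z)) (v z))"
  have "continuous_on (snd c ` fst c) (\<lambda>x. to_chart M c (chart_inv c x) (X (chart_inv c x)))"
    using X c smooth_on_imp_continuous_on unfolding mild_wind_def smooth_vector_field_def by blast
  then have X': "continuous_on ?S ?X"
    by (rule continuous_on_compose2[where f = fst]) (auto intro: continuous_intros)
  have h: "continuous_on ?S (?h u v)" if "continuous_on ?S u" "continuous_on ?S v" for u v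
    by (rule chart_h_continuous2[OF c _ _ that]) (auto intro: continuous_intros)
  have fX: "from_chart M c (chart_inv c (fst z)) (?X z) = X (chart_inv c (fst z))" if "z \<in> ?S" for z
    using from_to_chart[OF c chart_inv_in[OF c]] that by auto
  have l: "1 - ?h ?X ?X z \<noteq> 0" if "z \<in> ?S" for z
    using mild_wind_lt_1[OF X, of "chart_inv c (fst z)"] fX[OF that] by simp
  have "continuous_on ?S (\<lambda>z. (sqrt ((?h ?X snd z)\<^sup>2 + (1 - ?h ?X ?X z) * ?h snd snd z) - ?h ?X snd z)
      / (1 - ?h ?X ?X z))"
    by (intro continuous_intros h X') (use l in auto)
  moreover have "(sqrt ((?h ?X snd z)\<^sup>2 + (1 - ?h ?X ?X z) * ?h snd snd z) - ?h ?X snd z)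
      / (1 - ?h ?X ?X z) = chart_metric c (randers X) z" if "z \<in> ?S" for z
    unfolding fX[OF that] chart_metric_def randers_metric_def Let_def case_prod_unfold ..
  ultimately show ?thesis by (rule continuous_on_eq)
qed

lemma speed_continuous:
  assumes \<gamma>: "smooth_curve M {a..b} \<gamma>" and ab: "a < b"
  shows "continuous_on {a..b} (\<lambda>t. randers X (\<gamma> t) (velocity M {a..b} \<gamma> t))"
  unfolding continuous_on_eq_continuous_within
proof
  fix u assume u: "u \<in> {a..b}"
  let ?c = "chart_at M (\<gamma> u)"
  obtain N x x' where N: "open N" "u \<in> N"
    "\<forall>s\<in>N \<inter> {a..b}. \<gamma> s \<in> fst ?c \<and> snd ?c (\<gamma> s) = x s \<and> velocity M {a..b} \<gamma> s = from_chart M ?c (\<gamma> s) (x' s)"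
    "\<forall>s\<in>N. (x has_vector_derivative x' s) (at s)" "continuous_on N x'"
    by (rule smooth_curve_local_velocity[OF \<gamma> ab chart_at_in(1) u chart_at_in(2)]) (rule that)
  have "continuous_on N x"
    using N(4) has_vector_derivative_continuous continuous_at_imp_continuous_on by blast
  then have "continuous_on ({a..b} \<inter> N) (\<lambda>s. (x s, x' s))"
    using N(5) by (intro continuous_on_Pair) (auto intro: continuous_on_subset)
  then have "continuous_on ({a..b} \<inter> N) (\<lambda>s. chart_metric ?c (randers X) (x s, x' s))"
    by (rule continuous_on_compose2[OF chart_metric_continuous[OF chart_at_in(1)]]) (use N(3) in force)
  then have "continuous_on ({a..b} \<inter> N) (\<lambda>t. randers X (\<gamma> t) (velocity M {a..b} \<gamma> t))"
  proof (rule continuous_on_eq)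
    fix s assume s: "s \<in> {a..b} \<inter> N"
    then have "\<gamma> s \<in> fst ?c" "x s = snd ?c (\<gamma> s)" "velocity M {a..b} \<gamma> s = from_chart M ?c (\<gamma> s) (x' s)"
      using N(3) by auto
    then show "chart_metric ?c (randers X) (x s, x' s) = randers X (\<gamma> s) (velocity M {a..b} \<gamma> s)"
      unfolding chart_metric_def by (simp add: chart_inv_left chart_at_in)
  qed
  then have "continuous (at u within {a..b} \<inter> N) (\<lambda>t. randers X (\<gamma> t) (velocity M {a..b} \<gamma> t))"
    using u N by (simp add: continuous_on_eq_continuous_within)
  moreover have "at u within {a..b} \<inter> N = at u within {a..b}"
    using N by (intro at_within_nhd[of u N]) auto
  ultimately show "continuous (at u within {a..b}) (\<lambda>t. randers X (\<gamma> t) (velocity M {a..b} \<gamma> t))" by simp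
qed

end

end

section \<open>Lengths and distances\<close>

context smooth_manifold
begin

lemma velocity_interior:
  "a < t \<Longrightarrow> t < b \<Longrightarrow> velocity M {a..b} \<gamma> t = velocity M UNIV \<gamma> t"
  unfolding velocity_def by (simp add: at_within_Icc_at)

lemma velocity_cong:
  assumes "t \<in> I" "\<And>s. s \<in> I \<Longrightarrow> \<gamma> s = \<sigma> s"
  shows "velocity M I \<gamma> t = velocity M I \<sigma> t"
proof -
  let ?c = "snd (chart_at M (\<gamma> t))"
  have "((?c \<circ> \<gamma>) has_vector_derivative V) (at t within I) \<longleftrightarrow>
      ((?c \<circ> \<sigma>) has_vector_derivative V) (at t within I)" for V
    using has_vector_derivative_transform[OF assms(1), of "?c \<circ> \<gamma>" "?c \<circ> \<sigma>" V]
      has_vector_derivative_transform[OF assms(1), of "?c \<circ> \<sigma>" "?c \<circ> \<gamma>" V] assms(2)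
    by (auto simp: comp_def)
  then show ?thesis
    unfolding velocity_def vector_derivative_def using assms by simp
qed

lemma curve_length_cong:
  "(\<And>s. s \<in> {a..b} \<Longrightarrow> \<gamma> s = \<sigma> s) \<Longrightarrow> curve_length M F a b \<gamma> = curve_length M F a b \<sigma>"
  unfolding curve_length_def by (intro integral_cong) (metis velocity_cong)

definition rectifiable :: "('m \<Rightarrow> 'e \<Rightarrow> real) \<Rightarrow> real \<Rightarrow> real \<Rightarrow> (real \<Rightarrow> 'm) \<Rightarrow> bool" where
  "rectifiable F a b \<gamma> \<longleftrightarrow> (\<lambda>t. F (\<gamma> t) (velocity M {a..b} \<gamma> t)) integrable_on {a..b}"

text \<open>The one-sided velocities at the end points of the parts do not matter for the integrals.\<close>

lemma curve_length_combine:
  assumes "a \<le> b" "b \<le> c" "rectifiable F a b \<gamma>" "rectifiable F b c \<gamma>"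
  shows "rectifiable F a c \<gamma>"
    "curve_length M F a c \<gamma> = curve_length M F a b \<gamma> + curve_length M F b c \<gamma>"
proof -
  let ?f = "\<lambda>a b t. F (\<gamma> t) (velocity M {a..b} \<gamma> t)"
  have 1: "(?f a c has_integral curve_length M F a b \<gamma>) {a..b}"
  proof (rule has_integral_spike_finite[of "{a, b}"])
    show "(?f a b has_integral curve_length M F a b \<gamma>) {a..b}"
      using assms(3) unfolding rectifiable_def curve_length_def by (rule integrable_integral)
  qed (use assms in \<open>auto simp: velocity_interior\<close>)
  have 2: "(?f a c has_integral curve_length M F b c \<gamma>) {b..c}"
  proof (rule has_integral_spike_finite[of "{b, c}"])
    show "(?f b c has_integral curve_length M F b c \<gamma>) {b..c}"
      using assms(4) unfolding rectifiable_def curve_length_def by (rule integrable_integral)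
  qed (use assms in \<open>auto simp: velocity_interior\<close>)
  have "(?f a c has_integral curve_length M F a b \<gamma> + curve_length M F b c \<gamma>) {a..c}"
    by (rule has_integral_combine[OF assms(1,2) 1 2])
  then show "rectifiable F a c \<gamma>"
    "curve_length M F a c \<gamma> = curve_length M F a b \<gamma> + curve_length M F b c \<gamma>"
    unfolding rectifiable_def curve_length_def by (auto simp: has_integral_iff)
qed

lemma smooth_imp_piecewise_smooth:
  assumes "smooth_curve M {a..b} \<gamma>"
  shows "piecewise_smooth_curve M a b \<gamma>"
  unfolding piecewise_smooth_curve_def
proof (intro conjI exI[of _ "{}"] allI impI)
  show "continuous_on {a..b} \<gamma>" using assms unfolding smooth_curve_def by blast
  show "smooth_curve M {s..t} \<gamma>" if "a \<le> s \<and> s < t \<and> t \<le> b \<and> {s<..<t} \<inter> {} = {}" for s t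
    by (rule smooth_curve_subset[OF assms]) (use that in auto)
qed simp

text \<open>Properties of the parameter intervals that are inherited by concatenation need to be checked on smooth
  pieces only. In this form nothing has to be said about the set of break points.\<close>

lemma piecewise_smooth_induct:
  assumes \<gamma>: "piecewise_smooth_curve M a b \<gamma>" and ab: "a < b"
    and smooth: "\<And>s t. a \<le> s \<Longrightarrow> s < t \<Longrightarrow> t \<le> b \<Longrightarrow> smooth_curve M {s..t} \<gamma> \<Longrightarrow> Q s t"
    and combine: "\<And>s t u. a \<le> s \<Longrightarrow> s < t \<Longrightarrow> t < u \<Longrightarrow> u \<le> b \<Longrightarrow> Q s t \<Longrightarrow> Q t u \<Longrightarrow> Q s u"
  shows "Q a b"
proof -
  obtain P where P: "finite P"
    "\<And>s t. a \<le> s \<Longrightarrow> s < t \<Longrightarrow> t \<le> b \<Longrightarrow> {s<..<t} \<inter> P = {} \<Longrightarrow> smooth_curve M {s..t} \<gamma>"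
    using \<gamma> unfolding piecewise_smooth_curve_def by blast
  have "\<forall>s t. a \<le> s \<and> s < t \<and> t \<le> b \<and> card ({s<..<t} \<inter> P) = n \<longrightarrow> Q s t" for n
  proof (induction n rule: less_induct)
    case (less n)
    show ?case
    proof (intro allI impI, elim conjE)
      fix s t assume st: "a \<le> s" "s < t" "t \<le> b" and n: "card ({s<..<t} \<inter> P) = n"
      show "Q s t"
      proof (cases "{s<..<t} \<inter> P = {}")
        case True
        then show ?thesis using smooth st P(2) by blast
      next
        case False
        then obtain p where p: "p \<in> P" "s < p" "p < t" by auto
        have "card ({s<..<p} \<inter> P) < n" "card ({p<..<t} \<inter> P) < n"
          unfolding n[symmetric] by (intro psubset_card_mono; use p P(1) in force)+
        then have "Q s p" "Q p t" using less st p by auto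
        then show ?thesis using combine st p by simp
      qed
    qed
  qed
  then show ?thesis using ab by blast
qed

lemma piecewise_smooth_glue:
  assumes "piecewise_smooth_curve M a b \<gamma>" "piecewise_smooth_curve M b c \<gamma>" "a \<le> b" "b \<le> c"
  shows "piecewise_smooth_curve M a c \<gamma>"
proof -
  obtain P where P: "finite P"
    "\<forall>s t. a \<le> s \<and> s < t \<and> t \<le> b \<and> {s<..<t} \<inter> P = {} \<longrightarrow> smooth_curve M {s..t} \<gamma>"
    using assms(1) unfolding piecewise_smooth_curve_def by blast
  obtain Q where Q: "finite Q"
    "\<forall>s t. b \<le> s \<and> s < t \<and> t \<le> c \<and> {s<..<t} \<inter> Q = {} \<longrightarrow> smooth_curve M {s..t} \<gamma>"
    using assms(2) unfolding piecewise_smooth_curve_def by blast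
  have "continuous_on ({a..b} \<union> {b..c}) \<gamma>"
    using assms by (intro continuous_on_closed_Un) (auto simp: piecewise_smooth_curve_def)
  then have "continuous_on {a..c} \<gamma>" using assms(3,4) by (simp add: ivl_disj_un_two_touch)
  moreover have "smooth_curve M {s..t} \<gamma>"
    if "a \<le> s" "s < t" "t \<le> c" "{s<..<t} \<inter> (insert b (P \<union> Q)) = {}" for s t
  proof (cases "t \<le> b")
    case True
    then show ?thesis using P(2) that by blast
  next
    case False
    have "b \<le> s"
    proof (rule ccontr)
      assume "\<not> b \<le> s"
      then have "b \<in> {s<..<t}" using False by simp
      then show False using that(4) by blast
    qed
    then show ?thesis using Q(2) that by blast
  qed
  ultimately show ?thesis
    unfolding piecewise_smooth_curve_def using P(1) Q(1)
    by (intro conjI exI[of _ "insert b (P \<union> Q)"]) auto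
qed

lemma piecewise_smooth_cong:
  assumes "piecewise_smooth_curve M a b \<gamma>" "\<And>s. s \<in> {a..b} \<Longrightarrow> \<gamma> s = \<sigma> s"
  shows "piecewise_smooth_curve M a b \<sigma>"
proof -
  obtain P where P: "finite P"
    "\<forall>s t. a \<le> s \<and> s < t \<and> t \<le> b \<and> {s<..<t} \<inter> P = {} \<longrightarrow> smooth_curve M {s..t} \<gamma>"
    using assms(1) unfolding piecewise_smooth_curve_def by blast
  have "smooth_curve M {s..t} \<sigma>" if "a \<le> s \<and> s < t \<and> t \<le> b \<and> {s<..<t} \<inter> P = {}" for s t
    by (rule smooth_curve_cong[of _ \<gamma>]) (use that P(2) assms(2) in auto)
  moreover have "continuous_on {a..b} \<sigma>"
    by (rule continuous_on_eq[of _ \<gamma>]) (use assms in \<open>auto simp: piecewise_smooth_curve_def\<close>)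
  ultimately show ?thesis
    unfolding piecewise_smooth_curve_def using P(1) by blast
qed

lemma affine_smooth_curve:
  assumes "smooth_curve M {k * a + m..k * b + m} \<gamma>" "k > 0"
  shows "smooth_curve M {a..b} (\<lambda>t. \<gamma> (k * t + m))"
proof (rule smooth_curveI)
  let ?g = "\<lambda>t. k * t + m"
  fix u assume u: "u \<in> {a..b}"
  then have u': "?g u \<in> {k * a + m..k * b + m}" using assms(2) by auto
  obtain N where N: "open N" "?g u \<in> N" "\<forall>s\<in>{k * a + m..k * b + m} \<inter> N. \<gamma> s \<in> fst (chart_at M (\<gamma> (?g u)))"
      "smooth_on ({k * a + m..k * b + m} \<inter> N) (\<lambda>s. snd (chart_at M (\<gamma> (?g u))) (\<gamma> s))"
    by (rule smooth_curve_coordinates[OF assms(1) chart_at_in(1) u' chart_at_in(2)])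
  have "open (?g -` N)"
    by (intro open_vimage N(1) continuous_intros)
  moreover have g: "?g s \<in> {k * a + m..k * b + m} \<inter> N" if "s \<in> {a..b} \<inter> ?g -` N" for s
    using that assms(2) by auto
  moreover have "smooth_on ({a..b} \<inter> ?g -` N) (\<lambda>s. m + s *\<^sub>R k)"
    by (rule smooth_on_affine)
  then have "smooth_on ({a..b} \<inter> ?g -` N) (\<lambda>s. snd (chart_at M (\<gamma> (?g u))) (\<gamma> (m + s *\<^sub>R k)))"
    by (rule smooth_on_compose[OF _ N(4)]) (use g in \<open>auto simp: add.commute mult.commute\<close>)
  ultimately show "\<exists>c N. c \<in> M \<and> open N \<and> u \<in> N \<and> (\<forall>s\<in>{a..b} \<inter> N. \<gamma> (?g s) \<in> fst c) \<and>
      smooth_on ({a..b} \<inter> N) (\<lambda>s. snd c (\<gamma> (?g s)))"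
    using N(2,3) g chart_at_in(1)
    by (intro exI[of _ "chart_at M (\<gamma> (?g u))"] exI[of _ "?g -` N"])
       (auto simp: add.commute mult.commute)
qed

lemma has_velocity_affine:
  assumes "has_velocity M \<gamma> V (k * t + m) I" "(\<lambda>t. k * t + m) ` J \<subseteq> I"
  shows "has_velocity M (\<lambda>t. \<gamma> (k * t + m)) (k *\<^sub>R V) t J"
proof -
  let ?c = "snd (chart_at M (\<gamma> (k * t + m)))"
  have "((\<lambda>t. k * t + m) has_vector_derivative k) (at t within J)"
    by (auto intro!: derivative_eq_intros)
  moreover have "((\<lambda>s. ?c (\<gamma> s)) has_vector_derivative V) (at (k * t + m) within (\<lambda>t. k * t + m) ` J)"
    using assms unfolding has_velocity_def by (blast intro: has_vector_derivative_within_subset)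
  ultimately have "(((\<lambda>s. ?c (\<gamma> s)) \<circ> (\<lambda>t. k * t + m)) has_vector_derivative k *\<^sub>R V) (at t within J)"
    by (rule vector_diff_chain_within)
  moreover have "continuous (at t within J) (\<lambda>t. \<gamma> (k * t + m))"
    by (rule continuous_within_compose2[where f = "\<lambda>t. k * t + m" and g = \<gamma>])
       (use assms in \<open>auto intro!: continuous_intros intro: continuous_within_subset simp: has_velocity_def\<close>)
  ultimately show ?thesis unfolding has_velocity_def comp_def by blast
qed

end

context riemannian_manifold
begin

context
  fixes X :: "'m \<Rightarrow> 'e"
  assumes X: "mild_wind X"
begin

lemma smooth_rectifiable: "smooth_curve M {a..b} \<gamma> \<Longrightarrow> a < b \<Longrightarrow> rectifiable (randers X) a b \<gamma>"
  unfolding rectifiable_def by (intro integrable_continuous_interval speed_continuous X)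

lemma piecewise_rectifiable:
  assumes "piecewise_smooth_curve M a b \<gamma>" "a < b"
  shows "rectifiable (randers X) a b \<gamma>"
  by (rule piecewise_smooth_induct[OF assms])
     (auto intro: smooth_rectifiable curve_length_combine(1)[OF less_imp_le less_imp_le])

lemma curve_length_nonneg: "wind_length X a b \<gamma> \<ge> 0"
  unfolding curve_length_def
  by (cases "(\<lambda>t. randers X (\<gamma> t) (velocity M {a..b} \<gamma> t)) integrable_on {a..b}")
     (auto intro: integral_nonneg randers_nonneg X simp: not_integrable_integral)

lemma affine_smooth_length:
  assumes \<gamma>: "smooth_curve M {k * a + m..k * b + m} \<gamma>" and k: "k > 0" and ab: "a < b"
  shows "wind_length X a b (\<lambda>t. \<gamma> (k * t + m)) =
    wind_length X (k * a + m) (k * b + m) \<gamma>"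
proof -
  let ?g = "\<lambda>t. k * t + m" and ?I = "{k * a + m..k * b + m}"
  let ?f = "\<lambda>t. randers X (\<gamma> t) (velocity M ?I \<gamma> t)"
  have ab': "?g a < ?g b" using ab k by simp
  have g: "?g ` {a..b} \<subseteq> ?I" using k by auto
  have "velocity M {a..b} (\<lambda>t. \<gamma> (?g t)) t = k *\<^sub>R velocity M ?I \<gamma> (?g t)" if "t \<in> {a..b}" for t
    by (rule has_velocity_imp_velocity[OF has_velocity_affine[OF _ g] ab that],
        rule smooth_curve_has_velocity[OF \<gamma> ab']) (use g that in blast)
  then have "randers X (\<gamma> (?g t)) (velocity M {a..b} (\<lambda>t. \<gamma> (?g t)) t) = k *\<^sub>R ?f (?g t)"
    if "t \<in> {a..b}" for t
    using that k by (simp add: randers_scale[OF X])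
  then have "wind_length X a b (\<lambda>t. \<gamma> (?g t)) = integral {a..b} (\<lambda>t. k *\<^sub>R ?f (?g t))"
    unfolding curve_length_def by (rule integral_cong)
  also have "\<dots> = integral ?I ?f"
    by (rule integral_unique, rule has_integral_substitution[OF _ _ g speed_continuous[OF X \<gamma> ab']])
       (use ab ab' in \<open>auto intro!: derivative_eq_intros\<close>)
  finally show ?thesis unfolding curve_length_def .
qed

text \<open>The pieces of \<open>\<gamma>\<close> are parametrized by \<open>k * t + m\<close>, hence the inverse affine map in the induction.\<close>

lemma affine_piecewise:
  assumes \<gamma>: "piecewise_smooth_curve M (k * a + m) (k * b + m) \<gamma>" and k: "k > 0" and ab: "a < b"
  shows "piecewise_smooth_curve M a b (\<lambda>t. \<gamma> (k * t + m))"
    "wind_length X a b (\<lambda>t. \<gamma> (k * t + m)) =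
      wind_length X (k * a + m) (k * b + m) \<gamma>"
proof -
  let ?L = "\<lambda>a b. wind_length X a b (\<lambda>t. \<gamma> (k * t + m)) =
      wind_length X (k * a + m) (k * b + m) \<gamma>"
  let ?Q = "\<lambda>s t. piecewise_smooth_curve M ((s - m) / k) ((t - m) / k) (\<lambda>t. \<gamma> (k * t + m)) \<and>
    rectifiable (randers X) s t \<gamma> \<and> ?L ((s - m) / k) ((t - m) / k)"
  have ab': "k * a + m < k * b + m" using ab k by simp
  have inv: "k * ((s - m) / k) + m = s" for s using k by simp
  have "?Q (k * a + m) (k * b + m)"
  proof (rule piecewise_smooth_induct[OF \<gamma> ab'])
    fix s t :: real assume st: "s < t" and \<gamma>: "smooth_curve M {s..t} \<gamma>"
    have st': "(s - m) / k < (t - m) / k" using st k by (simp add: divide_strict_right_mono)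
    have \<gamma>': "smooth_curve M {k * ((s - m) / k) + m..k * ((t - m) / k) + m} \<gamma>"
      unfolding inv by (rule \<gamma>)
    show "?Q s t"
      using smooth_imp_piecewise_smooth[OF affine_smooth_curve[OF \<gamma>' k]]
        affine_smooth_length[OF \<gamma>' k st'] smooth_rectifiable[OF \<gamma> st] by blast
  next
    fix s t u :: real assume st: "s < t" "t < u" and Q: "?Q s t" "?Q t u"
    have st': "(s - m) / k < (t - m) / k" "(t - m) / k < (u - m) / k"
      using st k by (simp_all add: divide_strict_right_mono)
    have P: "piecewise_smooth_curve M ((s - m) / k) ((u - m) / k) (\<lambda>t. \<gamma> (k * t + m))"
      using piecewise_smooth_glue Q st' by (meson less_imp_le)
    moreover have "rectifiable (randers X) s u \<gamma>"
      using curve_length_combine(1) Q st by (meson less_imp_le)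
    moreover have "?L ((s - m) / k) ((u - m) / k)"
      using Q st st' unfolding inv
      by (simp add: curve_length_combine(2)[of s t u]
           curve_length_combine(2)[of "(s - m) / k" "(t - m) / k" "(u - m) / k"] piecewise_rectifiable)
    ultimately show "?Q s u" by blast
  qed
  then show "piecewise_smooth_curve M a b (\<lambda>t. \<gamma> (k * t + m))" "?L a b" using k by simp_all
qed

lemma finsler_dist_nonneg: "wind_dist X p q \<ge> 0"
  unfolding finsler_dist_def by (intro INF_greatest) (simp add: curve_length_nonneg)

text \<open>The distance refers to curves on the unit interval; other intervals are reduced to it by an affine
  change of the parameter.\<close>

lemma finsler_dist_le_length:
  assumes \<gamma>: "piecewise_smooth_curve M a b \<gamma>" and ab: "a < b"
  shows "wind_dist X (\<gamma> a) (\<gamma> b) \<le> ereal (wind_length X a b \<gamma>)"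
proof -
  have \<gamma>': "piecewise_smooth_curve M ((b - a) * 0 + a) ((b - a) * 1 + a) \<gamma>" using \<gamma> by simp
  have "wind_dist X (\<gamma> a) (\<gamma> b)
      \<le> ereal (wind_length X 0 1 (\<lambda>t. \<gamma> ((b - a) * t + a)))"
    unfolding finsler_dist_def
    by (rule INF_lower) (use affine_piecewise(1)[OF \<gamma>'] ab in simp)
  then show ?thesis
    using affine_piecewise(2)[OF \<gamma>'] ab by simp
qed

lemma finsler_dist_refl: "wind_dist X p p = 0"
proof (rule antisym[OF _ finsler_dist_nonneg])
  let ?c = "chart_at M p"
  have "smooth_curve M {0..1} (\<lambda>_. p)"
  proof (rule smooth_curveI)
    show "\<exists>c N. c \<in> M \<and> open N \<and> u \<in> N \<and> (\<forall>s\<in>{0..1} \<inter> N. p \<in> fst c) \<and>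
        smooth_on ({0..1} \<inter> N) (\<lambda>s. snd c p)" for u :: real
      by (intro exI[of _ ?c] exI[of _ UNIV])
         (auto simp: chart_at_in intro!: smooth_on_subset[OF smooth_on_open[OF open_UNIV Ck_on_const]])
  qed
  moreover have "velocity M {0..1} (\<lambda>_. p) t = 0" if "t \<in> {0..1}" for t
    by (rule has_velocity_imp_velocity) (use that in \<open>auto simp: has_velocity_def\<close>)
  then have "wind_length X 0 1 (\<lambda>_. p) = integral {0..1::real} (\<lambda>t. 0)"
    unfolding curve_length_def by (intro integral_cong) (simp add: randers_zero[OF X])
  ultimately show "wind_dist X p p \<le> 0"
    using finsler_dist_le_length[of 0 1 "\<lambda>_. p"] smooth_imp_piecewise_smooth by (simp add: zero_ereal_def)
qed

lemma finsler_dist_triangle_curves: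
  assumes 1: "piecewise_smooth_curve M 0 1 \<gamma>" and 2: "piecewise_smooth_curve M 0 1 \<sigma>" and "\<gamma> 1 = \<sigma> 0"
  shows "wind_dist X (\<gamma> 0) (\<sigma> 1) \<le>
    ereal (wind_length X 0 1 \<gamma>) + ereal (wind_length X 0 1 \<sigma>)"
proof -
  define \<rho> where "\<rho> t = (if t \<le> 1 then \<gamma> t else \<sigma> (1 * t + (-1)))" for t :: real
  have \<rho>1: "\<gamma> s = \<rho> s" if "s \<in> {0..1}" for s using that unfolding \<rho>_def by simp
  have \<rho>2: "\<sigma> (1 * s + (-1)) = \<rho> s" if "s \<in> {1..2}" for s
    using that assms(3) unfolding \<rho>_def by (cases "s = 1") auto
  have shifted: "piecewise_smooth_curve M (1 * 1 + (-1)) (1 * 2 + (-1)) \<sigma>" using 2 by simp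
  have "piecewise_smooth_curve M 0 1 \<rho>"
    by (rule piecewise_smooth_cong[OF 1 \<rho>1])
  moreover have "piecewise_smooth_curve M 1 2 \<rho>"
    by (rule piecewise_smooth_cong[OF affine_piecewise(1)[OF shifted] \<rho>2]) auto
  ultimately have P: "piecewise_smooth_curve M 0 2 \<rho>" "rectifiable (randers X) 0 1 \<rho>"
      "rectifiable (randers X) 1 2 \<rho>"
    using piecewise_smooth_glue[of 0 1 \<rho> 2] piecewise_rectifiable by auto
  have "wind_length X 0 1 \<rho> = wind_length X 0 1 \<gamma>"
    using curve_length_cong[OF \<rho>1] by simp
  moreover have "wind_length X 1 2 \<rho> = wind_length X 0 1 \<sigma>"
    using curve_length_cong[OF \<rho>2] affine_piecewise(2)[OF shifted] by simp
  moreover have "wind_length X 0 2 \<rho> =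
      wind_length X 0 1 \<rho> + wind_length X 1 2 \<rho>"
    using curve_length_combine(2)[OF _ _ P(2,3)] by simp
  moreover have "\<rho> 0 = \<gamma> 0" "\<rho> 2 = \<sigma> 1" unfolding \<rho>_def by auto
  ultimately show ?thesis using finsler_dist_le_length[OF P(1)] by simp
qed

lemma finsler_dist_triangle:
  "wind_dist X p r \<le>
    wind_dist X p q + wind_dist X q r"
proof -
  let ?C = "\<lambda>p q. {\<gamma>. piecewise_smooth_curve M 0 1 \<gamma> \<and> \<gamma> 0 = p \<and> \<gamma> 1 = q}"
  let ?L = "\<lambda>\<gamma>. ereal (wind_length X 0 1 \<gamma>)"
  have d: "wind_dist X p q = (INF \<gamma>\<in>?C p q. ?L \<gamma>)" for p q
    unfolding finsler_dist_def ..
  show ?thesis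
  proof (cases "?C p q = {} \<or> ?C q r = {}")
    case True
    then have "wind_dist X p q = \<infinity> \<or> wind_dist X q r = \<infinity>"
      unfolding d by (elim disjE) (simp_all only: INF_empty top_ereal_def simp_thms)
    then show ?thesis by auto
  next
    case False
    have "wind_dist X p r \<le> (INF \<gamma>\<in>?C p q. INF \<sigma>\<in>?C q r. ?L \<gamma> + ?L \<sigma>)"
      using finsler_dist_triangle_curves by (intro INF_greatest) auto
    also have "\<dots> = (INF \<gamma>\<in>?C p q. ?L \<gamma> + wind_dist X q r)"
      unfolding d using False by (intro INF_cong refl INF_ereal_add_right) (auto simp: curve_length_nonneg)
    also have "\<dots> = wind_dist X p q + wind_dist X q r"
      unfolding d[of p q] using False finsler_dist_nonneg[of q r]
      by (intro INF_ereal_add_left) (auto simp: curve_length_nonneg)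
    finally show ?thesis .
  qed
qed

lemma dist_from_triangle:
  "dist_from M (randers X) A r \<le>
    dist_from M (randers X) A q + wind_dist X q r"
proof (cases "A = {}")
  case True
  then show ?thesis
    unfolding dist_from_def using finsler_dist_nonneg[of q r] by (simp add: top_ereal_def)
next
  case False
  have "dist_from M (randers X) A r \<le>
      (INF p\<in>A. wind_dist X p q + wind_dist X q r)"
    unfolding dist_from_def by (intro INF_mono) (blast intro: finsler_dist_triangle)
  also have "\<dots> = dist_from M (randers X) A q + wind_dist X q r"
    unfolding dist_from_def using False finsler_dist_nonneg[of q r]
    by (intro INF_ereal_add_left) (auto simp: finsler_dist_nonneg)
  finally show ?thesis .
qed

lemma finsler_dist_lessE:
  assumes "wind_dist X p q < ereal l"
  obtains \<gamma> where "piecewise_smooth_curve M 0 1 \<gamma>" "\<gamma> 0 = p" "\<gamma> 1 = q"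
    "wind_length X 0 1 \<gamma> < l"
  using assms unfolding finsler_dist_def INF_less_iff by auto

end

end

section \<open>The flow of the wind\<close>

locale zermelo_navigation = riemannian_manifold M h
  for M :: "('m::{t2_space, second_countable_topology}, 'e::euclidean_space) chart set"
    and h :: "'m \<Rightarrow> 'e \<Rightarrow> 'e \<Rightarrow> real" +
  fixes W :: "'m \<Rightarrow> 'e" and D :: "(real \<times> 'm) set" and \<phi> :: "real \<Rightarrow> 'm \<Rightarrow> 'm"
  assumes W_mild: "mild_wind W"
    and flow: "is_flow M W D \<phi>"
    and killing: "killing_flow M \<phi> h"
begin

lemma D_open: "open D"
  and zero_in_D: "(0, p) \<in> D"
  and D_interval: "is_interval {t. (t, p) \<in> D}"
  and flow_zero: "\<phi> 0 p = p"
  and flow_integral_curve: "integral_curve M W {t. (t, p) \<in> D} (\<lambda>t. \<phi> t p)"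
  and flow_continuous: "continuous_on D (\<lambda>(t, p). \<phi> t p)"
  using flow unfolding is_flow_def by blast+

lemma flow_maximal:
  assumes "open J" "is_interval J" "0 \<in> J" "integral_curve M W J \<sigma>" "t \<in> J"
  shows "(t, \<sigma> 0) \<in> D" "\<sigma> t = \<phi> t (\<sigma> 0)"
  using flow assms unfolding is_flow_def by blast+

lemma slice_open: "open {t. (f t, p) \<in> D}" if "continuous_on UNIV f"
proof -
  have "{t. (f t, p) \<in> D} = (\<lambda>t. (f t, p)) -` D" by auto
  then show ?thesis
    by (simp add: open_vimage[OF D_open] continuous_on_Pair that)
qed

lemma flow_velocity:
  assumes "(t, p) \<in> D"
  shows "has_velocity M (\<lambda>t. \<phi> t p) (W (\<phi> t p)) t UNIV"
proof -
  have "continuous_on {t. (t, p) \<in> D} (\<lambda>t. \<phi> t p)"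
    using flow_integral_curve unfolding integral_curve_def by blast
  then have "isCont (\<lambda>t. \<phi> t p) t"
    using assms slice_open[of "\<lambda>t. t"] by (simp add: continuous_on_eq_continuous_at)
  then show ?thesis
    using flow_integral_curve[of p] assms unfolding has_velocity_def integral_curve_def comp_def by auto
qed

lemma integral_curveI:
  assumes "\<And>t. t \<in> J \<Longrightarrow> has_velocity M \<sigma> (W (\<sigma> t)) t UNIV"
  shows "integral_curve M W J \<sigma>"
  unfolding integral_curve_def comp_def
  using assms unfolding has_velocity_def
  by (simp add: continuous_at_imp_continuous_on)

text \<open>By maximality of the integral curves: \<open>u \<mapsto> \<phi> (u + t) p\<close> is one that starts at \<open>\<phi> t p\<close>.\<close>

lemma flow_add:
  assumes t: "(t, p) \<in> D" and st: "(s + t, p) \<in> D"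
  shows "(s, \<phi> t p) \<in> D" "\<phi> s (\<phi> t p) = \<phi> (s + t) p"
proof -
  let ?J = "{u. (u + t, p) \<in> D}"
  have "is_interval ?J"
    unfolding is_interval_1
  proof (intro ballI allI impI)
    fix a b x assume "a \<in> ?J" "b \<in> ?J" "a \<le> x \<and> x \<le> b"
    then show "x \<in> ?J"
      using D_interval[of p, unfolded is_interval_1, THEN bspec, THEN bspec, of "a + t" "b + t"] by simp
  qed
  moreover have "open ?J" by (intro slice_open continuous_intros)
  moreover have "integral_curve M W ?J (\<lambda>u. \<phi> (u + t) p)"
  proof (rule integral_curveI)
    fix u assume "u \<in> ?J"
    then have "has_velocity M (\<lambda>t. \<phi> t p) (W (\<phi> (1 * u + t) p)) (1 * u + t) UNIV"
      by (simp add: flow_velocity)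
    from has_velocity_affine[OF this, of UNIV]
    show "has_velocity M (\<lambda>u. \<phi> (u + t) p) (W (\<phi> (u + t) p)) u UNIV" by simp
  qed
  ultimately show "(s, \<phi> t p) \<in> D" "\<phi> s (\<phi> t p) = \<phi> (s + t) p"
    using flow_maximal[of ?J "\<lambda>u. \<phi> (u + t) p" s] t st by auto
qed

lemma flow_inverse:
  assumes "(t, p) \<in> D"
  shows "(- t, \<phi> t p) \<in> D" "\<phi> (- t) (\<phi> t p) = p"
  using flow_add[of t p "- t"] assms zero_in_D flow_zero by auto

lemma flow_chart_open:
  assumes c: "c \<in> M" and d: "d \<in> M"
  shows "open {(t, x). x \<in> snd c ` fst c \<and> (t, chart_inv c x) \<in> D \<and> \<phi> t (chart_inv c x) \<in> fst d}"
    (is "open ?S")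
proof -
  let ?U = "(UNIV :: real set) \<times> snd c ` fst c" and ?G = "\<lambda>z. (fst z, chart_inv c (snd z))"
  have "open (D \<inter> (\<lambda>(t, p). \<phi> t p) -` fst d)"
    using continuous_on_open_vimage[OF D_open] flow_continuous chart_open[OF d] by (metis Int_commute)
  moreover have "continuous_on ?U ?G"
    by (intro continuous_intros continuous_on_compose2[OF chart_inv_continuous[OF c]]) auto
  moreover have "open ?U" by (intro open_Times open_UNIV chart_image_open c)
  ultimately have "open (?G -` (D \<inter> (\<lambda>(t, p). \<phi> t p) -` fst d) \<inter> ?U)"
    using continuous_on_open_vimage by blast
  also have "\<dots> = ?S" by auto
  finally show ?thesis .
qed

lemma flow_chart_smooth:
  assumes "c \<in> M" "d \<in> M"
  shows "smooth_on {(t, x). x \<in> snd c ` fst c \<and> (t, chart_inv c x) \<in> D \<and> \<phi> t (chart_inv c x) \<in> fst d}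
    (\<lambda>(t, x). snd d (\<phi> t (chart_inv c x)))"
  using flow assms unfolding is_flow_def by blast

text \<open>Joint smoothness provides a derivative in \<open>(t, x)\<close>; its restriction to the first factor is the
  velocity of a flow line, its restriction to the second factor the differential of \<open>\<phi> t\<close>.\<close>

lemma flow_has_derivative:
  assumes tp: "(t, p) \<in> D"
  defines "c \<equiv> chart_at M p" and "d \<equiv> chart_at M (\<phi> t p)"
  shows "((\<lambda>z. snd d (\<phi> (fst z) (chart_inv c (snd z)))) has_derivative
    (\<lambda>z. fst z *\<^sub>R W (\<phi> t p) + differential_at M (\<phi> t) p (snd z))) (at (t, snd c p))"
    "linear (differential_at M (\<phi> t) p)"
proof -
  let ?g = "\<lambda>z. snd d (\<phi> (fst z) (chart_inv c (snd z)))"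
  have c: "c \<in> M" "p \<in> fst c" "d \<in> M" "\<phi> t p \<in> fst d"
    unfolding c_def d_def by (simp_all add: chart_at_in)
  have "(\<lambda>(t, x). snd d (\<phi> t (chart_inv c x))) differentiable (at (t, snd c p))"
    by (rule smooth_on_imp_differentiable_at[OF flow_chart_smooth[OF c(1,3)] flow_chart_open[OF c(1,3)]])
       (use c tp in \<open>auto simp: chart_inv_left\<close>)
  then obtain g' where g': "(?g has_derivative g') (at (t, snd c p))"
    unfolding differentiable_def case_prod_unfold by blast
  have lin: "linear g'" using g' has_derivative_linear by blast
  have "((\<lambda>x. ?g (t, x)) has_derivative (\<lambda>v. g' (0, v))) (at (snd c p))"
    by (rule has_derivative_compose[where f = "\<lambda>x. (t, x)" and g = ?g, OF _ g'])
       (auto intro!: derivative_eq_intros)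
  from fun_cong[OF frechet_derivative_at[OF this]]
  have diff: "differential_at M (\<phi> t) p v = g' (0, v)" for v
    unfolding differential_at_def comp_def c_def d_def by simp
  have "((\<lambda>s. ?g (s, snd c p)) has_derivative (\<lambda>a. g' (a, 0))) (at t)"
    by (rule has_derivative_compose[where f = "\<lambda>s. (s, snd c p)" and g = ?g, OF _ g'])
       (auto intro!: derivative_eq_intros)
  moreover have "((\<lambda>s. ?g (s, snd c p)) has_derivative (\<lambda>a. a *\<^sub>R W (\<phi> t p))) (at t)"
    using flow_velocity[OF tp] c
    unfolding has_velocity_def has_vector_derivative_def d_def[symmetric] by (simp add: chart_inv_left)
  ultimately have "(\<lambda>a. g' (a, 0)) = (\<lambda>a. a *\<^sub>R W (\<phi> t p))"
    by (rule has_derivative_unique)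
  then have W: "g' (a, 0) = a *\<^sub>R W (\<phi> t p)" for a by meson
  have "g' z = fst z *\<^sub>R W (\<phi> t p) + differential_at M (\<phi> t) p (snd z)" for z
    using linear_add[OF lin, of "(fst z, 0)" "(0, snd z)"] unfolding diff W by simp
  then have "g' = (\<lambda>z. fst z *\<^sub>R W (\<phi> t p) + differential_at M (\<phi> t) p (snd z))" by (rule ext)
  then show "(?g has_derivative (\<lambda>z. fst z *\<^sub>R W (\<phi> t p) + differential_at M (\<phi> t) p (snd z)))
      (at (t, snd c p))" using g' by (simp only:)
  show "linear (differential_at M (\<phi> t) p)"
  proof (rule linearI)
    show "differential_at M (\<phi> t) p (u + v) = differential_at M (\<phi> t) p u + differential_at M (\<phi> t) p v" for u v
      unfolding diff using linear_add[OF lin, of "(0, u)" "(0, v)"] by simp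
    show "differential_at M (\<phi> t) p (k *\<^sub>R u) = k *\<^sub>R differential_at M (\<phi> t) p u" for k u
      unfolding diff using linear_scale[OF lin, of k "(0, u)"] by simp
  qed
qed

text \<open>The kinematics of the wind: a point that moves along \<open>\<sigma>\<close> while being carried by the flow for the time \<open>\<tau>\<close>
  gains \<open>\<tau>'\<close> times the wind.\<close>

lemma moved_curve_velocity:
  assumes \<sigma>: "has_velocity M \<sigma> V u I" and \<tau>: "(\<tau> has_vector_derivative \<tau>') (at u within I)"
    and u: "u \<in> I" and D: "(\<tau> u, \<sigma> u) \<in> D"
  shows "has_velocity M (\<lambda>s. \<phi> (\<tau> s) (\<sigma> s))
    (\<tau>' *\<^sub>R W (\<phi> (\<tau> u) (\<sigma> u)) + differential_at M (\<phi> (\<tau> u)) (\<sigma> u) V) u I"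
proof -
  let ?c = "chart_at M (\<sigma> u)" and ?d = "chart_at M (\<phi> (\<tau> u) (\<sigma> u))"
  let ?g = "\<lambda>z. snd ?d (\<phi> (fst z) (chart_inv ?c (snd z)))"
  let ?L = "\<lambda>z. fst z *\<^sub>R W (\<phi> (\<tau> u) (\<sigma> u)) + differential_at M (\<phi> (\<tau> u)) (\<sigma> u) (snd z)"
  have \<sigma>c: "continuous (at u within I) \<sigma>"
    and \<sigma>v: "((\<lambda>s. snd ?c (\<sigma> s)) has_derivative (\<lambda>s. s *\<^sub>R V)) (at u within I)"
    using \<sigma> unfolding has_velocity_def has_vector_derivative_def by blast+
  have "((\<lambda>s. (\<tau> s, snd ?c (\<sigma> s))) has_derivative (\<lambda>s. (s *\<^sub>R \<tau>', s *\<^sub>R V))) (at u within I)"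
    using \<tau> unfolding has_vector_derivative_def by (intro has_derivative_Pair \<sigma>v)
  from has_derivative_compose[OF this flow_has_derivative(1)[OF D]]
  have "((\<lambda>s. ?g (\<tau> s, snd ?c (\<sigma> s))) has_derivative (\<lambda>s. ?L (s *\<^sub>R \<tau>', s *\<^sub>R V))) (at u within I)" .
  moreover have "\<forall>\<^sub>F s in at u within I. ?g (\<tau> s, snd ?c (\<sigma> s)) = snd ?d (\<phi> (\<tau> s) (\<sigma> s))"
    using eventually_in_open[OF \<sigma>c chart_open chart_at_in(2)] chart_at_in(1)
    by (auto elim!: eventually_mono simp: chart_inv_left chart_at_in)
  ultimately have "((\<lambda>s. snd ?d (\<phi> (\<tau> s) (\<sigma> s))) has_derivative (\<lambda>s. ?L (s *\<^sub>R \<tau>', s *\<^sub>R V))) (at u within I)"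
    by (rule has_derivative_transform_eventually) (simp_all add: chart_inv_left chart_at_in u)
  moreover have "?L (s *\<^sub>R \<tau>', s *\<^sub>R V) = s *\<^sub>R ?L (\<tau>', V)" for s
    using linear_scale[OF flow_has_derivative(2)[OF D]] by (simp add: scaleR_add_right)
  ultimately have "((\<lambda>s. snd ?d (\<phi> (\<tau> s) (\<sigma> s))) has_vector_derivative ?L (\<tau>', V)) (at u within I)"
    unfolding has_vector_derivative_def by (simp only:)
  moreover have "isCont (\<lambda>(t, p). \<phi> t p) (\<tau> u, \<sigma> u)"
    using flow_continuous D_open D continuous_on_eq_continuous_at by blast
  from continuous_within_compose3[where f = "\<lambda>s. (\<tau> s, \<sigma> s)", OF this
      continuous_Pair[OF has_vector_derivative_continuous[OF \<tau>] \<sigma>c]]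
  have "continuous (at u within I) (\<lambda>s. \<phi> (\<tau> s) (\<sigma> s))" by simp
  ultimately show ?thesis unfolding has_velocity_def by simp
qed

lemma moved_curve_smooth:
  assumes \<sigma>: "smooth_curve M I \<sigma>" and \<tau>: "smooth_on I \<tau>" and D: "\<And>s. s \<in> I \<Longrightarrow> (\<tau> s, \<sigma> s) \<in> D"
  shows "smooth_curve M I (\<lambda>s. \<phi> (\<tau> s) (\<sigma> s))"
proof (rule smooth_curveI)
  fix u assume u: "u \<in> I"
  let ?c = "chart_at M (\<sigma> u)" and ?d = "chart_at M (\<phi> (\<tau> u) (\<sigma> u))"
  let ?S = "{(t, x). x \<in> snd ?c ` fst ?c \<and> (t, chart_inv ?c x) \<in> D \<and> \<phi> t (chart_inv ?c x) \<in> fst ?d}"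
  have cont: "continuous_on I \<sigma>" using \<sigma> unfolding smooth_curve_def by blast
  have "continuous_on I (\<lambda>s. (\<lambda>(t, p). \<phi> t p) (\<tau> s, \<sigma> s))"
    by (rule continuous_on_compose2[OF flow_continuous])
       (auto intro!: continuous_on_Pair smooth_on_imp_continuous_on \<tau> cont D)
  then have "continuous_on I (\<lambda>s. \<phi> (\<tau> s) (\<sigma> s))" by simp
  then obtain K where K: "open K" "K \<inter> I = (\<lambda>s. \<phi> (\<tau> s) (\<sigma> s)) -` fst ?d \<inter> I"
    using chart_open[OF chart_at_in(1)] unfolding continuous_on_open_invariant by blast
  obtain N where N: "open N" "u \<in> N" "\<forall>s\<in>I \<inter> N. \<sigma> s \<in> fst ?c" "smooth_on (I \<inter> N) (\<lambda>s. snd ?c (\<sigma> s))"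
    by (rule smooth_curve_coordinates[OF \<sigma> chart_at_in(1) u chart_at_in(2)])
  have "smooth_on (I \<inter> (N \<inter> K)) (\<lambda>s. (\<tau> s, snd ?c (\<sigma> s)))"
    by (intro smooth_on_Pair smooth_on_subset[OF \<tau>] smooth_on_subset[OF N(4)]) auto
  moreover have in_d: "\<phi> (\<tau> s) (\<sigma> s) \<in> fst ?d" if "s \<in> I" "s \<in> K" for s using K(2) that by blast
  then have "(\<lambda>s. (\<tau> s, snd ?c (\<sigma> s))) ` (I \<inter> (N \<inter> K)) \<subseteq> ?S"
    using N(3) D by (auto simp: chart_inv_left chart_at_in)
  ultimately have "smooth_on (I \<inter> (N \<inter> K)) (\<lambda>s. (\<lambda>(t, x). snd ?d (\<phi> t (chart_inv ?c x))) (\<tau> s, snd ?c (\<sigma> s)))"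
    by (rule smooth_on_compose[OF _ flow_chart_smooth[OF chart_at_in(1) chart_at_in(1)]])
  then have "smooth_on (I \<inter> (N \<inter> K)) (\<lambda>s. snd ?d (\<phi> (\<tau> s) (\<sigma> s)))"
    by (rule smooth_on_cong) (use N(3) in \<open>auto simp: chart_inv_left chart_at_in\<close>)
  moreover have "u \<in> K" using K(2) u chart_at_in(2) by blast
  ultimately show "\<exists>c N. c \<in> M \<and> open N \<and> u \<in> N \<and> (\<forall>s\<in>I \<inter> N. \<phi> (\<tau> s) (\<sigma> s) \<in> fst c) \<and>
      smooth_on (I \<inter> N) (\<lambda>s. snd c (\<phi> (\<tau> s) (\<sigma> s)))"
    using N(1,2) K(1) in_d by (intro exI[of _ ?d] exI[of _ "N \<inter> K"]) (simp add: chart_at_in open_Int)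
qed

lemma differential_zero: "differential_at M (\<phi> 0) p V = V"
proof -
  have "\<phi> 0 = (\<lambda>p. p)" using flow_zero by (rule ext)
  then show ?thesis
    using to_chart_at[of p V] unfolding differential_at_def to_chart_def comp_def by simp
qed

text \<open>Both sides are the derivative of \<open>s \<mapsto> \<phi> t (\<phi> s p) = \<phi> (s + t) p\<close> at \<open>s = 0\<close>.\<close>

lemma flow_preserves_wind:
  assumes "(t, p) \<in> D"
  shows "differential_at M (\<phi> t) p (W p) = W (\<phi> t p)"
proof -
  define I where "I = {s. (s, p) \<in> D} \<inter> {s. (1 * s + t, p) \<in> D}"
  have "open I" unfolding I_def by (intro open_Int slice_open continuous_intros)
  moreover have 0: "0 \<in> I" unfolding I_def using assms zero_in_D by simp
  ultimately have nt: "at 0 within I \<noteq> bot" using at_within_open[of 0 I] by simp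
  have "has_velocity M (\<lambda>s. \<phi> s p) (W p) 0 I"
    using has_velocity_within_subset[OF flow_velocity[OF zero_in_D]] by (simp add: flow_zero)
  moreover have "((\<lambda>s. t) has_vector_derivative 0) (at 0 within I)" by simp
  ultimately have "has_velocity M (\<lambda>s. \<phi> t (\<phi> s p))
      (0 *\<^sub>R W (\<phi> t (\<phi> 0 p)) + differential_at M (\<phi> t) (\<phi> 0 p) (W p)) 0 I"
    by (rule moved_curve_velocity) (use 0 assms in \<open>simp_all add: flow_zero\<close>)
  then have "has_velocity M (\<lambda>s. \<phi> t (\<phi> s p)) (differential_at M (\<phi> t) p (W p)) 0 I"
    unfolding flow_zero scaleR_zero_left add_0 .
  then have "has_velocity M (\<lambda>s. \<phi> (1 * s + t) p) (differential_at M (\<phi> t) p (W p)) 0 I"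
    by (rule has_velocity_cong[OF _ 0]) (use flow_add(2)[of _ p t] in \<open>simp add: I_def add.commute\<close>)
  moreover have "has_velocity M (\<lambda>t. \<phi> t p) (W (\<phi> t p)) (1 * 0 + t) UNIV"
    using flow_velocity[OF assms] by simp
  then have "has_velocity M (\<lambda>s. \<phi> (1 * s + t) p) (1 *\<^sub>R W (\<phi> t p)) 0 I"
    by (rule has_velocity_affine) simp
  ultimately show ?thesis using has_velocity_unique_at[OF _ _ nt] by (metis scaleR_one)
qed

end

context smooth_manifold
begin

lemma curve_through:
  obtains \<sigma> J where "open J" "(0::real) \<in> J" "\<sigma> 0 = p" "continuous_on J \<sigma>" "has_velocity M \<sigma> V 0 J"
proof -
  let ?c = "chart_at M p"
  define x where "x s = snd ?c p + s *\<^sub>R V" for s :: real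
  define J where "J = x -` (snd ?c ` fst ?c)"
  define \<sigma> where "\<sigma> s = chart_inv ?c (x s)" for s
  have x: "continuous_on S x" for S unfolding x_def by (intro continuous_intros)
  have J: "open J" unfolding J_def by (intro open_vimage chart_image_open chart_at_in x)
  have 0: "0 \<in> J" unfolding J_def x_def using chart_at_in by auto
  have \<sigma>0: "\<sigma> 0 = p" unfolding \<sigma>_def x_def by (simp add: chart_inv_left chart_at_in)
  have cont: "continuous_on J \<sigma>" unfolding \<sigma>_def
    by (rule continuous_on_compose2[OF chart_inv_continuous[OF chart_at_in(1)] x]) (auto simp: J_def)
  have "(x has_vector_derivative V) (at 0 within J)"
    unfolding x_def by (auto intro!: derivative_eq_intros)
  then have "((\<lambda>s. snd ?c (\<sigma> s)) has_vector_derivative V) (at 0 within J)"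
    by (rule has_vector_derivative_transform[OF 0, rotated])
       (auto simp: \<sigma>_def J_def chart_inv_right[OF chart_at_in(1)])
  moreover have "continuous (at 0 within J) \<sigma>"
    using cont 0 by (simp add: continuous_on_eq_continuous_within)
  ultimately show thesis using that J 0 \<sigma>0 cont unfolding has_velocity_def by metis
qed

end

context zermelo_navigation
begin

text \<open>The chain rule for \<open>\<phi> (s + t) = \<phi> s \<circ> \<phi> t\<close>, obtained by following the velocity of a test curve.\<close>

lemma differential_add:
  assumes t: "(t, p) \<in> D" and st: "(s + t, p) \<in> D"
  shows "differential_at M (\<phi> (s + t)) p V = differential_at M (\<phi> s) (\<phi> t p) (differential_at M (\<phi> t) p V)"
proof -
  obtain \<sigma> J where \<sigma>: "open J" "(0::real) \<in> J" "\<sigma> 0 = p" "continuous_on J \<sigma>" "has_velocity M \<sigma> V 0 J"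
    by (rule curve_through)
  have slice: "open {q. (a, q) \<in> D}" for a
  proof -
    have "{q. (a, q) \<in> D} = (\<lambda>q. (a, q)) -` D" by auto
    then show ?thesis
      by (simp add: open_vimage[OF D_open] continuous_on_Pair)
  qed
  define I where "I = \<sigma> -` ({q. (t, q) \<in> D} \<inter> {q. (s + t, q) \<in> D}) \<inter> J"
  have "open I" unfolding I_def
    using \<sigma>(1,4) continuous_on_open_vimage open_Int slice by blast
  moreover have 0: "0 \<in> I" unfolding I_def using assms \<sigma> by simp
  ultimately have nt: "at 0 within I \<noteq> bot" using at_within_open[of 0 I] by simp
  have V: "has_velocity M \<sigma> V 0 I"
    using \<sigma>(5) by (rule has_velocity_within_subset) (auto simp: I_def)
  have const: "((\<lambda>s. k) has_vector_derivative 0) (at 0 within I)" for k :: real by simp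
  have "has_velocity M (\<lambda>u. \<phi> (s + t) (\<sigma> u))
      (0 *\<^sub>R W (\<phi> (s + t) (\<sigma> 0)) + differential_at M (\<phi> (s + t)) (\<sigma> 0) V) 0 I"
    by (rule moved_curve_velocity[OF V const 0]) (use st \<sigma> in simp)
  moreover have "has_velocity M (\<lambda>u. \<phi> t (\<sigma> u))
      (0 *\<^sub>R W (\<phi> t (\<sigma> 0)) + differential_at M (\<phi> t) (\<sigma> 0) V) 0 I"
    by (rule moved_curve_velocity[OF V const 0]) (use t \<sigma> in simp)
  then have "has_velocity M (\<lambda>u. \<phi> s (\<phi> t (\<sigma> u))) (0 *\<^sub>R W (\<phi> s (\<phi> t (\<sigma> 0))) +
      differential_at M (\<phi> s) (\<phi> t (\<sigma> 0)) (0 *\<^sub>R W (\<phi> t (\<sigma> 0)) + differential_at M (\<phi> t) (\<sigma> 0) V)) 0 I"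
    by (rule moved_curve_velocity[OF _ const 0]) (use flow_add(1)[OF assms] \<sigma> in simp)
  then have "has_velocity M (\<lambda>u. \<phi> (s + t) (\<sigma> u)) (0 *\<^sub>R W (\<phi> s (\<phi> t (\<sigma> 0))) +
      differential_at M (\<phi> s) (\<phi> t (\<sigma> 0)) (0 *\<^sub>R W (\<phi> t (\<sigma> 0)) + differential_at M (\<phi> t) (\<sigma> 0) V)) 0 I"
    by (rule has_velocity_cong[OF _ 0]) (auto simp: I_def flow_add(2))
  ultimately show ?thesis
    using has_velocity_unique_at[OF _ _ nt] \<sigma>(3) by (metis add_0 scaleR_zero_left)
qed

text \<open>The Killing condition says that the pullback of \<open>h\<close> by \<open>\<phi> t\<close> is stationary at \<open>t = 0\<close>. Applied at the
  point \<open>\<phi> s p\<close>, it shows by the group law that the pullback is stationary at every time \<open>s\<close>, hence constant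
  on the interval on which the flow line of \<open>p\<close> is defined.\<close>

lemma flow_isometry:
  assumes "(t, p) \<in> D"
  shows "h (\<phi> t p) (differential_at M (\<phi> t) p U) (differential_at M (\<phi> t) p V) = h p U V"
proof -
  let ?T = "{t. (t, p) \<in> D}"
  let ?g = "\<lambda>t. h (\<phi> t p) (differential_at M (\<phi> t) p U) (differential_at M (\<phi> t) p V)"
  have "(?g has_real_derivative 0) (at s within ?T)" if s: "s \<in> ?T" for s
  proof -
    let ?q = "\<phi> s p" and ?U = "differential_at M (\<phi> s) p U" and ?V = "differential_at M (\<phi> s) p V"
    have K: "((\<lambda>t. h (\<phi> t ?q) (differential_at M (\<phi> t) ?q ?U) (differential_at M (\<phi> t) ?q ?V))
        has_real_derivative 0) (at 0)"
      using killing unfolding killing_flow_def has_lie_derivative_def by blast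
    have "((\<lambda>t. ?g (t + s)) has_real_derivative 0) (at 0)"
    proof (rule has_field_derivative_transform_within_open[OF K])
      show "open {t. (t + s, p) \<in> D}" by (intro slice_open continuous_intros)
      show "0 \<in> {t. (t + s, p) \<in> D}" using s by simp
      show "h (\<phi> t ?q) (differential_at M (\<phi> t) ?q ?U) (differential_at M (\<phi> t) ?q ?V) = ?g (t + s)"
        if "t \<in> {t. (t + s, p) \<in> D}" for t
        using that s by (simp add: flow_add(2) differential_add)
    qed
    then have "(?g has_real_derivative 0) (at s)"
      using DERIV_shift[of ?g 0 0 s] by simp
    then show ?thesis by (rule has_field_derivative_at_within)
  qed
  from has_field_derivative_zero_constant[OF is_interval_convex[OF D_interval] this]
  obtain k where k: "\<And>s. s \<in> ?T \<Longrightarrow> ?g s = k" by auto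
  show ?thesis
    using k[of t] k[of 0] assms zero_in_D by (simp add: flow_zero differential_zero)
qed

text \<open>If everything is carried along by the flow at the rate \<open>\<epsilon>\<close>, a fire in the wind \<open>X\<close> becomes a fire
  in the wind \<open>Y\<close>. Only \<open>\<epsilon> = 1\<close> (from still air to \<open>W\<close>) and \<open>\<epsilon> = -1\<close> (back) will be needed.\<close>

definition wind_shift :: "real \<Rightarrow> ('m \<Rightarrow> 'e) \<Rightarrow> ('m \<Rightarrow> 'e) \<Rightarrow> bool" where
  "wind_shift \<epsilon> X Y \<longleftrightarrow>
     (\<forall>t p. (t, p) \<in> D \<longrightarrow> Y (\<phi> t p) = \<epsilon> *\<^sub>R W (\<phi> t p) + differential_at M (\<phi> t) p (X p))"

lemma wind_shift_on: "wind_shift 1 (\<lambda>_. 0) W"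
  unfolding wind_shift_def using linear_0[OF flow_has_derivative(2)] by simp

lemma wind_shift_off: "wind_shift (- 1) W (\<lambda>_. 0)"
  unfolding wind_shift_def using flow_preserves_wind by simp

text \<open>The differential of the flow, an isometry, maps \<open>V - l X\<close> to the vector on the left-hand side. By the Zermelo
  condition, the moved curve is therefore slower than a clock of rate \<open>l\<close> in the wind \<open>Y\<close> if and only if the
  original curve was so in the wind \<open>X\<close>.\<close>

lemma shift_norm:
  assumes "wind_shift \<epsilon> X Y" "(t, p) \<in> D"
  shows "h (\<phi> t p) ((\<epsilon> * l) *\<^sub>R W (\<phi> t p) + differential_at M (\<phi> t) p V - l *\<^sub>R Y (\<phi> t p))
      ((\<epsilon> * l) *\<^sub>R W (\<phi> t p) + differential_at M (\<phi> t) p V - l *\<^sub>R Y (\<phi> t p)) =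
    h p (V - l *\<^sub>R X p) (V - l *\<^sub>R X p)"
proof -
  note lin = flow_has_derivative(2)[OF assms(2)]
  have "(\<epsilon> * l) *\<^sub>R W (\<phi> t p) + differential_at M (\<phi> t) p V - l *\<^sub>R Y (\<phi> t p) =
      differential_at M (\<phi> t) p (V - l *\<^sub>R X p)"
    using assms unfolding wind_shift_def
    by (simp add: linear_diff[OF lin] linear_scale[OF lin] algebra_simps)
  then show ?thesis using flow_isometry[OF assms(2)] by simp
qed

lemma shift_less:
  assumes "mild_wind X" "mild_wind Y" "wind_shift \<epsilon> X Y" "(t, p) \<in> D" "randers X p V < l"
  shows "randers Y (\<phi> t p) ((\<epsilon> * l) *\<^sub>R W (\<phi> t p) + differential_at M (\<phi> t) p V) < l"
  using assms(5) unfolding randers_less_iff[OF assms(1)] randers_less_iff[OF assms(2)]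
    shift_norm[OF assms(3,4)] .

lemma shift_eq:
  assumes "mild_wind X" "mild_wind Y" "wind_shift \<epsilon> X Y" "(t, p) \<in> D"
  shows "randers Y (\<phi> t p)
    ((\<epsilon> * randers X p V) *\<^sub>R W (\<phi> t p) + differential_at M (\<phi> t) p V) = randers X p V"
  by (rule randers_eqI[OF assms(2) randers_nonneg[OF assms(1)]])
     (use shift_norm[OF assms(3,4)] zermelo_identity[OF assms(1)] in metis)

end

section \<open>Short curves stay near their starting point\<close>

lemma (in smooth_manifold) chart_preimage_open:
  assumes "c \<in> M" "open U"
  shows "open (snd c -` U \<inter> fst c)"
  using continuous_on_open_vimage[OF chart_open[OF assms(1)]] chart_continuous[OF assms(1)] assms(2) by blast

context riemannian_manifold
begin

context
  fixes X :: "'m \<Rightarrow> 'e"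
  assumes X: "mild_wind X"
begin

text \<open>By homogeneity it suffices to minimize over the compact set of pairs of a point of \<open>K\<close> and a Euclidean
  unit vector.\<close>

lemma chart_metric_lower_bound:
  assumes c: "c \<in> M" and K: "compact K" "K \<subseteq> snd c ` fst c"
  obtains m where "m > 0"
    "\<And>x v. x \<in> K \<Longrightarrow> m * norm v \<le> randers X (chart_inv c x) (from_chart M c (chart_inv c x) v)"
proof (cases "K = {}")
  case True
  then show thesis using that[of 1] by simp
next
  case False
  let ?G = "\<lambda>x v. randers X (chart_inv c x) (from_chart M c (chart_inv c x) v)"
  let ?S = "K \<times> sphere (0 :: 'e) 1"
  have lin: "linear (from_chart M c (chart_inv c x))" if "x \<in> K" for x
    using from_chart_linear[OF c chart_inv_in[OF c]] K that by blast
  have pos: "?G x v > 0" if "x \<in> K" "v \<noteq> 0" for x v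
  proof (rule randers_pos[OF X])
    have "chart_inv c x \<in> fst c" using chart_inv_in[OF c] K(2) that by blast
    then show "from_chart M c (chart_inv c x) v \<noteq> 0"
      using to_from_chart[OF c, of "chart_inv c x" v] that linear_0[OF to_chart_linear[OF c]] by metis
  qed
  obtain e :: 'e where "norm e = 1" using vector_choose_size[of 1] by auto
  then have ne: "?S \<noteq> {}" using False by (auto simp: dist_norm)
  have "compact ?S" using K by (intro compact_Times compact_sphere)
  moreover have "continuous_on ?S (chart_metric c (randers X))"
    by (rule continuous_on_subset[OF chart_metric_continuous[OF X c]]) (use K(2) in auto)
  ultimately obtain z where z: "z \<in> ?S"
    "\<And>y. y \<in> ?S \<Longrightarrow> chart_metric c (randers X) z \<le> chart_metric c (randers X) y"
    using continuous_attains_inf[OF _ ne] by blast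
  define m where "m = chart_metric c (randers X) z"
  show thesis
  proof (rule that)
    show "m > 0"
    proof -
      have "fst z \<in> K" "snd z \<noteq> 0" using z(1) by auto
      from pos[OF this] show ?thesis unfolding m_def chart_metric_def by (simp add: case_prod_unfold)
    qed
    fix x v assume x: "x \<in> K"
    show "m * norm v \<le> ?G x v"
    proof (cases "v = 0")
      case False
      have "m \<le> ?G x (v /\<^sub>R norm v)"
        using z(2)[of "(x, v /\<^sub>R norm v)"] x False unfolding m_def chart_metric_def by simp
      moreover have "?G x v = norm v * ?G x (v /\<^sub>R norm v)"
        using False by (simp add: randers_scale[OF X] linear_scale[OF lin[OF x]])
      ultimately show ?thesis by (metis mult.commute mult_left_mono norm_ge_zero)
    qed (simp add: randers_nonneg[OF X])
  qed
qed

lemma coordinate_displacement: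
  assumes \<gamma>: "smooth_curve M {a..b} \<gamma>" and ab: "a < b" and c: "c \<in> M" and m: "m > 0"
    and bound: "\<And>x v. x \<in> K \<Longrightarrow>
      m * norm v \<le> randers X (chart_inv c x) (from_chart M c (chart_inv c x) v)"
    and t: "t \<in> {a..b}" and inside: "\<And>s. s \<in> {a..t} \<Longrightarrow> \<gamma> s \<in> fst c \<and> snd c (\<gamma> s) \<in> K"
  shows "norm (snd c (\<gamma> t) - snd c (\<gamma> a)) \<le> wind_length X a b \<gamma> / m"
proof -
  let ?v = "\<lambda>s. to_chart M c (\<gamma> s) (velocity M {a..b} \<gamma> s)"
  let ?f = "\<lambda>s. randers X (\<gamma> s) (velocity M {a..b} \<gamma> s)"
  have "((\<lambda>s. snd c (\<gamma> s)) has_vector_derivative ?v s) (at s within {a..t})" if "s \<in> {a..t}" for s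
  proof -
    have s: "s \<in> {a..b}" "\<gamma> s \<in> fst c" using that t inside by auto
    have "((\<lambda>s. snd c (\<gamma> s)) has_vector_derivative ?v s) (at s within {a..b})"
      using smooth_curve_has_velocity[OF \<gamma> ab s(1)]
      unfolding has_velocity_chart[where \<gamma> = \<gamma> and t = s, OF c s(2) s(1)] by (rule conjunct2)
    then show ?thesis by (rule has_vector_derivative_within_subset) (use t in auto)
  qed
  then have ftc: "(?v has_integral snd c (\<gamma> t) - snd c (\<gamma> a)) {a..t}"
    using t by (intro fundamental_theorem_of_calculus) auto
  have int: "?f integrable_on {a..b}"
    by (intro integrable_continuous_interval speed_continuous X \<gamma> ab)
  then have int': "?f integrable_on {a..t}"
    by (rule integrable_subinterval_real) (use t in auto)
  have "norm (integral {a..t} ?v) \<le> integral {a..t} (\<lambda>s. ?f s / m)"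
  proof (rule integral_norm_bound_integral)
    fix s assume s: "s \<in> {a..t}"
    have "m * norm (?v s) \<le> ?f s"
      using bound[of "snd c (\<gamma> s)" "?v s"] inside[OF s] by (simp add: chart_inv_left from_to_chart c)
    then show "norm (?v s) \<le> ?f s / m" using m by (simp add: field_simps)
  qed (use ftc int' in \<open>auto simp: has_integral_iff divide_inverse intro: integrable_on_mult_left\<close>)
  also have "\<dots> = integral {a..t} ?f / m" by simp
  also have "\<dots> \<le> integral {a..b} ?f / m"
    using t m int int' by (intro divide_right_mono integral_subset_le) (auto intro: randers_nonneg[OF X])
  finally show ?thesis
    using integral_unique[OF ftc] unfolding curve_length_def by simp
qed

text \<open>The length of the curve bounds its displacement in the chart, but only as long as the curve has not
  left the ball on which the metrics are compared; hence the argument by the first exit time.\<close>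

lemma smooth_curve_confined:
  assumes \<gamma>: "smooth_curve M {a..b} \<gamma>" and ab: "a < b" and c: "c \<in> M" and m: "m > 0"
    and ball: "cball x0 \<rho> \<subseteq> snd c ` fst c"
    and bound: "\<And>x v. x \<in> cball x0 \<rho> \<Longrightarrow>
      m * norm v \<le> randers X (chart_inv c x) (from_chart M c (chart_inv c x) v)"
    and start: "\<gamma> a \<in> fst c"
      "norm (snd c (\<gamma> a) - x0) + wind_length X a b \<gamma> / m < \<rho>"
    and t: "t \<in> {a..b}"
  shows "\<gamma> t \<in> fst c \<and>
    norm (snd c (\<gamma> t) - x0) \<le> norm (snd c (\<gamma> a) - x0) + wind_length X a b \<gamma> / m"
proof -
  define R where "R = norm (snd c (\<gamma> a) - x0) + wind_length X a b \<gamma> / m"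
  have L: "wind_length X a b \<gamma> / m \<ge> 0"
    using curve_length_nonneg[OF X] m by simp
  have R: "R < \<rho>" using start(2) unfolding R_def .
  define U where "U = chart_inv c ` ball x0 \<rho>"
  define B where "B = chart_inv c ` cball x0 R"
  have sub: "ball x0 \<rho> \<subseteq> snd c ` fst c" "cball x0 R \<subseteq> ball x0 \<rho>" using ball R by auto
  have image: "p \<in> chart_inv c ` S \<longleftrightarrow> p \<in> fst c \<and> snd c p \<in> S" if "S \<subseteq> snd c ` fst c" for S p
  proof
    assume "p \<in> chart_inv c ` S"
    then obtain x where "x \<in> S" "p = chart_inv c x" by blast
    then show "p \<in> fst c \<and> snd c p \<in> S"
      using that chart_inv_in[OF c, of x] chart_inv_right[OF c, of x] by auto
  next
    assume "p \<in> fst c \<and> snd c p \<in> S"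
    then show "p \<in> chart_inv c ` S" using chart_inv_left[OF c, of p] by (metis imageI)
  qed
  have U: "p \<in> U \<longleftrightarrow> p \<in> fst c \<and> norm (snd c p - x0) < \<rho>" for p
    unfolding U_def image[OF sub(1)] by (simp add: dist_norm norm_minus_commute)
  have B: "p \<in> B \<longleftrightarrow> p \<in> fst c \<and> norm (snd c p - x0) \<le> R" for p
    unfolding B_def image[OF order_trans[OF sub(2,1)]] by (simp add: dist_norm norm_minus_commute)
  have "U = snd c -` ball x0 \<rho> \<inter> fst c"
    by (rule set_eqI) (simp add: U dist_norm norm_minus_commute conj_commute)
  then have "open U"
    using chart_preimage_open[OF c open_ball] by simp
  have "compact B"
    unfolding B_def by (intro compact_continuous_image continuous_on_subset[OF chart_inv_continuous[OF c]])
      (use sub in auto)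
  then have "closed B" by (rule compact_imp_closed)
  have cont: "continuous_on {a..b} \<gamma>" using \<gamma> unfolding smooth_curve_def by blast
  have step: "\<gamma> s \<in> B" if "s \<in> {a..b}" "\<forall>u\<in>{a..s}. \<gamma> u \<in> U" for s
  proof -
    have in_ball: "\<gamma> u \<in> fst c \<and> snd c (\<gamma> u) \<in> cball x0 \<rho>" if "u \<in> {a..s}" for u
      using bspec[OF \<open>\<forall>u\<in>{a..s}. \<gamma> u \<in> U\<close> that] unfolding U by (simp add: dist_norm norm_minus_commute)
    have "norm (snd c (\<gamma> s) - snd c (\<gamma> a)) \<le> wind_length X a b \<gamma> / m"
      by (rule coordinate_displacement[OF \<gamma> ab c m bound that(1) in_ball])
    then have "norm (snd c (\<gamma> s) - x0) \<le> R"
      unfolding R_def using norm_triangle_ineq[of "snd c (\<gamma> s) - snd c (\<gamma> a)" "snd c (\<gamma> a) - x0"] by simp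
    moreover have "\<gamma> s \<in> fst c" using that U by auto
    ultimately show ?thesis using B by blast
  qed
  have a: "\<gamma> a \<in> U" unfolding U using start L by auto
  have "\<gamma> s \<in> U" if "s \<in> {a..b}" for s
  proof (rule ccontr)
    assume "\<gamma> s \<notin> U"
    \<comment> \<open>At the first exit time \<open>z\<close> the curve would still be in the smaller closed ball \<open>B\<close>.\<close>
    define Z where "Z = {a..b} \<inter> \<gamma> -` (- U)"
    have "closed Z"
      unfolding Z_def by (rule continuous_closed_preimage[OF cont]) (use \<open>open U\<close> in auto)
    then have "compact Z" unfolding Z_def
      by (metis Int_lower1 bounded_closed_interval bounded_subset compact_eq_bounded_closed)
    moreover have "Z \<noteq> {}" using that \<open>\<gamma> s \<notin> U\<close> unfolding Z_def by auto
    ultimately obtain z where z: "z \<in> Z" "\<forall>y\<in>Z. z \<le> y"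
      using compact_attains_inf by meson
    have "z \<noteq> a" using z(1) a unfolding Z_def by auto
    then have az: "a < z" "z \<le> b" using z(1) unfolding Z_def by auto
    have inU: "\<gamma> u \<in> U" if "u \<in> {a..<z}" for u
    proof (rule ccontr)
      assume "\<gamma> u \<notin> U"
      then have "u \<in> Z" unfolding Z_def using that az by auto
      then show False using z(2) that by fastforce
    qed
    have "s \<in> {a..b} \<and> \<gamma> s \<in> B" if "s \<in> {a..<z}" for s
      using step[of s] inU that az by simp
    then have "{a..<z} \<subseteq> {a..b} \<inter> \<gamma> -` B" by blast
    moreover have "closed ({a..b} \<inter> \<gamma> -` B)"
      by (rule continuous_closed_preimage[OF cont]) (use \<open>closed B\<close> in auto)
    ultimately have "closure {a..<z} \<subseteq> {a..b} \<inter> \<gamma> -` B" by (rule closure_minimal)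
    moreover have "z \<in> closure {a..<z}" using az by simp
    ultimately have "\<gamma> z \<in> B" by blast
    then have "\<gamma> z \<in> U" using U B R by auto
    then show False using z(1) unfolding Z_def by simp
  qed
  then have "\<gamma> t \<in> B" using step t by auto
  then show ?thesis using B unfolding R_def by blast
qed

lemma piecewise_curve_confined:
  assumes \<gamma>: "piecewise_smooth_curve M a b \<gamma>" and ab: "a < b" and c: "c \<in> M" and m: "m > 0"
    and ball: "cball x0 \<rho> \<subseteq> snd c ` fst c"
    and bound: "\<And>x v. x \<in> cball x0 \<rho> \<Longrightarrow>
      m * norm v \<le> randers X (chart_inv c x) (from_chart M c (chart_inv c x) v)"
    and start: "\<gamma> a \<in> fst c"
      "norm (snd c (\<gamma> a) - x0) + wind_length X a b \<gamma> / m < \<rho>"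
    and t: "t \<in> {a..b}"
  shows "\<gamma> t \<in> fst c \<and> norm (snd c (\<gamma> t) - x0) < \<rho>"
proof -
  let ?L = "\<lambda>s t. wind_length X s t \<gamma>"
  let ?Q = "\<lambda>s t. rectifiable (randers X) s t \<gamma> \<and>
    (\<gamma> s \<in> fst c \<and> norm (snd c (\<gamma> s) - x0) + ?L s t / m < \<rho> \<longrightarrow>
      (\<forall>u\<in>{s..t}. \<gamma> u \<in> fst c \<and> norm (snd c (\<gamma> u) - x0) \<le> norm (snd c (\<gamma> s) - x0) + ?L s t / m))"
  have "?Q a b"
  proof (rule piecewise_smooth_induct[OF \<gamma> ab])
    fix s t assume "s < t" "smooth_curve M {s..t} \<gamma>"
    then show "?Q s t"
      using smooth_rectifiable[OF X] smooth_curve_confined[OF _ _ c m ball bound] by blast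
  next
    fix s t u assume st: "s < t" "t < u" and Q: "?Q s t" "?Q t u"
    have rect: "rectifiable (randers X) s u \<gamma>" and len: "?L s u = ?L s t + ?L t u"
      using curve_length_combine[of s t u "randers X" \<gamma>] Q st by auto
    have pos: "?L s t / m \<ge> 0" "?L t u / m \<ge> 0" using curve_length_nonneg[OF X] m by simp_all
    have "\<gamma> w \<in> fst c \<and> norm (snd c (\<gamma> w) - x0) \<le> norm (snd c (\<gamma> s) - x0) + ?L s u / m"
      if "\<gamma> s \<in> fst c" "norm (snd c (\<gamma> s) - x0) + ?L s u / m < \<rho>" "w \<in> {s..u}" for w
    proof -
      have sum: "?L s u / m = ?L s t / m + ?L t u / m" using len by (simp add: add_divide_distrib)
      then have A: "\<forall>w\<in>{s..t}. \<gamma> w \<in> fst c \<and> norm (snd c (\<gamma> w) - x0) \<le> norm (snd c (\<gamma> s) - x0) + ?L s t / m"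
        using Q(1) that pos by linarith
      then have At: "\<gamma> t \<in> fst c" "norm (snd c (\<gamma> t) - x0) \<le> norm (snd c (\<gamma> s) - x0) + ?L s t / m"
        using st by auto
      then have B: "\<forall>w\<in>{t..u}. \<gamma> w \<in> fst c \<and> norm (snd c (\<gamma> w) - x0) \<le> norm (snd c (\<gamma> t) - x0) + ?L t u / m"
        using Q(2) that sum by linarith
      show ?thesis
      proof (cases "w \<le> t")
        case True
        then show ?thesis using A[THEN bspec, of w] that(3) sum pos by auto
      next
        case False
        then show ?thesis using B[THEN bspec, of w] that(3) sum pos At(2) by auto
      qed
    qed
    with rect show "?Q s u" by blast
  qed
  then show ?thesis using start t by fastforce
qed

text \<open>The flow need not be complete. A competitor of a short piece of a geodesic can be moved by the flow
  because it stays in a region on which the flow is defined for the required times.\<close>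

lemma short_curves_stay_near:
  assumes N: "open N" "q \<in> N"
  obtains N' \<eta> where "open N'" "q \<in> N'" "\<eta> > 0"
    "\<And>\<gamma> a b t. piecewise_smooth_curve M a b \<gamma> \<Longrightarrow> a < b \<Longrightarrow> \<gamma> a \<in> N' \<Longrightarrow>
      wind_length X a b \<gamma> < \<eta> \<Longrightarrow> t \<in> {a..b} \<Longrightarrow> \<gamma> t \<in> N"
proof -
  define c where "c = chart_at M q"
  have c: "c \<in> M" "q \<in> fst c" unfolding c_def by (rule chart_at_in)+
  define x0 where "x0 = snd c q"
  have "open (snd c ` (fst c \<inter> N))" by (intro chart_open_image c(1)) (auto simp: chart_open c N)
  then obtain \<rho> where \<rho>: "\<rho> > 0" "cball x0 \<rho> \<subseteq> snd c ` (fst c \<inter> N)"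
    using c N unfolding open_contains_cball x0_def by blast
  then have ball: "cball x0 \<rho> \<subseteq> snd c ` fst c" by blast
  obtain m where m: "m > 0" "\<And>x v. x \<in> cball x0 \<rho> \<Longrightarrow>
      m * norm v \<le> randers X (chart_inv c x) (from_chart M c (chart_inv c x) v)"
    using chart_metric_lower_bound[OF c(1) compact_cball ball] by blast
  show thesis
  proof (rule that[of "fst c \<inter> snd c -` ball x0 (\<rho> / 2)" "m * \<rho> / 2"])
    show "open (fst c \<inter> snd c -` ball x0 (\<rho> / 2))"
      using chart_preimage_open[OF c(1) open_ball] by (simp add: Int_commute)
    fix \<gamma> a b t
    assume \<gamma>: "piecewise_smooth_curve M a b \<gamma>" "a < b" "\<gamma> a \<in> fst c \<inter> snd c -` ball x0 (\<rho> / 2)"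
      "wind_length X a b \<gamma> < m * \<rho> / 2" "t \<in> {a..b}"
    have "wind_length X a b \<gamma> / m < \<rho> / 2"
      using \<gamma>(4) m(1) by (simp add: field_simps)
    moreover have "norm (snd c (\<gamma> a) - x0) < \<rho> / 2"
      using \<gamma>(3) by (simp add: dist_norm norm_minus_commute)
    ultimately have "norm (snd c (\<gamma> a) - x0) + wind_length X a b \<gamma> / m < \<rho>"
      by linarith
    from piecewise_curve_confined[OF \<gamma>(1,2) c(1) m(1) ball m(2) _ this \<gamma>(5)]
    have "\<gamma> t \<in> fst c \<and> norm (snd c (\<gamma> t) - x0) < \<rho>"
      using \<gamma>(3) by blast
    then have t: "\<gamma> t \<in> fst c" "snd c (\<gamma> t) \<in> snd c ` (fst c \<inter> N)"
      using subsetD[OF \<rho>(2), of "snd c (\<gamma> t)"] by (simp_all add: dist_norm norm_minus_commute)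
    from t(2) obtain p where p: "snd c (\<gamma> t) = snd c p" "p \<in> fst c \<inter> N" by (rule imageE)
    have "\<gamma> t = chart_inv c (snd c (\<gamma> t))" by (rule chart_inv_left[OF c(1) t(1), symmetric])
    also have "\<dots> = p" unfolding p(1) by (rule chart_inv_left[OF c(1)]) (use p(2) in blast)
    finally show "\<gamma> t \<in> N" using p(2) by blast
  next
    show "q \<in> fst c \<inter> snd c -` ball x0 (\<rho> / 2)" using c(2) \<rho>(1) by (simp add: x0_def)
    show "m * \<rho> / 2 > 0" using m(1) \<rho>(1) by simp
  qed
qed

end

end

section \<open>Geodesics in the moving frame\<close>

text \<open>A clock \<open>\<tau>\<close> along a curve of speed \<open>f\<close> that runs faster than arc length and needs exactly the time \<open>l\<close>.
  Arc length itself would not do: a Finsler metric is not smooth at the zero vector, so the arc length of a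
  smooth curve need not be smooth where the curve stops. A polynomial close to \<open>f\<close> is used instead.\<close>

lemma exists_clock:
  fixes f :: "real \<Rightarrow> real"
  assumes ab: "a < b" and f: "continuous_on {a..b} f" and l: "integral {a..b} f < l"
    and nonneg: "\<And>s. s \<in> {a..b} \<Longrightarrow> f s \<ge> 0"
  obtains \<tau> q where "smooth_on {a..b} \<tau>" "continuous_on {a..b} q" "integral {a..b} q = l"
    "\<And>s. s \<in> {a..b} \<Longrightarrow> f s < q s" "\<And>s. s \<in> {a..b} \<Longrightarrow> (\<tau> has_real_derivative q s) (at s)"
    "\<tau> a = T" "\<tau> b = T + l" "\<And>s. s \<in> {a..b} \<Longrightarrow> \<tau> s \<in> {T..T + l}"
proof -
  \<comment> \<open>The surplus of time is spread evenly, \<open>f + k\<close> is approximated by a polynomial \<open>g\<close>, and the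
    constant \<open>d\<close> restores the total time without using up the surplus.\<close>
  define k where "k = (l - integral {a..b} f) / (b - a)"
  have k: "k > 0" using ab l unfolding k_def by simp
  have kl: "integral {a..b} f + k * (b - a) = l" using ab unfolding k_def by simp
  have "compact {a..b}" "continuous_on {a..b} (\<lambda>s. f s + k)" "k / 4 > 0"
    using f k by (auto intro: continuous_intros)
  then obtain g where g: "real_polynomial_function g" "\<And>s. s \<in> {a..b} \<Longrightarrow> \<bar>(f s + k) - g s\<bar> < k / 4"
    using Stone_Weierstrass_real_polynomial_function by metis
  have gc: "continuous_on S g" for S
    using Ck_on_real_polynomial[OF g(1), of 0] by (auto intro: continuous_on_subset)
  define d where "d = (l - integral {a..b} g) / (b - a)"
  define q where "q s = g s + d" for s
  have qc: "continuous_on S q" for S unfolding q_def by (intro continuous_intros gc)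
  have fi: "f integrable_on {a..b}" and gi: "g integrable_on {a..b}"
    using f gc by (auto intro: integrable_continuous_interval)
  have fki: "(\<lambda>s. f s + k) integrable_on {a..b}" using fi by (intro integrable_add) auto
  have fk: "integral {a..b} (\<lambda>s. f s + k) = l"
    using fi ab kl by (subst integral_add) (auto simp: mult.commute)
  have q: "integral {a..b} q = l"
    unfolding q_def using gi ab by (subst integral_add) (auto simp: d_def)
  have "\<bar>l - integral {a..b} g\<bar> \<le> k / 4 * (b - a)"
  proof -
    have "integral {a..b} (\<lambda>s. (f s + k) - g s) = l - integral {a..b} g"
      unfolding fk[symmetric] by (rule integral_diff[OF fki gi])
    moreover have "norm (integral {a..b} (\<lambda>s. (f s + k) - g s)) \<le> integral {a..b} (\<lambda>s. k / 4)"
      using g(2) fki gi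
      by (intro integral_norm_bound_integral integrable_diff) (auto intro: less_imp_le)
    ultimately show ?thesis using ab by (simp add: mult.commute)
  qed
  then have d: "\<bar>d\<bar> \<le> k / 4"
    using ab unfolding d_def by (simp add: abs_divide pos_divide_le_eq)
  have fq: "f s < q s" if "s \<in> {a..b}" for s
    using g(2)[OF that] d k unfolding q_def by (simp add: abs_if split: if_splits)
  \<comment> \<open>Integrating from \<open>a - 1\<close> gives two-sided derivatives at the end points of \<open>{a..b}\<close>.\<close>
  define \<tau> where "\<tau> s = T + (integral {a - 1..s} q - integral {a - 1..a} q)" for s
  have deriv: "(\<tau> has_real_derivative q s) (at s)" if "s \<in> {a - 1<..<b + 1}" for s
  proof -
    have "((\<lambda>x. integral {a - 1..x} q) has_real_derivative q s) (at s within {a - 1..b + 1})"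
      by (rule integral_has_real_derivative[OF qc]) (use that in auto)
    moreover have "at s within {a - 1..b + 1} = at s"
      using that by (intro at_within_Icc_at) auto
    ultimately show ?thesis
      unfolding \<tau>_def by (auto intro!: derivative_eq_intros)
  qed
  have qk: "Ck_on k q S" if "open S" for k S
    unfolding q_def using that
    by (intro Ck_on_add Ck_on_const) (auto intro: Ck_on_subset[OF Ck_on_real_polynomial[OF g(1)]])
  have "smooth_on {a - 1<..<b + 1} \<tau>"
    by (rule smooth_on_antiderivative[OF _ qk deriv]) auto
  then have smooth: "smooth_on {a..b} \<tau>" by (rule smooth_on_subset) auto
  have int: "q integrable_on {c..e}" for c e by (intro integrable_continuous_interval qc)
  have \<tau>: "\<tau> s = T + integral {a..s} q" "\<tau> s = T + l - integral {s..b} q" if "s \<in> {a..b}" for s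
    using Henstock_Kurzweil_Integration.integral_combine[OF _ _ int, of "a - 1" a s] Henstock_Kurzweil_Integration.integral_combine[OF _ _ int, of a s b] q that
    unfolding \<tau>_def by auto
  have q0: "integral {c..e} q \<ge> 0" if "{c..e} \<subseteq> {a..b}" for c e
  proof (rule integral_nonneg[OF int])
    fix s assume "s \<in> {c..e}"
    then have "s \<in> {a..b}" using that by blast
    then show "q s \<ge> 0" using fq[of s] nonneg[of s] by simp
  qed
  show thesis
  proof (rule that[of \<tau> q])
    show "\<tau> a = T" unfolding \<tau>_def by simp
    show "\<tau> b = T + l" using \<tau>(1)[of b] q ab by simp
    show "\<tau> s \<in> {T..T + l}" if "s \<in> {a..b}" for s
      using \<tau>[OF that] q0[of a s] q0[of s b] that by simp
  qed (use smooth qc q fq deriv in auto)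
qed

context zermelo_navigation
begin

context
  fixes X Y :: "'m \<Rightarrow> 'e" and \<epsilon> :: real
  assumes X: "mild_wind X" and Y: "mild_wind Y" and shift: "wind_shift \<epsilon> X Y"
begin

text \<open>While \<open>\<sigma>\<close> is traversed with a clock that is faster than its length in the wind \<open>X\<close>, it is moved by the flow.
  The moved curve is slower than the same clock in the wind \<open>Y\<close>, so its length is less than the elapsed
  time \<open>l\<close>. The inequality is strict because the clock is strictly faster, which leaves room for a contradiction
  with minimality.\<close>

lemma transport_smooth:
  assumes \<sigma>: "smooth_curve M {a..b} \<sigma>" and ab: "a < b"
    and D: "\<And>s w. s \<in> {a..b} \<Longrightarrow> w \<in> {T..T + l} \<Longrightarrow> (\<epsilon> * w, \<sigma> s) \<in> D"
    and l: "wind_length X a b \<sigma> < l"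
  shows "wind_dist Y (\<phi> (\<epsilon> * T) (\<sigma> a)) (\<phi> (\<epsilon> * (T + l)) (\<sigma> b)) < ereal l"
proof -
  let ?f = "\<lambda>s. randers X (\<sigma> s) (velocity M {a..b} \<sigma> s)"
  obtain \<tau> q where \<tau>: "smooth_on {a..b} \<tau>" "continuous_on {a..b} q" "integral {a..b} q = l"
    "\<And>s. s \<in> {a..b} \<Longrightarrow> ?f s < q s" "\<And>s. s \<in> {a..b} \<Longrightarrow> (\<tau> has_real_derivative q s) (at s)"
    "\<tau> a = T" "\<tau> b = T + l" "\<And>s. s \<in> {a..b} \<Longrightarrow> \<tau> s \<in> {T..T + l}"
    using exists_clock[OF ab speed_continuous[OF X \<sigma> ab] l[unfolded curve_length_def] randers_nonneg[OF X]]
    by metis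
  define \<beta> where "\<beta> s = \<phi> (\<epsilon> * \<tau> s) (\<sigma> s)" for s
  have inD: "(\<epsilon> * \<tau> s, \<sigma> s) \<in> D" if "s \<in> {a..b}" for s using D \<tau>(8) that by blast
  have mult: "smooth_on UNIV (\<lambda>x::real. \<epsilon> * x)"
    by (intro smooth_on_open Ck_on_linear bounded_linear_mult_right) auto
  have "smooth_on {a..b} (\<lambda>s. \<epsilon> * \<tau> s)" by (rule smooth_on_compose[OF \<tau>(1) mult]) simp
  then have smooth: "smooth_curve M {a..b} \<beta>"
    unfolding \<beta>_def by (rule moved_curve_smooth[OF \<sigma>]) (rule inD)
  have speed: "randers Y (\<beta> s) (velocity M {a..b} \<beta> s) < q s" if s: "s \<in> {a..b}" for s
  proof -
    let ?V = "velocity M {a..b} \<sigma> s"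
    have "((\<lambda>s. \<epsilon> * \<tau> s) has_real_derivative \<epsilon> * q s) (at s within {a..b})"
      by (rule DERIV_cmult[OF has_field_derivative_at_within[OF \<tau>(5)[OF s]]])
    then have "((\<lambda>s. \<epsilon> * \<tau> s) has_vector_derivative \<epsilon> * q s) (at s within {a..b})"
      by (simp add: has_real_derivative_iff_has_vector_derivative)
    from moved_curve_velocity[OF smooth_curve_has_velocity[OF \<sigma> ab s] this s inD[OF s]]
    have "velocity M {a..b} \<beta> s =
        (\<epsilon> * q s) *\<^sub>R W (\<beta> s) + differential_at M (\<phi> (\<epsilon> * \<tau> s)) (\<sigma> s) ?V"
      unfolding \<beta>_def by (rule has_velocity_imp_velocity[OF _ ab s])
    then show ?thesis
      using shift_less[OF X Y shift inD[OF s] \<tau>(4)[OF s]] unfolding \<beta>_def by simp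
  qed
  have "wind_length Y a b \<beta> < integral {a..b} q"
    unfolding curve_length_def
    by (rule integral_less_real[OF speed_continuous[OF Y smooth ab] \<tau>(2)]) (use ab speed in auto)
  then have "ereal (wind_length Y a b \<beta>) < ereal l" using \<tau>(3) by simp
  moreover have "\<beta> a = \<phi> (\<epsilon> * T) (\<sigma> a)" "\<beta> b = \<phi> (\<epsilon> * (T + l)) (\<sigma> b)"
    unfolding \<beta>_def using \<tau> by simp_all
  ultimately show ?thesis
    using finsler_dist_le_length[OF Y smooth_imp_piecewise_smooth[OF smooth] ab] by (simp add: le_less_trans)
qed

lemma transport_piecewise:
  assumes \<sigma>: "piecewise_smooth_curve M a b \<sigma>" and ab: "a < b"
    and D: "\<And>s w. s \<in> {a..b} \<Longrightarrow> w \<in> {T..T + l} \<Longrightarrow> (\<epsilon> * w, \<sigma> s) \<in> D"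
    and l: "wind_length X a b \<sigma> < l"
  shows "wind_dist Y (\<phi> (\<epsilon> * T) (\<sigma> a)) (\<phi> (\<epsilon> * (T + l)) (\<sigma> b)) < ereal l"
proof -
  let ?L = "\<lambda>s t. wind_length X s t \<sigma>"
  let ?d = "wind_dist Y"
  let ?Q = "\<lambda>s t. rectifiable (randers X) s t \<sigma> \<and>
    (\<forall>U k. T \<le> U \<and> U + k \<le> T + l \<and> ?L s t < k \<longrightarrow>
      ?d (\<phi> (\<epsilon> * U) (\<sigma> s)) (\<phi> (\<epsilon> * (U + k)) (\<sigma> t)) < ereal k)"
  have "?Q a b"
  proof (rule piecewise_smooth_induct[OF \<sigma> ab])
    fix s t assume st: "a \<le> s" "s < t" "t \<le> b" and smooth: "smooth_curve M {s..t} \<sigma>"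
    have "?d (\<phi> (\<epsilon> * U) (\<sigma> s)) (\<phi> (\<epsilon> * (U + k)) (\<sigma> t)) < ereal k"
      if "T \<le> U" "U + k \<le> T + l" "?L s t < k" for U k
      by (rule transport_smooth[OF smooth st(2) _ that(3)]) (use D that st in auto)
    then show "?Q s t" using smooth_rectifiable[OF X smooth st(2)] by blast
  next
    fix s t u assume st: "s < t" "t < u" and Q: "?Q s t" "?Q t u"
    have rect: "rectifiable (randers X) s u \<sigma>" and len: "?L s u = ?L s t + ?L t u"
      using curve_length_combine[of s t u "randers X" \<sigma>] Q st by auto
    have "?d (\<phi> (\<epsilon> * U) (\<sigma> s)) (\<phi> (\<epsilon> * (U + k)) (\<sigma> u)) < ereal k"
      if k: "T \<le> U" "U + k \<le> T + l" "?L s u < k" for U k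
    proof -
      \<comment> \<open>Each of the two pieces gets half of the surplus of time.\<close>
      define k1 where "k1 = ?L s t + (k - ?L s u) / 2"
      define k2 where "k2 = ?L t u + (k - ?L s u) / 2"
      have k12: "k1 + k2 = k" "?L s t < k1" "?L t u < k2"
        using k(3) unfolding k1_def k2_def len by (auto simp: field_simps)
      have pos: "?L s t \<ge> 0" "?L t u \<ge> 0" using curve_length_nonneg[OF X] by auto
      have U: "U + k1 + k2 = U + k" using k12(1) by simp
      let ?z = "\<phi> (\<epsilon> * (U + k1)) (\<sigma> t)"
      have 1: "?d (\<phi> (\<epsilon> * U) (\<sigma> s)) ?z < ereal k1"
        using Q(1) k k12 pos by auto
      have 2: "?d ?z (\<phi> (\<epsilon> * (U + k)) (\<sigma> u)) < ereal k2"
        using Q(2)[THEN conjunct2, rule_format, of "U + k1" k2] k k12 pos unfolding U by auto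
      have "?d (\<phi> (\<epsilon> * U) (\<sigma> s)) (\<phi> (\<epsilon> * (U + k)) (\<sigma> u)) \<le>
          ?d (\<phi> (\<epsilon> * U) (\<sigma> s)) ?z + ?d ?z (\<phi> (\<epsilon> * (U + k)) (\<sigma> u))"
        by (rule finsler_dist_triangle[OF Y])
      also have "\<dots> < ereal k1 + ereal k2"
        by (rule ereal_add_strict_mono2[OF 1 2])
      finally show ?thesis using k12(1) by simp
    qed
    with rect show "?Q s u" by blast
  qed
  then show ?thesis using l by simp
qed

end

text \<open>The length of a unit speed curve is the elapsed time. Being locally shortest thus becomes a condition on
  distances alone, and these can be compared by transport.\<close>

lemma unit_speed_length:
  assumes "unit_speed M F b \<gamma>" "0 \<le> s1" "s1 \<le> s2" "s2 \<le> b"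
  shows "curve_length M F s1 s2 \<gamma> = s2 - s1"
proof -
  have "((\<lambda>t. F (\<gamma> t) (velocity M {s1..s2} \<gamma> t)) has_integral (s2 - s1)) {s1..s2}"
  proof (rule has_integral_spike_finite[of "{s1, s2}" _ _ "\<lambda>t. 1"])
    fix t assume "t \<in> {s1..s2} - {s1, s2}"
    then have "s1 < t" "t < s2" "0 < t" "t < b" using assms by auto
    then have "velocity M {s1..s2} \<gamma> t = velocity M {0..b} \<gamma> t" by (simp add: velocity_interior)
    then show "F (\<gamma> t) (velocity M {s1..s2} \<gamma> t) = 1"
      using assms(1) \<open>0 < t\<close> \<open>t < b\<close> unfolding unit_speed_def by simp
  qed (use has_integral_const_real[of "1::real" s1 s2] assms in simp_all)
  then show ?thesis unfolding curve_length_def by (rule integral_unique)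
qed

definition shortest_near :: "('m \<Rightarrow> 'e \<Rightarrow> real) \<Rightarrow> real \<Rightarrow> (real \<Rightarrow> 'm) \<Rightarrow> real \<Rightarrow> real \<Rightarrow> bool" where
  "shortest_near F b \<gamma> t e \<longleftrightarrow>
     (\<forall>s1 s2. s1 \<in> {0..b} \<and> s2 \<in> {0..b} \<and> \<bar>s1 - t\<bar> < e \<and> \<bar>s2 - t\<bar> < e \<and> s1 \<le> s2 \<longrightarrow>
       finsler_dist M F (\<gamma> s1) (\<gamma> s2) = ereal (s2 - s1))"

lemma unit_speed_geodesic_iff:
  assumes "unit_speed M F b \<gamma>" "smooth_curve M {0..b} \<gamma>"
  shows "geodesic M F b \<gamma> \<longleftrightarrow> (\<forall>t\<in>{0..b}. \<exists>e>0. shortest_near F b \<gamma> t e)"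
proof -
  have "{s1, s2} \<subseteq> {0..b} \<inter> {t - e<..<t + e} \<and> s1 \<le> s2 \<longleftrightarrow>
      s1 \<in> {0..b} \<and> s2 \<in> {0..b} \<and> \<bar>s1 - t\<bar> < e \<and> \<bar>s2 - t\<bar> < e \<and> s1 \<le> s2" for s1 s2 t e :: real
    by (auto simp: abs_less_iff)
  then show ?thesis
    unfolding geodesic_def shortest_near_def
    using assms(2) unit_speed_length[OF assms(1)] by simp
qed

lemma moved_unit_speed:
  assumes X: "mild_wind X" and Y: "mild_wind Y" and shift: "wind_shift \<epsilon> X Y" and b: "b > 0"
    and \<gamma>: "smooth_curve M {0..b} \<gamma>" "unit_speed M (randers X) b \<gamma>"
    and D: "\<And>t. t \<in> {0..b} \<Longrightarrow> (\<epsilon> * t, \<gamma> t) \<in> D"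
  shows "smooth_curve M {0..b} (\<lambda>t. \<phi> (\<epsilon> * t) (\<gamma> t))"
    "unit_speed M (randers Y) b (\<lambda>t. \<phi> (\<epsilon> * t) (\<gamma> t))"
    "velocity M {0..b} (\<lambda>t. \<phi> (\<epsilon> * t) (\<gamma> t)) 0 = \<epsilon> *\<^sub>R W (\<gamma> 0) + velocity M {0..b} \<gamma> 0"
proof -
  have "smooth_on {0..b} (\<lambda>x::real. \<epsilon> * x)"
    by (rule smooth_on_subset[of UNIV], intro smooth_on_open Ck_on_linear bounded_linear_mult_right) auto
  then show "smooth_curve M {0..b} (\<lambda>t. \<phi> (\<epsilon> * t) (\<gamma> t))"
    by (rule moved_curve_smooth[OF \<gamma>(1)]) (rule D)
  have v: "velocity M {0..b} (\<lambda>t. \<phi> (\<epsilon> * t) (\<gamma> t)) t =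
      \<epsilon> *\<^sub>R W (\<phi> (\<epsilon> * t) (\<gamma> t)) + differential_at M (\<phi> (\<epsilon> * t)) (\<gamma> t) (velocity M {0..b} \<gamma> t)"
    if t: "t \<in> {0..b}" for t
  proof -
    have "((\<lambda>s. \<epsilon> * s) has_vector_derivative \<epsilon>) (at t within {0..b})"
      by (auto intro!: derivative_eq_intros)
    from moved_curve_velocity[OF smooth_curve_has_velocity[OF \<gamma>(1) b t] this t D[OF t]]
    show ?thesis by (rule has_velocity_imp_velocity[OF _ b t])
  qed
  show "velocity M {0..b} (\<lambda>t. \<phi> (\<epsilon> * t) (\<gamma> t)) 0 = \<epsilon> *\<^sub>R W (\<gamma> 0) + velocity M {0..b} \<gamma> 0"
    using v[of 0] b by (simp add: flow_zero differential_zero)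
  show "unit_speed M (randers Y) b (\<lambda>t. \<phi> (\<epsilon> * t) (\<gamma> t))"
    unfolding unit_speed_def
  proof
    fix t assume t: "t \<in> {0..b}"
    have "randers X (\<gamma> t) (velocity M {0..b} \<gamma> t) = 1"
      using \<gamma>(2) t unfolding unit_speed_def by blast
    then show "randers Y (\<phi> (\<epsilon> * t) (\<gamma> t)) (velocity M {0..b} (\<lambda>t. \<phi> (\<epsilon> * t) (\<gamma> t)) t) = 1"
      using shift_eq[OF X Y shift D[OF t], of "velocity M {0..b} \<gamma> t"] unfolding v[OF t] by simp
  qed
qed

text \<open>If the moved curve \<open>\<beta>\<close> were not locally shortest, a shorter competitor between two of its points could be
  transported back by the opposite flow, with a clock that needs exactly the time between these two
  points. The result joins the corresponding points of \<open>\<gamma>\<close> in less time than \<open>\<gamma>\<close> needs.\<close>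

lemma moved_geodesic:
  assumes X: "mild_wind X" and Y: "mild_wind Y" and shift: "wind_shift \<epsilon> X Y"
    and unshift: "wind_shift (- \<epsilon>) Y X" and b: "b > 0"
    and \<gamma>: "geodesic M (randers X) b \<gamma>" "unit_speed M (randers X) b \<gamma>"
    and D: "\<And>t. t \<in> {0..b} \<Longrightarrow> (\<epsilon> * t, \<gamma> t) \<in> D"
  shows "geodesic M (randers Y) b (\<lambda>t. \<phi> (\<epsilon> * t) (\<gamma> t))"
proof -
  define \<beta> where "\<beta> t = \<phi> (\<epsilon> * t) (\<gamma> t)" for t
  have smooth: "smooth_curve M {0..b} \<gamma>" using \<gamma>(1) unfolding geodesic_def by blast
  have \<beta>: "smooth_curve M {0..b} \<beta>" "unit_speed M (randers Y) b \<beta>"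
    unfolding \<beta>_def by (rule moved_unit_speed[OF X Y shift b smooth \<gamma>(2) D]; assumption)+
  have inv: "(- \<epsilon> * t, \<beta> t) \<in> D" "\<phi> (- \<epsilon> * t) (\<beta> t) = \<gamma> t" if "t \<in> {0..b}" for t
    using flow_inverse[OF D[OF that]] unfolding \<beta>_def by simp_all
  have "\<exists>e>0. shortest_near (randers Y) b \<beta> t e" if t: "t \<in> {0..b}" for t
  proof -
    obtain e1 where e1: "e1 > 0" "shortest_near (randers X) b \<gamma> t e1"
      using \<gamma> t unfolding unit_speed_geodesic_iff[OF \<gamma>(2) smooth] by blast
    have "open ((\<lambda>z. (- \<epsilon> * fst z, snd z)) -` D)"
      by (intro open_vimage[OF D_open] continuous_intros)
    moreover have "(t, \<beta> t) \<in> (\<lambda>z. (- \<epsilon> * fst z, snd z)) -` D" using inv(1)[OF t] by simp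
    ultimately obtain I N where IN: "open I" "t \<in> I" "open N" "\<beta> t \<in> N"
        "I \<times> N \<subseteq> (\<lambda>z. (- \<epsilon> * fst z, snd z)) -` D"
      by (rule open_prod_elim) auto
    obtain e2 where e2: "e2 > 0" "ball t e2 \<subseteq> I" using openE[OF IN(1,2)] by blast
    have box: "(- \<epsilon> * w, q) \<in> D" if "\<bar>w - t\<bar> < e2" "q \<in> N" for w q
    proof -
      have "w \<in> I" using that(1) e2(2) by (auto simp: dist_real_def abs_minus_commute subset_iff)
      then show ?thesis using IN(5) that(2) by auto
    qed
    obtain N' \<eta> where N': "open N'" "\<beta> t \<in> N'" "\<eta> > 0"
      "\<And>\<sigma> c d s. piecewise_smooth_curve M c d \<sigma> \<Longrightarrow> c < d \<Longrightarrow> \<sigma> c \<in> N' \<Longrightarrow>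
        wind_length Y c d \<sigma> < \<eta> \<Longrightarrow> s \<in> {c..d} \<Longrightarrow> \<sigma> s \<in> N"
      using short_curves_stay_near[OF Y IN(3,4)] by metis
    have "continuous_on {0..b} \<beta>" using \<beta>(1) unfolding smooth_curve_def by blast
    then obtain K where K: "open K" "K \<inter> {0..b} = \<beta> -` N' \<inter> {0..b}"
      using N'(1) unfolding continuous_on_open_invariant by blast
    then have "t \<in> K" using t N'(2) by blast
    then obtain e3 where e3: "e3 > 0" "ball t e3 \<subseteq> K" using openE[OF K(1)] by blast
    have near: "\<beta> s \<in> N'" if "s \<in> {0..b}" "\<bar>s - t\<bar> < e3" for s
    proof -
      have "s \<in> K" using that(2) e3(2) by (auto simp: dist_real_def abs_minus_commute subset_iff)
      then show ?thesis using K(2) that(1) by blast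
    qed
    define e where "e = Min {e1, e2, e3, \<eta> / 2}"
    have e: "e > 0" "e \<le> e1" "e \<le> e2" "e \<le> e3" "e \<le> \<eta> / 2"
      unfolding e_def using e1 e2 e3 N'(3) by auto
    have "wind_dist Y (\<beta> s1) (\<beta> s2) = ereal (s2 - s1)"
      if s: "s1 \<in> {0..b}" "s2 \<in> {0..b}" "\<bar>s1 - t\<bar> < e" "\<bar>s2 - t\<bar> < e" "s1 \<le> s2" for s1 s2
    proof (cases "s1 = s2")
      case True
      then show ?thesis using finsler_dist_refl[OF Y] by (simp add: zero_ereal_def)
    next
      case False
      then have s12: "s1 < s2" using s(5) by simp
      have sub: "{s1..s2} \<subseteq> {0..b}" using s by auto
      have "wind_dist Y (\<beta> s1) (\<beta> s2) \<le> ereal (s2 - s1)"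
        using finsler_dist_le_length[OF Y smooth_imp_piecewise_smooth[OF smooth_curve_subset[OF \<beta>(1) sub]] s12]
          unit_speed_length[OF \<beta>(2), of s1 s2] s by simp
      moreover have "\<not> wind_dist Y (\<beta> s1) (\<beta> s2) < ereal (s2 - s1)"
      proof
        assume "wind_dist Y (\<beta> s1) (\<beta> s2) < ereal (s2 - s1)"
        then obtain \<sigma> where \<sigma>: "piecewise_smooth_curve M 0 1 \<sigma>" "\<sigma> 0 = \<beta> s1" "\<sigma> 1 = \<beta> s2"
            "wind_length Y 0 1 \<sigma> < s2 - s1"
          by (rule finsler_dist_lessE[OF Y])
        have "s2 - s1 < \<eta>" using s(3,4) e(5) by (simp add: abs_less_iff)
        then have N: "\<sigma> u \<in> N" if "u \<in> {0..1}" for u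
          using N'(4)[OF \<sigma>(1) _ _ _ that] near[OF s(1)] s(3) e(4) \<sigma>(2,4) by auto
        have "wind_dist X (\<phi> (- \<epsilon> * s1) (\<sigma> 0)) (\<phi> (- \<epsilon> * (s1 + (s2 - s1))) (\<sigma> 1))
            < ereal (s2 - s1)"
        proof (rule transport_piecewise[OF Y X unshift \<sigma>(1) _ _ \<sigma>(4)])
          fix u w :: real assume u: "u \<in> {0..1}" and w: "w \<in> {s1..s1 + (s2 - s1)}"
          have "\<bar>w - t\<bar> < e2" using w s(3,4) e(3) by (auto simp: abs_less_iff)
          then show "(- \<epsilon> * w, \<sigma> u) \<in> D" using box N[OF u] by blast
        qed simp
        then have "wind_dist X (\<gamma> s1) (\<gamma> s2) < ereal (s2 - s1)"
          using inv(2)[OF s(1)] inv(2)[OF s(2)] \<sigma>(2,3) by simp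
        moreover have "wind_dist X (\<gamma> s1) (\<gamma> s2) = ereal (s2 - s1)"
          using e1(2) s e(2) unfolding shortest_near_def by auto
        ultimately show False by simp
      qed
      ultimately show ?thesis by simp
    qed
    then have "shortest_near (randers Y) b \<beta> t e" unfolding shortest_near_def by blast
    then show ?thesis using e(1) by blast
  qed
  then have "geodesic M (randers Y) b \<beta>"
    using unit_speed_geodesic_iff[OF \<beta>(2,1)] by blast
  then show ?thesis unfolding \<beta>_def .
qed

end

section \<open>Orthogonality\<close>

lemma has_vector_derivative_imp_quotient_tendsto:
  assumes "(f has_vector_derivative d) (at_right 0)" "f 0 = 0"
  shows "((\<lambda>t. f t /\<^sub>R t) \<longlongrightarrow> d) (at_right (0::real))"
proof -
  have "((\<lambda>t. norm (f t - f 0 - (t - 0) *\<^sub>R d) / norm (t - 0)) \<longlongrightarrow> 0) (at_right 0)"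
    using assms(1) unfolding has_vector_derivative_def has_derivative_iff_norm by blast
  moreover have "\<forall>\<^sub>F t in at_right 0. norm (f t - f 0 - (t - 0) *\<^sub>R d) / norm (t - 0) = norm (f t /\<^sub>R t - d)"
  proof (rule eventually_at_right_less[THEN eventually_mono])
    fix t :: real assume t: "0 < t"
    then have "f t /\<^sub>R t - d = (f t - t *\<^sub>R d) /\<^sub>R t" by (simp add: algebra_simps)
    then show "norm (f t - f 0 - (t - 0) *\<^sub>R d) / norm (t - 0) = norm (f t /\<^sub>R t - d)"
      using t assms(2) by (simp add: divide_inverse mult.commute)
  qed
  ultimately have "((\<lambda>t. norm (f t /\<^sub>R t - d)) \<longlongrightarrow> 0) (at_right 0)"
    by (rule Lim_transform_eventually)
  then show ?thesis
    by (simp add: tendsto_norm_zero_iff LIM_zero_iff)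
qed

context smooth_manifold
begin

lemma from_chart_at: "from_chart M (chart_at M p) p V = V"
  using from_to_chart[OF chart_at_in, of p V] unfolding to_chart_at .

lemma velocity_open_interval:
  assumes "e > 0"
  shows "velocity M {-e<..<e} \<gamma> 0 = velocity M {-(e/2)..e/2} \<gamma> 0"
proof -
  have "velocity M {-e<..<e} \<gamma> 0 = velocity M UNIV \<gamma> 0"
    unfolding velocity_def using at_within_open[of 0 "{-e<..<e}"] assms by simp
  also have "\<dots> = velocity M {-(e/2)..e/2} \<gamma> 0"
    using velocity_interior[of "-(e/2)" 0 "e/2"] assms by simp
  finally show ?thesis .
qed

lemma tangent_toE:
  assumes "U \<in> tangent_to M A p"
  obtains c e where "e > 0" "has_velocity M c U 0 {-e..e}" "c ` {-e..e} \<subseteq> A" "c 0 = p"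
proof -
  obtain c e where c: "U = velocity M {-e<..<e} c 0" "0 < e" "smooth_curve M {-e<..<e} c"
    "c ` {-e<..<e} \<subseteq> A" "c 0 = p"
    using assms unfolding tangent_to_def by blast
  have sub: "{-(e/2)..e/2} \<subseteq> {-e<..<e}" using c(2) by auto
  show thesis
  proof (rule that[of "e/2" c])
    have "has_velocity M c (velocity M {-(e/2)..e/2} c 0) 0 {-(e/2)..e/2}"
      by (rule smooth_curve_has_velocity[OF smooth_curve_subset[OF c(3) sub]]) (use c(2) in auto)
    then show "has_velocity M c U 0 {-(e/2)..e/2}"
      unfolding c(1) velocity_open_interval[OF c(2)] .
    show "c ` {-(e/2)..e/2} \<subseteq> A" using c(4) sub by blast
  qed (use c in auto)
qed

lemma tangent_to_point:
  assumes "U \<in> tangent_to M {p} p"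
  shows "U = 0"
proof -
  obtain c e where c: "e > 0" "has_velocity M c U 0 {-e..e}" "c ` {-e..e} \<subseteq> {p}" "c 0 = p"
    by (rule tangent_toE[OF assms])
  have "has_velocity M (\<lambda>_. p) U 0 {-e..e}"
    by (rule has_velocity_cong[OF c(2)]) (use c in \<open>auto simp: image_subset_iff\<close>)
  moreover have "has_velocity M (\<lambda>_. p) 0 0 {-e..e}" unfolding has_velocity_def by simp
  ultimately show ?thesis
    using has_velocity_imp_velocity[of "\<lambda>_. p" U 0 "-e" e]
      has_velocity_imp_velocity[of "\<lambda>_. p" 0 0 "-e" e] c(1) by simp
qed

end

context riemannian_manifold
begin

context
  fixes X :: "'m \<Rightarrow> 'e"
  assumes X: "mild_wind X"
begin

text \<open>Implicit differentiation of the Zermelo condition suggests the value; it is verified here from the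
  explicit formula. In that formula the root is \<open>l + b\<close> at a vector of unit length.\<close>

lemma randers_has_derivative:
  assumes "randers X p V = 1"
  shows "1 + h p (V - X p) (X p) > 0"
    "((\<lambda>s. randers X p (V + s *\<^sub>R U)) has_real_derivative
      h p (V - X p) U / (1 + h p (V - X p) (X p))) (at 0)"
proof -
  define w where "w = h p (X p) (X p)"
  define l where "l = 1 - w"
  define b where "b = h p (X p) V"
  define v where "v = h p V V"
  have l: "l > 0" using mild_wind_lt_1[OF X, of p] unfolding l_def w_def by simp
  define S where "S = sqrt (b\<^sup>2 + l * v)"
  have "V \<noteq> 0" using assms randers_zero[OF X] by auto
  then have v: "v > 0" unfolding v_def by (rule h_pos)
  then have r: "b\<^sup>2 + l * v > 0" using l by (simp add: add_nonneg_pos)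
  have "(S - b) / l = 1"
    using assms unfolding randers_metric_def Let_def S_def l_def w_def b_def v_def .
  then have Sl: "S = l + b" using l by (simp add: field_simps)
  then have b_eq: "b = S - l" by simp
  have S: "S > 0" unfolding S_def using r by simp
  have lb: "1 + h p (V - X p) (X p) = l + b"
    unfolding l_def w_def b_def by (simp add: h_simps h_sym)
  show pos: "1 + h p (V - X p) (X p) > 0" unfolding lb using S Sl by simp
  have F: "randers X p (V + s *\<^sub>R U) =
      (sqrt ((b + s * h p (X p) U)\<^sup>2 + l * (v + 2 * s * h p V U + s\<^sup>2 * h p U U)) - (b + s * h p (X p) U)) / l" for s
    unfolding randers_metric_def Let_def l_def w_def b_def v_def
    by (simp add: h_simps h_sym[of p U V] power2_eq_square algebra_simps)
  have "((\<lambda>s. randers X p (V + s *\<^sub>R U)) has_real_derivative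
      ((2 * b * h p (X p) U + l * (2 * h p V U)) * (inverse S / 2) - h p (X p) U) / l) (at 0)"
    unfolding F
    by (rule derivative_eq_intros refl | use r l in \<open>simp add: S_def\<close>)+
  moreover have "((2 * b * h p (X p) U + l * (2 * h p V U)) * (inverse S / 2) - h p (X p) U) / l =
      h p (V - X p) U / (1 + h p (V - X p) (X p))"
    unfolding lb unfolding b_eq using S l by (simp add: h_simps field_simps)
  ultimately show "((\<lambda>s. randers X p (V + s *\<^sub>R U)) has_real_derivative
      h p (V - X p) U / (1 + h p (V - X p) (X p))) (at 0)" by simp
qed

text \<open>By homogeneity, \<open>F\<^sup>2 ((1 + t) V + s U) = (1 + t)\<^sup>2 F\<^sup>2 (V + s / (1 + t) U)\<close>. The derivative in \<open>s\<close> is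
  linear in \<open>1 + t\<close>, so that only the first derivative of \<open>F\<close> in the direction \<open>U\<close> remains.\<close>

lemma fundamental_tensor_self:
  assumes "randers X p V = 1"
  shows "fundamental_tensor (randers X) p V V U = h p (V - X p) U / (1 + h p (V - X p) (X p))"
proof -
  let ?F = "randers X p"
  define d where "d = h p (V - X p) U / (1 + h p (V - X p) (X p))"
  have d: "((\<lambda>s. (?F (V + s *\<^sub>R U))\<^sup>2) has_real_derivative 2 * d) (at 0)"
    using DERIV_power[OF randers_has_derivative(2)[OF assms, of U], of 2] assms unfolding d_def by simp
  have inner: "deriv (\<lambda>s. (?F (V + t *\<^sub>R V + s *\<^sub>R U))\<^sup>2) 0 = (1 + t) * (2 * d)" if t: "t > -1" for t
  proof (rule DERIV_imp_deriv)
    have "V + t *\<^sub>R V + s *\<^sub>R U = (1 + t) *\<^sub>R (V + (s / (1 + t)) *\<^sub>R U)" for s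
    proof -
      have "(1 + t) * (s / (1 + t)) = s" using t by simp
      then show ?thesis by (simp add: scaleR_add_right scaleR_add_left)
    qed
    then have eq: "(?F (V + t *\<^sub>R V + s *\<^sub>R U))\<^sup>2 = (1 + t)\<^sup>2 * (?F (V + (s / (1 + t)) *\<^sub>R U))\<^sup>2" for s
      using t by (simp add: randers_scale[OF X] power_mult_distrib)
    have "((\<lambda>s. s / (1 + t)) has_real_derivative 1 / (1 + t)) (at 0)"
      using t by (auto intro!: derivative_eq_intros)
    moreover have "((\<lambda>s. (?F (V + s *\<^sub>R U))\<^sup>2) has_real_derivative 2 * d) (at (0 / (1 + t)))"
      using d by simp
    ultimately have "((\<lambda>s. (?F (V + (s / (1 + t)) *\<^sub>R U))\<^sup>2) has_real_derivative 2 * d * (1 / (1 + t))) (at 0)"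
      by (rule DERIV_chain2[rotated])
    then have "((\<lambda>s. (1 + t)\<^sup>2 * (?F (V + (s / (1 + t)) *\<^sub>R U))\<^sup>2) has_real_derivative
        (1 + t)\<^sup>2 * (2 * d * (1 / (1 + t)))) (at 0)"
      by (rule DERIV_cmult)
    moreover have "(1 + t)\<^sup>2 * (2 * d * (1 / (1 + t))) = (1 + t) * (2 * d)"
      using t by (simp add: power2_eq_square)
    ultimately show "((\<lambda>s. (?F (V + t *\<^sub>R V + s *\<^sub>R U))\<^sup>2) has_real_derivative (1 + t) * (2 * d)) (at 0)"
      unfolding eq by simp
  qed
  have "((\<lambda>t. (1 + t) * (2 * d)) has_real_derivative 2 * d) (at 0)"
    by (auto intro!: derivative_eq_intros)
  then have "((\<lambda>t. deriv (\<lambda>s. (?F (V + t *\<^sub>R V + s *\<^sub>R U))\<^sup>2) 0) has_real_derivative 2 * d) (at 0)"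
    by (rule has_field_derivative_transform_within_open[of _ _ _ "{-1<..}"]) (use inner in auto)
  from DERIV_imp_deriv[OF this] show ?thesis
    unfolding fundamental_tensor_def d_def by simp
qed

text \<open>The indicatrix of \<open>F\<close> is the unit sphere of \<open>h\<close> translated by the wind, so the hyperplane tangent to it at \<open>V\<close>
  is \<open>h\<close>-orthogonal to \<open>V - X\<close>.\<close>

lemma finsler_orthogonal_iff:
  assumes "randers X p V = 1"
  shows "finsler_orthogonal M (randers X) A p V \<longleftrightarrow> riemannian_orthogonal M h A p (V - X p)"
proof -
  have "V \<noteq> 0" using assms randers_zero[OF X] by auto
  then show ?thesis
    unfolding finsler_orthogonal_def riemannian_orthogonal_def fundamental_tensor_self[OF assms]
    using randers_has_derivative(1)[OF assms] by simp
qed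

text \<open>The straight line in the chart serves as a competitor.\<close>

lemma finsler_dist_chord:
  assumes c: "c \<in> M" and sub: "closed_segment x y \<subseteq> snd c ` fst c"
    and bound: "\<And>z. z \<in> closed_segment x y \<Longrightarrow> chart_metric c (randers X) (z, y - x) \<le> L"
  shows "wind_dist X (chart_inv c x) (chart_inv c y) \<le> ereal L"
proof -
  define z where "z s = x + s *\<^sub>R (y - x)" for s :: real
  define \<gamma> where "\<gamma> s = chart_inv c (z s)" for s
  have z: "z s \<in> closed_segment x y" if "s \<in> {0..1}" for s
    using that unfolding z_def closed_segment_def by (auto simp: algebra_simps intro!: exI[of _ s])
  have \<gamma>c: "\<gamma> s \<in> fst c" "snd c (\<gamma> s) = z s" if "s \<in> {0..1}" for s
    using z[OF that] sub chart_inv_in[OF c] chart_inv_right[OF c] unfolding \<gamma>_def by blast+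
  have smooth: "smooth_curve M {0..1} \<gamma>"
  proof (rule smooth_curveI)
    have "smooth_on ({0..1} \<inter> UNIV) z" unfolding z_def by (rule smooth_on_affine)
    then have "smooth_on ({0..1} \<inter> UNIV) (\<lambda>s. snd c (\<gamma> s))"
      by (rule smooth_on_cong) (use \<gamma>c in auto)
    then show "\<exists>c N. c \<in> M \<and> open N \<and> u \<in> N \<and> (\<forall>s\<in>{0..1} \<inter> N. \<gamma> s \<in> fst c) \<and>
        smooth_on ({0..1} \<inter> N) (\<lambda>s. snd c (\<gamma> s))" for u
      using c \<gamma>c by (intro exI[of _ c] exI[of _ UNIV]) auto
  qed
  have speed: "randers X (\<gamma> s) (velocity M {0..1} \<gamma> s) \<le> L" if s: "s \<in> {0..1}" for s
  proof -
    have "(z has_vector_derivative (y - x)) (at s within {0..1})"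
      unfolding z_def by (auto intro!: derivative_eq_intros)
    then have "((\<lambda>s. snd c (\<gamma> s)) has_vector_derivative (y - x)) (at s within {0..1})"
      by (rule has_vector_derivative_transform[OF s, rotated]) (use \<gamma>c in auto)
    moreover have "continuous (at s within {0..1}) \<gamma>"
      using smooth s unfolding smooth_curve_def by (simp add: continuous_on_eq_continuous_within)
    ultimately have "has_velocity M \<gamma> (from_chart M c (\<gamma> s) (y - x)) s {0..1}"
      by (intro has_velocity_chartI[where \<gamma> = \<gamma> and t = s, OF c \<gamma>c(1)[OF s] s])
    from has_velocity_imp_velocity[OF this _ s]
    show ?thesis using bound[OF z[OF s]] unfolding chart_metric_def \<gamma>_def by simp
  qed
  have "wind_length X 0 1 \<gamma> \<le> integral {0..1::real} (\<lambda>s. L)"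
    unfolding curve_length_def
    by (rule integral_le[OF integrable_continuous_interval[OF speed_continuous[OF X smooth]]])
       (use speed in auto)
  then have "ereal (wind_length X 0 1 \<gamma>) \<le> ereal L" by simp
  moreover have "\<gamma> 0 = chart_inv c x" "\<gamma> 1 = chart_inv c y" unfolding \<gamma>_def z_def by simp_all
  ultimately show ?thesis
    using order_trans[OF finsler_dist_le_length[OF X smooth_imp_piecewise_smooth[OF smooth] zero_less_one], of "ereal L"]
    by simp
qed

text \<open>The first variation argument. If \<open>V - X\<close> were not orthogonal to some \<open>U\<close> tangent to \<open>A\<close>, moving the
  starting point along \<open>A\<close> with velocity \<open>kU\<close> for a suitable \<open>k\<close> would save time to first order: for small \<open>t\<close> the
  chord from the point of \<open>A\<close> at parameter \<open>kt\<close> to \<open>\<gamma> t\<close> has length about \<open>t F (V - kU) < t\<close>.\<close>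

lemma shortest_time_orthogonal:
  assumes \<gamma>: "smooth_curve M {0..b} \<gamma>" and b: "b > 0" and p: "\<gamma> 0 = p"
    and unit: "randers X p (velocity M {0..b} \<gamma> 0) = 1"
    and dist: "\<And>t. t \<in> {0..b} \<Longrightarrow> dist_from M (randers X) A (\<gamma> t) = ereal t"
  shows "riemannian_orthogonal M h A p (velocity M {0..b} \<gamma> 0 - X p)"
  unfolding riemannian_orthogonal_def
proof (rule ballI, rule ccontr)
  define V where "V = velocity M {0..b} \<gamma> 0"
  fix U assume U: "U \<in> tangent_to M A p" and "h p (velocity M {0..b} \<gamma> 0 - X p) U \<noteq> 0"
  then have ne: "h p (V - X p) U \<noteq> 0" unfolding V_def by simp
  obtain k where k: "randers X p (V - k *\<^sub>R U) < 1"
  proof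
    define B where "B = h p (V - X p) U"
    define C where "C = h p U U"
    have C: "C \<ge> 0" unfolding C_def by (rule h_nonneg)
    \<comment> \<open>The squared \<open>h\<close>-length to be made less than 1 is \<open>1 - 2kB + k\<^sup>2C\<close>; a denominator larger than \<open>C\<close> makes the
      linear term dominate, also for \<open>C = 0\<close>.\<close>
    define k where "k = B / (C + 1)"
    have "h p (V - X p) (V - X p) = 1"
      using zermelo_identity[OF X, of p V] unit unfolding V_def by simp
    then have "h p (V - k *\<^sub>R U - 1 *\<^sub>R X p) (V - k *\<^sub>R U - 1 *\<^sub>R X p) = 1 - 2 * k * B + k\<^sup>2 * C"
      unfolding B_def C_def by (simp add: h_simps h_sym power2_eq_square algebra_simps)
    moreover have "2 * k * B - k\<^sup>2 * C > 0"
    proof -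
      have "2 * k * B - k\<^sup>2 * C = B\<^sup>2 * (C + 2) / (C + 1)\<^sup>2"
      proof -
        define E where "E = C + 1"
        have E: "E > 0" "C = E - 1" using C unfolding E_def by auto
        show ?thesis unfolding k_def unfolding E(2) using E(1) by (simp add: field_simps power2_eq_square)
      qed
      also have "\<dots> > 0" using C ne unfolding B_def by (intro divide_pos_pos mult_pos_pos) auto
      finally show ?thesis .
    qed
    ultimately show "randers X p (V - k *\<^sub>R U) < 1"
      unfolding randers_less_iff[OF X] by simp
  qed
  define Z where "Z = V - k *\<^sub>R U"
  define m where "m = (1 + randers X p Z) / 2"
  have m: "randers X p Z < m" "m < 1" using k unfolding m_def Z_def by auto
  define c where "c = chart_at M p"
  have c: "c \<in> M" "p \<in> fst c" unfolding c_def by (rule chart_at_in)+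
  define x0 where "x0 = snd c p"
  have x0: "x0 \<in> snd c ` fst c" "chart_inv c x0 = p" using c unfolding x0_def by (auto simp: chart_inv_left)
  let ?G = "chart_metric c (randers X)"
  let ?O = "(snd c ` fst c) \<times> (UNIV :: 'e set)"
  have "?G (x0, Z) = randers X p Z"
    unfolding chart_metric_def using x0 from_chart_at[of p Z] unfolding c_def by simp
  moreover have "open (?G -` {..<m} \<inter> ?O)"
    using continuous_on_open_vimage[OF open_Times[OF chart_image_open[OF c(1)] open_UNIV], THEN iffD1,
        OF chart_metric_continuous[OF X c(1)], rule_format, OF open_lessThan] .
  ultimately obtain S T where ST: "open S" "open T" "(x0, Z) \<in> S \<times> T" "S \<times> T \<subseteq> ?G -` {..<m} \<inter> ?O"
    using m(1) x0(1) by (elim open_prod_elim[of _ "(x0, Z)"]) auto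
  obtain \<rho> where \<rho>: "\<rho> > 0" "ball x0 \<rho> \<subseteq> S" using openE[OF ST(1)] ST(3) by blast
  obtain a e where a: "e > 0" "has_velocity M a U 0 {-e..e}" "a ` {-e..e} \<subseteq> A" "a 0 = p"
    by (rule tangent_toE[OF U])
  define x where "x t = snd c (\<gamma> t)" for t
  define y where "y t = snd c (a (k * t))" for t
  have gv: "has_velocity M \<gamma> V 0 {0..b}"
    unfolding V_def using b by (intro smooth_curve_has_velocity[OF \<gamma>]) auto
  have at0: "at (0::real) within {0..b} = at_right 0" using b by (rule at_within_Icc_at_right)
  have xv: "(x has_vector_derivative V) (at_right 0)" and xc: "continuous (at_right 0) \<gamma>"
    using gv p unfolding has_velocity_def at0 x_def c_def by auto
  have "has_velocity M a U (k * 0 + 0) UNIV"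
    using a(1,2) at_within_interior[of 0 "{-e..e}"] unfolding has_velocity_def by simp
  then have "has_velocity M (\<lambda>t. a (k * t + 0)) (k *\<^sub>R U) 0 {0<..}"
    by (rule has_velocity_affine) simp
  then have yv: "(y has_vector_derivative k *\<^sub>R U) (at_right 0)" and yc: "continuous (at_right 0) (\<lambda>t. a (k * t))"
    using a(4) unfolding has_velocity_def y_def c_def by auto
  have "((\<lambda>t. x t - y t) has_vector_derivative Z) (at_right 0)"
    unfolding Z_def by (rule has_vector_derivative_diff[OF xv yv])
  then have q: "((\<lambda>t. (x t - y t) /\<^sub>R t) \<longlongrightarrow> Z) (at_right 0)"
    by (rule has_vector_derivative_imp_quotient_tendsto) (simp add: x_def y_def p a(4))
  have xl: "(x \<longlongrightarrow> x0) (at_right 0)" and yl: "(y \<longlongrightarrow> x0) (at_right 0)"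
    using has_vector_derivative_continuous[OF xv] has_vector_derivative_continuous[OF yv]
    unfolding continuous_within by (simp_all add: x_def y_def p a(4) x0_def)
  have small: "\<forall>\<^sub>F t in at_right (0::real). \<bar>k * t\<bar> < e"
  proof -
    have "((\<lambda>t. \<bar>k * t\<bar>) \<longlongrightarrow> \<bar>k * 0\<bar>) (at_right (0::real))" by (intro tendsto_intros)
    then show ?thesis using a(1) by (intro order_tendstoD(2)) simp
  qed
  have "\<forall>\<^sub>F t in at_right (0::real). 0 < t \<and> t < b \<and> \<bar>k * t\<bar> < e \<and> \<gamma> t \<in> fst c \<and> a (k * t) \<in> fst c \<and>
      x t \<in> ball x0 \<rho> \<and> y t \<in> ball x0 \<rho> \<and> (x t - y t) /\<^sub>R t \<in> T"
    by (intro eventually_conj eventually_at_right_less small eventually_at_right_real[OF b, THEN eventually_mono]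
          eventually_in_open[OF xc chart_open[OF c(1)]] eventually_in_open[OF yc chart_open[OF c(1)]]
          topological_tendstoD[OF xl] topological_tendstoD[OF yl] topological_tendstoD[OF q ST(2)])
       (use \<rho> ST(3) c(2) p a(4) in auto)
  from eventually_happens'[OF trivial_limit_at_right_real this]
  obtain t where t: "0 < t" "t < b" "\<bar>k * t\<bar> < e" "\<gamma> t \<in> fst c" "a (k * t) \<in> fst c"
      "x t \<in> ball x0 \<rho>" "y t \<in> ball x0 \<rho>" "(x t - y t) /\<^sub>R t \<in> T"
    by (elim exE conjE)
  have seg: "closed_segment (y t) (x t) \<subseteq> ball x0 \<rho>"
    by (rule closed_segment_subset[OF t(7,6) convex_ball])
  have "wind_dist X (chart_inv c (y t)) (chart_inv c (x t)) \<le> ereal (t * m)"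
  proof (rule finsler_dist_chord[OF c(1)])
    have "z \<in> snd c ` fst c" if "z \<in> S" for z
    proof -
      have "(z, Z) \<in> S \<times> T" using ST(3) that by simp
      then have "(z, Z) \<in> ?O" using ST(4) by blast
      then show ?thesis by (simp only: mem_Sigma_iff)
    qed
    then show "closed_segment (y t) (x t) \<subseteq> snd c ` fst c" using seg \<rho>(2) by blast
    fix z assume "z \<in> closed_segment (y t) (x t)"
    then have z: "z \<in> S" using seg \<rho>(2) by blast
    have zz: "(z, (x t - y t) /\<^sub>R t) \<in> ?G -` {..<m} \<inter> ?O" using ST(4) z t(8) by blast
    then have "?G (z, (x t - y t) /\<^sub>R t) \<le> m" and zc: "chart_inv c z \<in> fst c"
      using chart_inv_in[OF c(1)] by auto
    moreover have "?G (z, x t - y t) = t * ?G (z, (x t - y t) /\<^sub>R t)"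
    proof -
      have "x t - y t = t *\<^sub>R ((x t - y t) /\<^sub>R t)" using t(1) by simp
      then have "?G (z, x t - y t) = ?G (z, t *\<^sub>R ((x t - y t) /\<^sub>R t))" by (simp only:)
      also have "\<dots> = t * ?G (z, (x t - y t) /\<^sub>R t)"
        unfolding chart_metric_def case_prod_conv linear_scale[OF from_chart_linear[OF c(1) zc]]
          randers_scale[OF X less_imp_le[OF t(1)]] ..
      finally show ?thesis .
    qed
    ultimately show "?G (z, x t - y t) \<le> t * m" using t(1) by simp
  qed
  then have "wind_dist X (a (k * t)) (\<gamma> t) \<le> ereal (t * m)"
    unfolding x_def y_def using t(4,5) c(1) by (simp add: chart_inv_left)
  moreover have "a (k * t) \<in> A" using a(3) t(3) by (auto simp: abs_less_iff image_subset_iff)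
  then have "dist_from M (randers X) A (\<gamma> t) \<le> wind_dist X (a (k * t)) (\<gamma> t)"
    unfolding dist_from_def by (rule INF_lower)
  ultimately have "dist_from M (randers X) A (\<gamma> t) \<le> ereal (t * m)" by (rule order_trans[rotated])
  then have "ereal t \<le> ereal (t * m)" using dist[of t] t(1,2) by simp
  then show False using t(1) m(2) by simp
qed

end

end

section \<open>Wave rays and wavefronts\<close>

context zermelo_navigation
begin

lemma velocity_restrict:
  assumes "smooth_curve M {0..b} \<gamma>" "0 < a" "a \<le> b" "t \<in> {0..a}"
  shows "velocity M {0..a} \<gamma> t = velocity M {0..b} \<gamma> t"
  by (rule has_velocity_imp_velocity,
      rule has_velocity_within_subset[OF smooth_curve_has_velocity[OF assms(1)]])
     (use assms in auto)

lemma unit_speed_cong: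
  assumes "unit_speed M F b \<gamma>" "\<And>t. t \<in> {0..b} \<Longrightarrow> \<gamma> t = \<sigma> t"
  shows "unit_speed M F b \<sigma>"
  unfolding unit_speed_def
proof
  fix t assume t: "t \<in> {0..b}"
  have "F (\<gamma> t) (velocity M {0..b} \<gamma> t) = 1" using assms(1) t unfolding unit_speed_def by blast
  moreover have "velocity M {0..b} \<gamma> t = velocity M {0..b} \<sigma> t" by (rule velocity_cong[OF t assms(2)])
  ultimately show "F (\<sigma> t) (velocity M {0..b} \<sigma> t) = 1" using assms(2)[OF t] by simp
qed

lemma geodesic_cong:
  assumes \<gamma>: "geodesic M F b \<gamma>" "unit_speed M F b \<gamma>" and eq: "\<And>t. t \<in> {0..b} \<Longrightarrow> \<gamma> t = \<sigma> t"
  shows "geodesic M F b \<sigma>"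
proof -
  have s: "smooth_curve M {0..b} \<gamma>" using \<gamma>(1) unfolding geodesic_def by blast
  have s': "smooth_curve M {0..b} \<sigma>" by (rule smooth_curve_cong[OF s eq])
  have "shortest_near F b \<sigma> t e" if "shortest_near F b \<gamma> t e" for t e
    using that eq unfolding shortest_near_def by simp
  then show ?thesis
    using \<gamma>(1) unit_speed_geodesic_iff[OF \<gamma>(2) s] unit_speed_geodesic_iff[OF unit_speed_cong[OF \<gamma>(2) eq] s']
    by blast
qed

text \<open>For the wind \<open>W\<close> this is orthogonality for \<open>F\<close>, in still air it is orthogonality for \<open>h\<close>; in this common form
  the condition is invariant under the motion by the flow.\<close>

definition orthogonal_geodesic :: "('m \<Rightarrow> 'e) \<Rightarrow> 'm set \<Rightarrow> real \<Rightarrow> (real \<Rightarrow> 'm) \<Rightarrow> bool" where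
  "orthogonal_geodesic X A b \<gamma> \<longleftrightarrow>
     geodesic M (randers X) b \<gamma> \<and> unit_speed M (randers X) b \<gamma> \<and> \<gamma> 0 \<in> A \<and>
     riemannian_orthogonal M h A (\<gamma> 0) (velocity M {0..b} \<gamma> 0 - X (\<gamma> 0))"

lemma orthogonal_finsler_geodesic_iff:
  assumes "b > 0"
  shows "orthogonal_finsler_geodesic M (randers W) A b \<gamma> \<longleftrightarrow> orthogonal_geodesic W A b \<gamma>"
proof -
  have "randers W (\<gamma> 0) (velocity M {0..b} \<gamma> 0) = 1" if "unit_speed M (randers W) b \<gamma>"
    using that assms unfolding unit_speed_def by simp
  then show ?thesis
    unfolding orthogonal_finsler_geodesic_def orthogonal_geodesic_def
    using finsler_orthogonal_iff[OF W_mild] by blast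
qed

lemma orthogonal_riemannian_geodesic_iff:
  "orthogonal_riemannian_geodesic M h A b \<gamma> \<longleftrightarrow> orthogonal_geodesic (\<lambda>_. 0) A b \<gamma>"
  unfolding orthogonal_riemannian_geodesic_def orthogonal_geodesic_def randers_no_wind by simp

lemma orthogonal_geodesic_cong:
  assumes \<gamma>: "orthogonal_geodesic X A b \<gamma>" and b: "b > 0" and eq: "\<And>t. t \<in> {0..b} \<Longrightarrow> \<gamma> t = \<sigma> t"
  shows "orthogonal_geodesic X A b \<sigma>"
proof -
  have 0: "0 \<in> {0..b}" using b by simp
  have g: "geodesic M (randers X) b \<gamma>" "unit_speed M (randers X) b \<gamma>"
    and o: "\<gamma> 0 \<in> A" "riemannian_orthogonal M h A (\<gamma> 0) (velocity M {0..b} \<gamma> 0 - X (\<gamma> 0))"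
    using \<gamma> unfolding orthogonal_geodesic_def by blast+
  have "geodesic M (randers X) b \<sigma>" by (rule geodesic_cong[OF g eq])
  moreover have "unit_speed M (randers X) b \<sigma>" by (rule unit_speed_cong[OF g(2) eq])
  moreover have "velocity M {0..b} \<gamma> 0 = velocity M {0..b} \<sigma> 0" by (rule velocity_cong[OF 0 eq])
  ultimately show ?thesis unfolding orthogonal_geodesic_def using o eq[OF 0] by simp
qed

lemma orthogonal_geodesic_restrict:
  assumes \<gamma>: "orthogonal_geodesic X A b \<gamma>" and a: "0 < a" "a \<le> b"
  shows "orthogonal_geodesic X A a \<gamma>"
proof -
  let ?F = "randers X"
  have g: "geodesic M ?F b \<gamma>" "unit_speed M ?F b \<gamma>" using \<gamma> unfolding orthogonal_geodesic_def by blast+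
  have s: "smooth_curve M {0..b} \<gamma>" using g(1) unfolding geodesic_def by blast
  have s': "smooth_curve M {0..a} \<gamma>" by (rule smooth_curve_subset[OF s]) (use a in auto)
  have v: "velocity M {0..a} \<gamma> t = velocity M {0..b} \<gamma> t" if "t \<in> {0..a}" for t
    by (rule velocity_restrict[OF s a that])
  have u: "unit_speed M ?F a \<gamma>" using g(2) a v unfolding unit_speed_def by simp
  have "shortest_near ?F a \<gamma> t e" if "shortest_near ?F b \<gamma> t e" for t e
    using that a unfolding shortest_near_def by auto
  moreover have "{0..a} \<subseteq> {0..b}" using a by auto
  ultimately have "geodesic M ?F a \<gamma>"
    using g(1) unfolding unit_speed_geodesic_iff[OF g(2) s] unit_speed_geodesic_iff[OF u s'] by blast
  then show ?thesis
    using \<gamma> u v[of 0] a unfolding orthogonal_geodesic_def by simp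
qed

text \<open>The initial velocity changes by \<open>\<epsilon> W\<close>, and so does the wind at the starting point, which the flow has not
  yet moved.\<close>

lemma moved_orthogonal_geodesic:
  assumes X: "mild_wind X" and Y: "mild_wind Y" and shift: "wind_shift \<epsilon> X Y"
    and unshift: "wind_shift (- \<epsilon>) Y X" and b: "b > 0" and \<gamma>: "orthogonal_geodesic X A b \<gamma>"
    and D: "\<And>t. t \<in> {0..b} \<Longrightarrow> (\<epsilon> * t, \<gamma> t) \<in> D"
  shows "orthogonal_geodesic Y A b (\<lambda>t. \<phi> (\<epsilon> * t) (\<gamma> t))"
proof -
  have g: "geodesic M (randers X) b \<gamma>" "unit_speed M (randers X) b \<gamma>"
    using \<gamma> unfolding orthogonal_geodesic_def by blast+
  have s: "smooth_curve M {0..b} \<gamma>" using g(1) unfolding geodesic_def by blast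
  have "Y (\<gamma> 0) = \<epsilon> *\<^sub>R W (\<gamma> 0) + X (\<gamma> 0)"
    using shift zero_in_D[of "\<gamma> 0"] unfolding wind_shift_def by (metis differential_zero flow_zero)
  moreover have "velocity M {0..b} (\<lambda>t. \<phi> (\<epsilon> * t) (\<gamma> t)) 0 = \<epsilon> *\<^sub>R W (\<gamma> 0) + velocity M {0..b} \<gamma> 0"
    by (rule moved_unit_speed(3)[OF X Y shift b s g(2) D])
  ultimately have "velocity M {0..b} (\<lambda>t. \<phi> (\<epsilon> * t) (\<gamma> t)) 0 - Y (\<gamma> 0) = velocity M {0..b} \<gamma> 0 - X (\<gamma> 0)"
    by simp
  moreover have "geodesic M (randers Y) b (\<lambda>t. \<phi> (\<epsilon> * t) (\<gamma> t))"
    by (rule moved_geodesic[OF X Y shift unshift b g D])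
  moreover have "unit_speed M (randers Y) b (\<lambda>t. \<phi> (\<epsilon> * t) (\<gamma> t))"
    by (rule moved_unit_speed(2)[OF X Y shift b s g(2) D])
  ultimately show ?thesis
    using \<gamma> unfolding orthogonal_geodesic_def by (simp add: flow_zero)
qed

context
  fixes A :: "'m set" and r :: real
  assumes stop: "no_cut_before M h W D A r"
begin

lemma wind_geodesic_extends:
  assumes "b \<in> {0<..r}" "orthogonal_geodesic W A b \<gamma>"
  obtains \<sigma> where "\<And>t. t \<in> {0..b} \<Longrightarrow> \<sigma> t = \<gamma> t"
    "\<And>t. t \<in> {0..r} \<Longrightarrow> dist_from M (randers W) A (\<sigma> t) = ereal t \<and> (-t, \<sigma> t) \<in> D"
  using stop assms unfolding no_cut_before_def
  by (metis greaterThanAtMost_iff orthogonal_finsler_geodesic_iff)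

lemma wind_geodesic_dist:
  assumes b: "b \<in> {0<..r}" and \<gamma>: "orthogonal_geodesic W A b \<gamma>" and t: "t \<in> {0..b}"
  shows "dist_from M (randers W) A (\<gamma> t) = ereal t" "(-t, \<gamma> t) \<in> D"
proof -
  obtain \<sigma> where "\<And>t. t \<in> {0..b} \<Longrightarrow> \<sigma> t = \<gamma> t"
    "\<And>t. t \<in> {0..r} \<Longrightarrow> dist_from M (randers W) A (\<sigma> t) = ereal t \<and> (-t, \<sigma> t) \<in> D"
    using wind_geodesic_extends[OF b \<gamma>] by metis
  from this(1)[OF t] this(2)[of t] show "dist_from M (randers W) A (\<gamma> t) = ereal t" "(-t, \<gamma> t) \<in> D"
    using b t by auto
qed

lemma still_geodesic_domain:
  assumes b: "b \<in> {0<..r}" and \<gamma>: "orthogonal_geodesic (\<lambda>_. 0) A b \<gamma>" and t: "t \<in> {0..b}"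
  shows "(t, \<gamma> t) \<in> D"
proof -
  have "\<exists>\<sigma>. orthogonal_riemannian_geodesic M h A r \<sigma> \<and> (\<forall>t\<in>{0..b}. \<sigma> t = \<gamma> t) \<and> (\<forall>t\<in>{0..r}. (t, \<sigma> t) \<in> D)"
    using stop b \<gamma> unfolding no_cut_before_def orthogonal_riemannian_geodesic_iff by blast
  then obtain \<sigma> where "\<forall>t\<in>{0..b}. \<sigma> t = \<gamma> t" "\<forall>t\<in>{0..r}. (t, \<sigma> t) \<in> D" by blast
  moreover have "t \<in> {0..r}" using b t by simp
  ultimately show ?thesis using t by metis
qed

lemma orthogonal_geodesic_iff_moved:
  assumes b: "b \<in> {0<..r}"
  shows "orthogonal_geodesic W A b \<gamma> \<longleftrightarrow>
    (\<exists>\<gamma>h. orthogonal_geodesic (\<lambda>_. 0) A b \<gamma>h \<and> (\<forall>t\<in>{0..b}. \<gamma> t = \<phi> t (\<gamma>h t)))"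
proof
  have b0: "b > 0" using b by simp
  {
    assume \<gamma>: "orthogonal_geodesic W A b \<gamma>"
    note D = wind_geodesic_dist(2)[OF b \<gamma>]
    have "orthogonal_geodesic (\<lambda>_. 0) A b (\<lambda>t. \<phi> (- 1 * t) (\<gamma> t))"
      by (rule moved_orthogonal_geodesic[OF W_mild no_wind_mild wind_shift_off _ b0 \<gamma>])
         (use wind_shift_on D in simp_all)
    moreover have "\<forall>t\<in>{0..b}. \<gamma> t = \<phi> t (\<phi> (- 1 * t) (\<gamma> t))"
      using flow_inverse(2)[OF D] by simp
    ultimately show "\<exists>\<gamma>h. orthogonal_geodesic (\<lambda>_. 0) A b \<gamma>h \<and> (\<forall>t\<in>{0..b}. \<gamma> t = \<phi> t (\<gamma>h t))" by blast
  next
    assume "\<exists>\<gamma>h. orthogonal_geodesic (\<lambda>_. 0) A b \<gamma>h \<and> (\<forall>t\<in>{0..b}. \<gamma> t = \<phi> t (\<gamma>h t))"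
    then obtain \<gamma>h where \<gamma>h: "orthogonal_geodesic (\<lambda>_. 0) A b \<gamma>h" "\<forall>t\<in>{0..b}. \<gamma> t = \<phi> t (\<gamma>h t)" by blast
    have "orthogonal_geodesic W A b (\<lambda>t. \<phi> (1 * t) (\<gamma>h t))"
      by (rule moved_orthogonal_geodesic[OF no_wind_mild W_mild wind_shift_on _ b0 \<gamma>h(1)])
         (use wind_shift_off still_geodesic_domain[OF b \<gamma>h(1)] in simp_all)
    then show "orthogonal_geodesic W A b \<gamma>"
      by (rule orthogonal_geodesic_cong[OF _ b0]) (use \<gamma>h(2) in simp)
  }
qed

text \<open>The distance from \<open>A\<close> grows along a wave ray as fast as its length, so by the triangle inequality the ray is
  shortest between any two of its points; orthogonality is the first variation. Conversely, orthogonal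
  geodesics are wave rays by the standing assumption on the time \<open>r\<close>.\<close>

lemma wave_ray_iff:
  assumes b: "b \<in> {0<..r}"
  shows "wave_ray M (randers W) A b \<gamma> \<longleftrightarrow> orthogonal_geodesic W A b \<gamma>"
proof
  have b0: "b > 0" using b by simp
  {
    assume \<gamma>: "wave_ray M (randers W) A b \<gamma>"
    then have s: "smooth_curve M {0..b} \<gamma>" and u: "unit_speed M (randers W) b \<gamma>" and A: "\<gamma> 0 \<in> A"
      and dist: "\<And>t. t \<in> {0..b} \<Longrightarrow> dist_from M (randers W) A (\<gamma> t) = ereal t"
      unfolding wave_ray_def by blast+
    have u0: "randers W (\<gamma> 0) (velocity M {0..b} \<gamma> 0) = 1"
      using u b0 unfolding unit_speed_def by simp
    have "wind_dist W (\<gamma> s1) (\<gamma> s2) = ereal (s2 - s1)"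
      if st: "s1 \<in> {0..b}" "s2 \<in> {0..b}" "s1 \<le> s2" for s1 s2
    proof (cases "s1 = s2")
      case True
      then show ?thesis using finsler_dist_refl[OF W_mild] by (simp add: zero_ereal_def)
    next
      case False
      have "smooth_curve M {s1..s2} \<gamma>" by (rule smooth_curve_subset[OF s]) (use st in auto)
      then have "wind_dist W (\<gamma> s1) (\<gamma> s2) \<le> ereal (s2 - s1)"
        using finsler_dist_le_length[OF W_mild smooth_imp_piecewise_smooth] unit_speed_length[OF u, of s1 s2] st False
        by fastforce
      moreover have "ereal s2 \<le> ereal s1 + wind_dist W (\<gamma> s1) (\<gamma> s2)"
        using dist_from_triangle[OF W_mild, of A "\<gamma> s2" "\<gamma> s1"] dist st by simp
      ultimately show ?thesis
        by (cases "wind_dist W (\<gamma> s1) (\<gamma> s2)") auto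
    qed
    then have "shortest_near (randers W) b \<gamma> t 1" for t
      unfolding shortest_near_def by blast
    then have "geodesic M (randers W) b \<gamma>"
      unfolding unit_speed_geodesic_iff[OF u s] using zero_less_one by blast
    then show "orthogonal_geodesic W A b \<gamma>"
      unfolding orthogonal_geodesic_def
      using u A shortest_time_orthogonal[OF W_mild s b0 refl u0 dist] by blast
  next
    assume \<gamma>: "orthogonal_geodesic W A b \<gamma>"
    then show "wave_ray M (randers W) A b \<gamma>"
      unfolding wave_ray_def using wind_geodesic_dist(1)[OF b \<gamma>]
      unfolding orthogonal_geodesic_def geodesic_def by blast
  }
qed

lemma wavefront_eq:
  assumes \<tau>: "\<tau> \<in> {0<..r}"
  shows "wavefront M (randers W) A \<tau> =
    {\<phi> \<tau> (\<gamma>h \<tau>) | \<gamma>h. orthogonal_geodesic (\<lambda>_. 0) A \<tau> \<gamma>h}"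
proof (intro equalityI subsetI)
  fix q assume "q \<in> wavefront M (randers W) A \<tau>"
  then have q: "dist_from M (randers W) A q = ereal \<tau>" unfolding wavefront_def by simp
  then have "\<exists>\<sigma>. orthogonal_finsler_geodesic M (randers W) A r \<sigma> \<and> \<sigma> \<tau> = q"
    using stop \<tau> unfolding no_cut_before_def by (auto dest!: spec[of _ q])
  then obtain \<sigma> where \<sigma>: "orthogonal_geodesic W A r \<sigma>" "\<sigma> \<tau> = q"
    using \<tau> orthogonal_finsler_geodesic_iff[of r] by auto
  have "orthogonal_geodesic W A \<tau> \<sigma>" by (rule orthogonal_geodesic_restrict[OF \<sigma>(1)]) (use \<tau> in auto)
  then obtain \<gamma>h where "orthogonal_geodesic (\<lambda>_. 0) A \<tau> \<gamma>h" "\<forall>t\<in>{0..\<tau>}. \<sigma> t = \<phi> t (\<gamma>h t)"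
    using orthogonal_geodesic_iff_moved[OF \<tau>] by blast
  moreover have "\<tau> \<in> {0..\<tau>}" using \<tau> by simp
  ultimately show "q \<in> {\<phi> \<tau> (\<gamma>h \<tau>) | \<gamma>h. orthogonal_geodesic (\<lambda>_. 0) A \<tau> \<gamma>h}"
    using \<sigma>(2) by blast
next
  fix q assume "q \<in> {\<phi> \<tau> (\<gamma>h \<tau>) | \<gamma>h. orthogonal_geodesic (\<lambda>_. 0) A \<tau> \<gamma>h}"
  then obtain \<gamma>h where \<gamma>h: "orthogonal_geodesic (\<lambda>_. 0) A \<tau> \<gamma>h" "q = \<phi> \<tau> (\<gamma>h \<tau>)" by blast
  have "orthogonal_geodesic W A \<tau> (\<lambda>t. \<phi> t (\<gamma>h t))"
    using orthogonal_geodesic_iff_moved[OF \<tau>] \<gamma>h(1) by blast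
  from wind_geodesic_dist(1)[OF \<tau> this, of \<tau>]
  show "q \<in> wavefront M (randers W) A \<tau>" using \<tau> \<gamma>h(2) unfolding wavefront_def by simp
qed

end

end

theorem theorem3p5:
  fixes M :: "('m::{t2_space, second_countable_topology}, 'e::euclidean_space) chart set"
    and h :: "'m \<Rightarrow> 'e \<Rightarrow> 'e \<Rightarrow> real"
    and W :: "'m \<Rightarrow> 'e"
    and D :: "(real \<times> 'm) set"
    and \<phi> :: "real \<Rightarrow> 'm \<Rightarrow> 'm"
    and A :: "'m set"
    and r :: real
  assumes manifold: "smooth_atlas M"
    and metric: "riemannian_metric M h"
    and wind: "smooth_vector_field M W"
    and mild: "\<And>p. h p (W p) (W p) < 1"
    and flow: "is_flow M W D \<phi>"
    and killing: "killing_flow M \<phi> h"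
    and fire: "compact A" "smooth_submanifold M A"
    and stop: "no_cut_before M h W D A r"
  shows "(\<forall>p\<in>A. \<forall>b\<in>{0<..r}. \<forall>\<gamma>F.
            wave_ray M (randers_metric h W) A b \<gamma>F \<and> \<gamma>F 0 = p \<longleftrightarrow>
            (\<exists>\<gamma>h. geodesic M (riemannian_norm h) b \<gamma>h \<and> \<gamma>h 0 = p \<and>
               unit_speed M (riemannian_norm h) b \<gamma>h \<and>
               riemannian_orthogonal M h A p
                 (differential_at M (\<phi> 0) p (velocity M {0..b} \<gamma>h 0)) \<and>
               (\<forall>t\<in>{0..b}. \<gamma>F t = \<phi> t (\<gamma>h t))))
       \<and> (\<forall>p r'. no_cut_before M h W D {p} r' \<longrightarrow>
            (\<forall>\<tau>\<in>{0<..r'}. spherical_wavefront M (randers_metric h W) p \<tau> =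
               {\<phi> \<tau> (\<gamma>h \<tau>) | \<gamma>h. geodesic M (riemannian_norm h) \<tau> \<gamma>h \<and>
                  unit_speed M (riemannian_norm h) \<tau> \<gamma>h \<and> \<gamma>h 0 = p}))
       \<and> (\<forall>\<tau>\<in>{0<..r}. wavefront M (randers_metric h W) A \<tau> =
            {\<phi> \<tau> (\<gamma>h \<tau>) | \<gamma>h. geodesic M (riemannian_norm h) \<tau> \<gamma>h \<and> \<gamma>h 0 \<in> A \<and>
               riemannian_orthogonal M h A (\<gamma>h 0)
                 (differential_at M (\<phi> 0) (\<gamma>h 0) (velocity M {0..\<tau>} \<gamma>h 0)) \<and>
               unit_speed M (riemannian_norm h) \<tau> \<gamma>h})"
proof -
  interpret riemannian_manifold M h by unfold_locales (rule manifold metric)+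
  have W_mild: "mild_wind W" using wind mild unfolding mild_wind_def by blast
  interpret zermelo_navigation M h W D \<phi> by unfold_locales (rule W_mild flow killing)+
  have og: "orthogonal_geodesic (\<lambda>_. 0) B b \<gamma> \<longleftrightarrow> geodesic M (riemannian_norm h) b \<gamma> \<and> \<gamma> 0 \<in> B \<and>
      unit_speed M (riemannian_norm h) b \<gamma> \<and>
      riemannian_orthogonal M h B (\<gamma> 0) (differential_at M (\<phi> 0) (\<gamma> 0) (velocity M {0..b} \<gamma> 0))" for B b \<gamma>
    unfolding orthogonal_geodesic_def randers_no_wind differential_zero by auto
  have point: "riemannian_orthogonal M h {p} p V" for p V
    unfolding riemannian_orthogonal_def using tangent_to_point h_simps by metis
  show ?thesis
  proof (intro conjI ballI allI impI)
    fix p b \<gamma>F assume p: "p \<in> A" and b: "b \<in> {0<..r}"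
    have 0: "0 \<in> {0..b}" using b by simp
    show "wave_ray M (randers_metric h W) A b \<gamma>F \<and> \<gamma>F 0 = p \<longleftrightarrow>
            (\<exists>\<gamma>h. geodesic M (riemannian_norm h) b \<gamma>h \<and> \<gamma>h 0 = p \<and>
               unit_speed M (riemannian_norm h) b \<gamma>h \<and>
               riemannian_orthogonal M h A p
                 (differential_at M (\<phi> 0) p (velocity M {0..b} \<gamma>h 0)) \<and>
               (\<forall>t\<in>{0..b}. \<gamma>F t = \<phi> t (\<gamma>h t)))"
      unfolding wave_ray_iff[OF stop b] orthogonal_geodesic_iff_moved[OF stop b] og
      using p 0 flow_zero by metis
  next
    fix p r' \<tau> assume "no_cut_before M h W D {p} r'" "\<tau> \<in> {0<..r'}"
    then show "spherical_wavefront M (randers_metric h W) p \<tau> =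
               {\<phi> \<tau> (\<gamma>h \<tau>) | \<gamma>h. geodesic M (riemannian_norm h) \<tau> \<gamma>h \<and>
                  unit_speed M (riemannian_norm h) \<tau> \<gamma>h \<and> \<gamma>h 0 = p}"
      unfolding spherical_wavefront_def by (subst wavefront_eq) (auto simp: og point)
  next
    fix \<tau> assume "\<tau> \<in> {0<..r}"
    then show "wavefront M (randers_metric h W) A \<tau> =
            {\<phi> \<tau> (\<gamma>h \<tau>) | \<gamma>h. geodesic M (riemannian_norm h) \<tau> \<gamma>h \<and> \<gamma>h 0 \<in> A \<and>
               riemannian_orthogonal M h A (\<gamma>h 0)
                 (differential_at M (\<phi> 0) (\<gamma>h 0) (velocity M {0..\<tau>} \<gamma>h 0)) \<and>
               unit_speed M (riemannian_norm h) \<tau> \<gamma>h}"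
      unfolding wavefront_eq[OF stop \<open>\<tau> \<in> {0<..r}\<close>] og by auto
  qed
qed

end
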